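(* Let $\mathcal W$ be a $2$-rigid subcategory of $\mathcal B$ such that $\mathcal I\subsetneq \mathcal W$, and let $\mathcal G=\mathrm{Cone}(\mathcal W,\mathcal W)$ be the proper $2$-term subcategory induced by $\mathcal W$. Assume that the ideal quotient $\overline{\mathcal G}=\mathcal G/\Sigma\mathcal W$ is abelian. Then the assignment $$\Phi\colon (\mathcal X,\mathcal Y)\longmapsto (\mathcal X/\Sigma\mathcal W)\cap(\mathcal Y/\Sigma\mathcal W)$$ is a one-to-one correspondence from the first of the following sets to the second: (i) cotorsion pairs $(\mathcal X,\mathcal Y)$ in $\mathcal G$; (ii) support $\tau$-tilting subcategories of $\mathcal G/\Sigma\mathcal W$.
   Context: Ambient category: $k$ is a field and $(\mathcal B,\mathbb E,\mathfrak s)$ is a Krull-Schmidt, Hom-finite, $k$-linear extriangulated category (in the sense of Nakaoka-Palu) with enough projectives and enough injectives, satisfying condition (WIC): if a composite $A\xrightarrow{f}B\xrightarrow{g}C$ is a deflation then $g$ is a deflation, and if it is an inflation then $f$ is an inflation. $\mathcal P$ and $\mathcal I$ denote the subcategories of projective and of injective objects of $\mathcal B$. All subcategories are full and closed under isomorphisms. $\mathbb E$-triangles are written $A\to B\to C\dashrightarrow$, and $\mathbb E^i$ ($i\ge 1$, $\mathbb E^1=\mathbb E$) are the higher extension functors of $\mathcal B$. For subcategories $\mathcal B',\mathcal B''$: $\mathrm{Cone}(\mathcal B',\mathcal B'')$ is the subcategory of all $X$ admitting an $\mathbb E$-triangle $B'\to B''\to X\dashrightarrow$ with $B'\in\mathcal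 B'$, $B''\in\mathcal B''$; $\Sigma\mathcal B'=\mathrm{Cone}(\mathcal B',\mathcal I)$. A subcategory $\mathcal W$ is $2$-rigid if $\mathbb E^{i}(\mathcal W,\mathcal W)=0$ for $i=1,2$; the proper $2$-term subcategory induced by it is $\mathcal G=\mathrm{Cone}(\mathcal W,\mathcal W)$, which is regarded as an extriangulated subcategory of $\mathcal B$ (its $\mathbb E$-triangles are those of $\mathcal B$ with all terms in $\mathcal G$). A cotorsion pair in an extriangulated category $\mathcal C$ is a pair $(\mathcal X,\mathcal Y)$ of subcategories of $\mathcal C$ closed under direct summands such that $\mathbb E(\mathcal X,\mathcal Y)=0$ and every $C\in\mathcal C$ admits $\mathbb E$-triangles $Y_C\to X_C\to C\dashrightarrow$ and $C\to Y^C\to X^C\dashrightarrow$ in $\mathcal C$ with $X_C,X^C\in\mathcal X$ and $Y_C,Y^C\in\mathcal Y$. For a subcategory $\mathcal B'\subseteq\mathcal B$, $\overline{\mathcal B'}=\mathcal B'/\Sigma\mathcal W$ is the category with the same objects as $\mathcal B'$ and with morphisms $\mathrm{Hom}_{\mathcal B}(A,B)/[\Sigma\mathcal W](A,B)$, where $[\Sigma\mathcal W](A,B)$ is the subgroup of morphisms factoring through an object of $\Sigma\mathcal W$; $\overline f$ is the class of $f$. For $\mathcal X\subseteq\mathcal G$, $\overline{\mathcal X}$ is viewed as a full subcategory of $\overline{\mathcal G}$, taken up to isomorphism in $\overline{\mathcal G}$. A subcategory $\overline{\mathcal M}\subseteq\overline{\mathcal G}$ is $\tau$-rigid if every $M\in\overline{\mathcal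 M}$ admits an exact sequence $W_1\xrightarrow{\overline f}W_0\to M\to 0$ in $\overline{\mathcal G}$ with $W_1,W_0\in\overline{\mathcal W}$ such that $\mathrm{Hom}_{\overline{\mathcal B}}(\overline f,M')$ is surjective for every $M'\in\overline{\mathcal M}$. It is support $\tau$-tilting if it is $\tau$-rigid and every projective object $W$ of $\overline{\mathcal G}$ (the projectives being given by $\overline{\mathcal W}$) admits an exact sequence $W\xrightarrow{\overline m}M^0\to M^1\to 0$ with $M^0,M^1\in\overline{\mathcal M}$ and $\overline m$ a left $\overline{\mathcal M}$-approximation.
   Formalization: The subcategory W and the (support) τ-rigid subcategories are required to be closed under finite direct sums and direct summands; otherwise e.g. {k^n : n ≠ 1} in vect_k would be an extra support τ-tilting subcategory. *)

theory Defs
  imports "HOL-Algebra.AbelCoset" "HOL-Algebra.Module"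
begin

section \<open>Linear categories\<close>

text \<open>
  Hom-sets are modules over the ground field; the components \<open>mult\<close> and \<open>one\<close> that the record
  \<open>module\<close> inherits from \<open>ring\<close> are never used.  Hom-sets for different pairs of
  objects may overlap as sets, so composition carries its three objects:
  \<open>Comp C X Y Z g f\<close> is the composite of \<open>f : X \<rightarrow> Y\<close> and \<open>g : Y \<rightarrow> Z\<close>.
\<close>

record ('o, 'm, 'k) lcat =
  Ob :: "'o set"
  Hom :: "'o \<Rightarrow> 'o \<Rightarrow> ('k, 'm) module"
  Idm :: "'o \<Rightarrow> 'm"
  Comp :: "'o \<Rightarrow> 'o \<Rightarrow> 'o \<Rightarrow> 'm \<Rightarrow> 'm \<Rightarrow> 'm"

abbreviation mor :: "('o, 'm, 'k, 'z) lcat_scheme \<Rightarrow> 'o \<Rightarrow> 'o \<Rightarrow> 'm set" where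
  "mor C X Y \<equiv> carrier (Hom C X Y)"

locale linear_category = field K for K (structure) +
  fixes C :: "('o, 'm, 'k, 'z) lcat_scheme"
  assumes hom_module: "\<lbrakk>X \<in> Ob C; Y \<in> Ob C\<rbrakk> \<Longrightarrow> module K (Hom C X Y)"
    and id_closed: "X \<in> Ob C \<Longrightarrow> Idm C X \<in> mor C X X"
    and comp_closed:
      "\<lbrakk>X \<in> Ob C; Y \<in> Ob C; Z \<in> Ob C; f \<in> mor C X Y; g \<in> mor C Y Z\<rbrakk>
        \<Longrightarrow> Comp C X Y Z g f \<in> mor C X Z"
    and id_right: "\<lbrakk>X \<in> Ob C; Y \<in> Ob C; f \<in> mor C X Y\<rbrakk> \<Longrightarrow> Comp C X X Y f (Idm C X) = f"
    and id_left: "\<lbrakk>X \<in> Ob C; Y \<in> Ob C; f \<in> mor C X Y\<rbrakk> \<Longrightarrow> Comp C X Y Y (Idm C Y) f = f"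
    and comp_assoc:
      "\<lbrakk>X \<in> Ob C; Y \<in> Ob C; Z \<in> Ob C; U \<in> Ob C; f \<in> mor C X Y; g \<in> mor C Y Z; h \<in> mor C Z U\<rbrakk>
        \<Longrightarrow> Comp C X Z U h (Comp C X Y Z g f) = Comp C X Y U (Comp C Y Z U h g) f"
    and comp_add_right:
      "\<lbrakk>X \<in> Ob C; Y \<in> Ob C; Z \<in> Ob C; f \<in> mor C X Y; f' \<in> mor C X Y; g \<in> mor C Y Z\<rbrakk>
        \<Longrightarrow> Comp C X Y Z g (f \<oplus>\<^bsub>Hom C X Y\<^esub> f')
          = Comp C X Y Z g f \<oplus>\<^bsub>Hom C X Z\<^esub> Comp C X Y Z g f'"
    and comp_add_left:
      "\<lbrakk>X \<in> Ob C; Y \<in> Ob C; Z \<in> Ob C; f \<in> mor C X Y; g \<in> mor C Y Z; g' \<in> mor C Y Z\<rbrakk>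
        \<Longrightarrow> Comp C X Y Z (g \<oplus>\<^bsub>Hom C Y Z\<^esub> g') f
          = Comp C X Y Z g f \<oplus>\<^bsub>Hom C X Z\<^esub> Comp C X Y Z g' f"
    and comp_smult_right:
      "\<lbrakk>X \<in> Ob C; Y \<in> Ob C; Z \<in> Ob C; r \<in> carrier K; f \<in> mor C X Y; g \<in> mor C Y Z\<rbrakk>
        \<Longrightarrow> Comp C X Y Z g (r \<odot>\<^bsub>Hom C X Y\<^esub> f) = r \<odot>\<^bsub>Hom C X Z\<^esub> Comp C X Y Z g f"
    and comp_smult_left:
      "\<lbrakk>X \<in> Ob C; Y \<in> Ob C; Z \<in> Ob C; r \<in> carrier K; f \<in> mor C X Y; g \<in> mor C Y Z\<rbrakk>
        \<Longrightarrow> Comp C X Y Z (r \<odot>\<^bsub>Hom C Y Z\<^esub> g) f = r \<odot>\<^bsub>Hom C X Z\<^esub> Comp C X Y Z g f"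

definition is_iso :: "('o, 'm, 'k, 'z) lcat_scheme \<Rightarrow> 'o \<Rightarrow> 'o \<Rightarrow> 'm \<Rightarrow> bool" where
  "is_iso C X Y f \<longleftrightarrow> f \<in> mor C X Y \<and>
    (\<exists>g \<in> mor C Y X. Comp C X Y X g f = Idm C X \<and> Comp C Y X Y f g = Idm C Y)"

definition isomorphic :: "('o, 'm, 'k, 'z) lcat_scheme \<Rightarrow> 'o \<Rightarrow> 'o \<Rightarrow> bool" where
  "isomorphic C X Y \<longleftrightarrow> X \<in> Ob C \<and> Y \<in> Ob C \<and> (\<exists>f. is_iso C X Y f)"

definition zero_object :: "('o, 'm, 'k, 'z) lcat_scheme \<Rightarrow> 'o \<Rightarrow> bool" where
  "zero_object C Z \<longleftrightarrow> Z \<in> Ob C \<and>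
    (\<forall>X \<in> Ob C. (\<exists>!f. f \<in> mor C Z X) \<and> (\<exists>!f. f \<in> mor C X Z))"

text \<open>\<open>P\<close> is the biproduct of \<open>A\<close> and \<open>B\<close> with injections \<open>i, j\<close> and projections \<open>p, q\<close>.\<close>

definition biproduct ::
  "('o, 'm, 'k, 'z) lcat_scheme \<Rightarrow> 'o \<Rightarrow> 'o \<Rightarrow> 'o \<Rightarrow> 'm \<Rightarrow> 'm \<Rightarrow> 'm \<Rightarrow> 'm \<Rightarrow> bool" where
  "biproduct C A B P i j p q \<longleftrightarrow>
    A \<in> Ob C \<and> B \<in> Ob C \<and> P \<in> Ob C \<and>
    i \<in> mor C A P \<and> j \<in> mor C B P \<and> p \<in> mor C P A \<and> q \<in> mor C P B \<and>
    Comp C A P A p i = Idm C A \<and> Comp C B P B q j = Idm C B \<and>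
    Comp C B P A p j = \<zero>\<^bsub>Hom C B A\<^esub> \<and> Comp C A P B q i = \<zero>\<^bsub>Hom C A B\<^esub> \<and>
    Comp C P A P i p \<oplus>\<^bsub>Hom C P P\<^esub> Comp C P B P j q = Idm C P"

locale additive_category = linear_category K C
  for K (structure) and C :: "('o, 'm, 'k, 'z) lcat_scheme" +
  assumes ex_zero_object: "\<exists>Z. zero_object C Z"
    and ex_biproduct: "\<lbrakk>A \<in> Ob C; B \<in> Ob C\<rbrakk> \<Longrightarrow> \<exists>P i j p q. biproduct C A B P i j p q"

definition is_mono :: "('o, 'm, 'k, 'z) lcat_scheme \<Rightarrow> 'o \<Rightarrow> 'o \<Rightarrow> 'm \<Rightarrow> bool" where
  "is_mono C A B f \<longleftrightarrow> f \<in> mor C A B \<and>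
    (\<forall>X \<in> Ob C. \<forall>g \<in> mor C X A. \<forall>h \<in> mor C X A. Comp C X A B f g = Comp C X A B f h \<longrightarrow> g = h)"

definition is_epi :: "('o, 'm, 'k, 'z) lcat_scheme \<Rightarrow> 'o \<Rightarrow> 'o \<Rightarrow> 'm \<Rightarrow> bool" where
  "is_epi C A B f \<longleftrightarrow> f \<in> mor C A B \<and>
    (\<forall>X \<in> Ob C. \<forall>g \<in> mor C B X. \<forall>h \<in> mor C B X. Comp C A B X g f = Comp C A B X h f \<longrightarrow> g = h)"

text \<open>\<open>k : L \<rightarrow> A\<close> is a kernel, resp. \<open>c : B \<rightarrow> Q\<close> is a cokernel, of \<open>f : A \<rightarrow> B\<close>.\<close>

definition is_kernel ::
  "('o, 'm, 'k, 'z) lcat_scheme \<Rightarrow> 'o \<Rightarrow> 'o \<Rightarrow> 'm \<Rightarrow> 'o \<Rightarrow> 'm \<Rightarrow> bool" where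
  "is_kernel C A B f L k \<longleftrightarrow> f \<in> mor C A B \<and> L \<in> Ob C \<and> k \<in> mor C L A \<and>
    Comp C L A B f k = \<zero>\<^bsub>Hom C L B\<^esub> \<and>
    (\<forall>X \<in> Ob C. \<forall>g \<in> mor C X A. Comp C X A B f g = \<zero>\<^bsub>Hom C X B\<^esub> \<longrightarrow>
      (\<exists>!u. u \<in> mor C X L \<and> Comp C X L A k u = g))"

definition is_cokernel ::
  "('o, 'm, 'k, 'z) lcat_scheme \<Rightarrow> 'o \<Rightarrow> 'o \<Rightarrow> 'm \<Rightarrow> 'o \<Rightarrow> 'm \<Rightarrow> bool" where
  "is_cokernel C A B f Q c \<longleftrightarrow> f \<in> mor C A B \<and> Q \<in> Ob C \<and> c \<in> mor C B Q \<and>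
    Comp C A B Q c f = \<zero>\<^bsub>Hom C A Q\<^esub> \<and>
    (\<forall>X \<in> Ob C. \<forall>g \<in> mor C B X. Comp C A B X g f = \<zero>\<^bsub>Hom C A X\<^esub> \<longrightarrow>
      (\<exists>!u. u \<in> mor C Q X \<and> Comp C B Q X u c = g))"

locale abelian_category = additive_category K C
  for K (structure) and C :: "('o, 'm, 'k, 'z) lcat_scheme" +
  assumes ex_kernel: "\<lbrakk>A \<in> Ob C; B \<in> Ob C; f \<in> mor C A B\<rbrakk> \<Longrightarrow> \<exists>L k. is_kernel C A B f L k"
    and ex_cokernel: "\<lbrakk>A \<in> Ob C; B \<in> Ob C; f \<in> mor C A B\<rbrakk> \<Longrightarrow> \<exists>Q c. is_cokernel C A B f Q c"
    and mono_is_kernel: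
      "\<lbrakk>A \<in> Ob C; B \<in> Ob C; is_mono C A B f\<rbrakk> \<Longrightarrow> \<exists>Y \<in> Ob C. \<exists>g. is_kernel C B Y g A f"
    and epi_is_cokernel:
      "\<lbrakk>A \<in> Ob C; B \<in> Ob C; is_epi C A B f\<rbrakk> \<Longrightarrow> \<exists>X \<in> Ob C. \<exists>g. is_cokernel C X A g B f"

text \<open>
  Exactness of \<open>A \<rightarrow> B \<rightarrow> E\<close> at \<open>B\<close>: the image of \<open>f\<close>, i.e. the kernel \<open>k\<close> of the cokernel \<open>c\<close>
  of \<open>f\<close>, is a kernel of \<open>g\<close>.
\<close>

definition exact_at ::
  "('o, 'm, 'k, 'z) lcat_scheme \<Rightarrow> 'o \<Rightarrow> 'o \<Rightarrow> 'o \<Rightarrow> 'm \<Rightarrow> 'm \<Rightarrow> bool" where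
  "exact_at C A B E f g \<longleftrightarrow> A \<in> Ob C \<and> B \<in> Ob C \<and> E \<in> Ob C \<and>
    (\<exists>Q c I k. is_cokernel C A B f Q c \<and> is_kernel C B Q c I k \<and> is_kernel C B E g I k)"

text \<open>Exactness of \<open>A \<rightarrow> B \<rightarrow> E \<rightarrow> 0\<close>.\<close>

definition right_exact ::
  "('o, 'm, 'k, 'z) lcat_scheme \<Rightarrow> 'o \<Rightarrow> 'o \<Rightarrow> 'o \<Rightarrow> 'm \<Rightarrow> 'm \<Rightarrow> bool" where
  "right_exact C A B E f g \<longleftrightarrow> exact_at C A B E f g \<and>
    (\<exists>Z. zero_object C Z \<and> exact_at C B E Z g \<zero>\<^bsub>Hom C E Z\<^esub>)"

definition projective_object :: "('o, 'm, 'k, 'z) lcat_scheme \<Rightarrow> 'o \<Rightarrow> bool" where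
  "projective_object C P \<longleftrightarrow> P \<in> Ob C \<and>
    (\<forall>A \<in> Ob C. \<forall>B \<in> Ob C. \<forall>e. is_epi C A B e \<longrightarrow>
      (\<forall>f \<in> mor C P B. \<exists>g \<in> mor C P A. Comp C P A B e g = f))"

definition hom_finite ::
  "('k, 'r) ring_scheme \<Rightarrow> ('o, 'm, 'k, 'z) lcat_scheme \<Rightarrow> bool" where
  "hom_finite K C \<longleftrightarrow> (\<forall>X \<in> Ob C. \<forall>Y \<in> Ob C. \<exists>S. finite S \<and> S \<subseteq> mor C X Y \<and>
    (\<forall>f \<in> mor C X Y. \<exists>c \<in> S \<rightarrow> carrier K.
      f = (\<Oplus>\<^bsub>Hom C X Y\<^esub>s\<in>S. c s \<odot>\<^bsub>Hom C X Y\<^esub> s)))"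

text \<open>The endomorphism ring is local: it is nonzero and its non-units are closed under addition.\<close>

definition local_endo :: "('o, 'm, 'k, 'z) lcat_scheme \<Rightarrow> 'o \<Rightarrow> bool" where
  "local_endo C X \<longleftrightarrow> X \<in> Ob C \<and> Idm C X \<noteq> \<zero>\<^bsub>Hom C X X\<^esub> \<and>
    (\<forall>f \<in> mor C X X. \<forall>g \<in> mor C X X.
      \<not> is_iso C X X f \<and> \<not> is_iso C X X g \<longrightarrow> \<not> is_iso C X X (f \<oplus>\<^bsub>Hom C X X\<^esub> g))"

definition krull_schmidt :: "('o, 'm, 'k, 'z) lcat_scheme \<Rightarrow> bool" where
  "krull_schmidt C \<longleftrightarrow> (\<forall>X \<in> Ob C. \<exists>(n::nat) A i p.
    (\<forall>a<n. local_endo C (A a) \<and> i a \<in> mor C (A a) X \<and> p a \<in> mor C X (A a)) \<and>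
    (\<forall>a<n. \<forall>b<n. Comp C (A b) X (A a) (p a) (i b) =
      (if a = b then Idm C (A a) else \<zero>\<^bsub>Hom C (A b) (A a)\<^esub>)) \<and>
    (\<Oplus>\<^bsub>Hom C X X\<^esub>a\<in>{..<n}. Comp C X (A a) X (i a) (p a)) = Idm C X)"


section \<open>Subcategories and ideal quotients\<close>

text \<open>A full subcategory is represented by its set of objects.\<close>

definition strict_subcat :: "('o, 'm, 'k, 'z) lcat_scheme \<Rightarrow> 'o set \<Rightarrow> bool" where
  "strict_subcat C S \<longleftrightarrow> S \<subseteq> Ob C \<and> (\<forall>X \<in> S. \<forall>Y. isomorphic C X Y \<longrightarrow> Y \<in> S)"

definition summand_closed :: "('o, 'm, 'k, 'z) lcat_scheme \<Rightarrow> 'o set \<Rightarrow> bool" where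
  "summand_closed C S \<longleftrightarrow> (\<forall>A B P i j p q. biproduct C A B P i j p q \<and> P \<in> S \<longrightarrow> A \<in> S)"

definition sum_closed :: "('o, 'm, 'k, 'z) lcat_scheme \<Rightarrow> 'o set \<Rightarrow> bool" where
  "sum_closed C S \<longleftrightarrow> (\<forall>Z. zero_object C Z \<longrightarrow> Z \<in> S) \<and>
    (\<forall>A B P i j p q. biproduct C A B P i j p q \<and> A \<in> S \<and> B \<in> S \<longrightarrow> P \<in> S)"

definition additive_subcat :: "('o, 'm, 'k, 'z) lcat_scheme \<Rightarrow> 'o set \<Rightarrow> bool" where
  "additive_subcat C S \<longleftrightarrow> strict_subcat C S \<and> sum_closed C S \<and> summand_closed C S"

definition full_sub :: "('o, 'm, 'k, 'z) lcat_scheme \<Rightarrow> 'o set \<Rightarrow> ('o, 'm, 'k, 'z) lcat_scheme" where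
  "full_sub C S = C\<lparr>Ob := S\<rparr>"

definition iso_closure :: "('o, 'm, 'k, 'z) lcat_scheme \<Rightarrow> 'o set \<Rightarrow> 'o set" where
  "iso_closure C S = {Y. \<exists>X \<in> S. isomorphic C X Y}"

definition factor_ideal ::
  "('o, 'm, 'k, 'z) lcat_scheme \<Rightarrow> 'o set \<Rightarrow> 'o \<Rightarrow> 'o \<Rightarrow> 'm set" where
  "factor_ideal C D A B =
    {Comp C A X B h g | X g h. X \<in> D \<and> g \<in> mor C A X \<and> h \<in> mor C X B}"

text \<open>
  The quotient of the full subcategory \<open>S\<close> by the ideal of the morphisms of \<open>C\<close> that factor
  through \<open>D\<close>: its morphisms are the cosets of the ideal.
\<close>

definition ideal_quotient ::
  "('o, 'm, 'k, 'z) lcat_scheme \<Rightarrow> 'o set \<Rightarrow> 'o set \<Rightarrow> ('o, 'm set, 'k) lcat" where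
  "ideal_quotient C S D =
    \<lparr>Ob = S,
     Hom = (\<lambda>A B.
       \<lparr>carrier = a_rcosets\<^bsub>Hom C A B\<^esub> (factor_ideal C D A B),
        mult = undefined,
        one = undefined,
        zero = factor_ideal C D A B,
        add = set_add (Hom C A B),
        smult = (\<lambda>r F. \<Union>f\<in>F. factor_ideal C D A B +>\<^bsub>Hom C A B\<^esub> (r \<odot>\<^bsub>Hom C A B\<^esub> f))\<rparr>),
     Idm = (\<lambda>A. factor_ideal C D A A +>\<^bsub>Hom C A A\<^esub> Idm C A),
     Comp = (\<lambda>X Y Z G F. \<Union>g\<in>G. \<Union>f\<in>F.
       factor_ideal C D X Z +>\<^bsub>Hom C X Z\<^esub> Comp C X Y Z g f)\<rparr>"


section \<open>Extriangulated categories\<close>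

text \<open>
  \<open>Ext T X A\<close> is the module of extensions written E(X, A), contravariant in \<open>X\<close> and covariant
  in \<open>A\<close>.  For \<open>a : A \<rightarrow> A'\<close> the map \<open>Push T X A A' a : E(X, A) \<rightarrow> E(X, A')\<close> is the action
  of \<open>a\<close>, and for \<open>c : X' \<rightarrow> X\<close> the map \<open>Pull T X' X A c : E(X, A) \<rightarrow> E(X', A)\<close> is the
  action of \<open>c\<close>.  \<open>Realn T X A \<delta>\<close> is the equivalence class of sequences assigned to \<open>\<delta> \<in> E(X, A)\<close>;
  the triple \<open>(B, x, y)\<close> stands for the sequence with morphisms \<open>x : A \<rightarrow> B\<close> and \<open>y : B \<rightarrow> X\<close>.
\<close>

record ('o, 'm, 'k, 'e) extri = "('o, 'm, 'k) lcat" +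
  Ext :: "'o \<Rightarrow> 'o \<Rightarrow> ('k, 'e) module"
  Push :: "'o \<Rightarrow> 'o \<Rightarrow> 'o \<Rightarrow> 'm \<Rightarrow> 'e \<Rightarrow> 'e"
  Pull :: "'o \<Rightarrow> 'o \<Rightarrow> 'o \<Rightarrow> 'm \<Rightarrow> 'e \<Rightarrow> 'e"
  Realn :: "'o \<Rightarrow> 'o \<Rightarrow> 'e \<Rightarrow> ('o \<times> 'm \<times> 'm) set"

definition short_seqs ::
  "('o, 'm, 'k, 'z) lcat_scheme \<Rightarrow> 'o \<Rightarrow> 'o \<Rightarrow> ('o \<times> 'm \<times> 'm) set" where
  "short_seqs C X A = {(B, x, y). B \<in> Ob C \<and> x \<in> mor C A B \<and> y \<in> mor C B X}"

definition seq_equiv ::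
  "('o, 'm, 'k, 'z) lcat_scheme \<Rightarrow> 'o \<Rightarrow> 'o \<Rightarrow> (('o \<times> 'm \<times> 'm) \<times> ('o \<times> 'm \<times> 'm)) set" where
  "seq_equiv C X A =
    {((B, x, y), (B', x', y')). (B, x, y) \<in> short_seqs C X A \<and> (B', x', y') \<in> short_seqs C X A \<and>
      (\<exists>b. is_iso C B B' b \<and> Comp C A B B' b x = x' \<and> Comp C B B' X y' b = y)}"

text \<open>\<open>f \<oplus> f' : P \<rightarrow> P'\<close>, where \<open>p, q\<close> are the projections of \<open>P\<close> and \<open>i', j'\<close> the injections
  of \<open>P'\<close>.\<close>

definition sum_mor ::
  "('o, 'm, 'k, 'z) lcat_scheme \<Rightarrow> 'o \<Rightarrow> 'o \<Rightarrow> 'o \<Rightarrow> 'm \<Rightarrow> 'm \<Rightarrow>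
    'o \<Rightarrow> 'o \<Rightarrow> 'o \<Rightarrow> 'm \<Rightarrow> 'm \<Rightarrow> 'm \<Rightarrow> 'm \<Rightarrow> 'm" where
  "sum_mor C A B P p q A' B' P' i' j' f f' =
    Comp C P A P' (Comp C A A' P' i' f) p \<oplus>\<^bsub>Hom C P P'\<^esub> Comp C P B P' (Comp C B B' P' j' f') q"

locale extriangulated_category = additive_category K T
  for K (structure) and T :: "('o, 'm, 'k, 'e) extri" +
  \<comment> \<open>(ET1): \<open>Ext\<close> is a linear bifunctor.\<close>
  assumes ext_module: "\<lbrakk>X \<in> Ob T; A \<in> Ob T\<rbrakk> \<Longrightarrow> module K (Ext T X A)"
    and push_closed:
      "\<lbrakk>X \<in> Ob T; A \<in> Ob T; A' \<in> Ob T; a \<in> mor T A A'; d \<in> carrier (Ext T X A)\<rbrakk>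
        \<Longrightarrow> Push T X A A' a d \<in> carrier (Ext T X A')"
    and pull_closed:
      "\<lbrakk>X \<in> Ob T; X' \<in> Ob T; A \<in> Ob T; c \<in> mor T X' X; d \<in> carrier (Ext T X A)\<rbrakk>
        \<Longrightarrow> Pull T X' X A c d \<in> carrier (Ext T X' A)"
    and push_id: "\<lbrakk>X \<in> Ob T; A \<in> Ob T; d \<in> carrier (Ext T X A)\<rbrakk> \<Longrightarrow> Push T X A A (Idm T A) d = d"
    and pull_id: "\<lbrakk>X \<in> Ob T; A \<in> Ob T; d \<in> carrier (Ext T X A)\<rbrakk> \<Longrightarrow> Pull T X X A (Idm T X) d = d"
    and push_comp:
      "\<lbrakk>X \<in> Ob T; A \<in> Ob T; A' \<in> Ob T; A'' \<in> Ob T; a \<in> mor T A A'; a' \<in> mor T A' A'';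
        d \<in> carrier (Ext T X A)\<rbrakk>
        \<Longrightarrow> Push T X A A'' (Comp T A A' A'' a' a) d = Push T X A' A'' a' (Push T X A A' a d)"
    and pull_comp:
      "\<lbrakk>X \<in> Ob T; X' \<in> Ob T; X'' \<in> Ob T; A \<in> Ob T; c \<in> mor T X' X; c' \<in> mor T X'' X';
        d \<in> carrier (Ext T X A)\<rbrakk>
        \<Longrightarrow> Pull T X'' X A (Comp T X'' X' X c c') d = Pull T X'' X' A c' (Pull T X' X A c d)"
    and push_pull:
      "\<lbrakk>X \<in> Ob T; X' \<in> Ob T; A \<in> Ob T; A' \<in> Ob T; a \<in> mor T A A'; c \<in> mor T X' X;
        d \<in> carrier (Ext T X A)\<rbrakk>
        \<Longrightarrow> Push T X' A A' a (Pull T X' X A c d) = Pull T X' X A' c (Push T X A A' a d)"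
    and push_add:
      "\<lbrakk>X \<in> Ob T; A \<in> Ob T; A' \<in> Ob T; a \<in> mor T A A'; d \<in> carrier (Ext T X A);
        d' \<in> carrier (Ext T X A)\<rbrakk>
        \<Longrightarrow> Push T X A A' a (d \<oplus>\<^bsub>Ext T X A\<^esub> d') = Push T X A A' a d \<oplus>\<^bsub>Ext T X A'\<^esub> Push T X A A' a d'"
    and push_smult:
      "\<lbrakk>X \<in> Ob T; A \<in> Ob T; A' \<in> Ob T; r \<in> carrier K; a \<in> mor T A A'; d \<in> carrier (Ext T X A)\<rbrakk>
        \<Longrightarrow> Push T X A A' a (r \<odot>\<^bsub>Ext T X A\<^esub> d) = r \<odot>\<^bsub>Ext T X A'\<^esub> Push T X A A' a d"
    and pull_add:
      "\<lbrakk>X \<in> Ob T; X' \<in> Ob T; A \<in> Ob T; c \<in> mor T X' X; d \<in> carrier (Ext T X A);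
        d' \<in> carrier (Ext T X A)\<rbrakk>
        \<Longrightarrow> Pull T X' X A c (d \<oplus>\<^bsub>Ext T X A\<^esub> d') = Pull T X' X A c d \<oplus>\<^bsub>Ext T X' A\<^esub> Pull T X' X A c d'"
    and pull_smult:
      "\<lbrakk>X \<in> Ob T; X' \<in> Ob T; A \<in> Ob T; r \<in> carrier K; c \<in> mor T X' X; d \<in> carrier (Ext T X A)\<rbrakk>
        \<Longrightarrow> Pull T X' X A c (r \<odot>\<^bsub>Ext T X A\<^esub> d) = r \<odot>\<^bsub>Ext T X' A\<^esub> Pull T X' X A c d"
    and add_push:
      "\<lbrakk>X \<in> Ob T; A \<in> Ob T; A' \<in> Ob T; a \<in> mor T A A'; a' \<in> mor T A A'; d \<in> carrier (Ext T X A)\<rbrakk>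
        \<Longrightarrow> Push T X A A' (a \<oplus>\<^bsub>Hom T A A'\<^esub> a') d = Push T X A A' a d \<oplus>\<^bsub>Ext T X A'\<^esub> Push T X A A' a' d"
    and smult_push:
      "\<lbrakk>X \<in> Ob T; A \<in> Ob T; A' \<in> Ob T; r \<in> carrier K; a \<in> mor T A A'; d \<in> carrier (Ext T X A)\<rbrakk>
        \<Longrightarrow> Push T X A A' (r \<odot>\<^bsub>Hom T A A'\<^esub> a) d = r \<odot>\<^bsub>Ext T X A'\<^esub> Push T X A A' a d"
    and add_pull:
      "\<lbrakk>X \<in> Ob T; X' \<in> Ob T; A \<in> Ob T; c \<in> mor T X' X; c' \<in> mor T X' X; d \<in> carrier (Ext T X A)\<rbrakk>
        \<Longrightarrow> Pull T X' X A (c \<oplus>\<^bsub>Hom T X' X\<^esub> c') d = Pull T X' X A c d \<oplus>\<^bsub>Ext T X' A\<^esub> Pull T X' X A c' d"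
    and smult_pull:
      "\<lbrakk>X \<in> Ob T; X' \<in> Ob T; A \<in> Ob T; r \<in> carrier K; c \<in> mor T X' X; d \<in> carrier (Ext T X A)\<rbrakk>
        \<Longrightarrow> Pull T X' X A (r \<odot>\<^bsub>Hom T X' X\<^esub> c) d = r \<odot>\<^bsub>Ext T X' A\<^esub> Pull T X' X A c d"
  \<comment> \<open>(ET2): \<open>Realn\<close> is an additive realization.\<close>
    and realn_class:
      "\<lbrakk>X \<in> Ob T; A \<in> Ob T; d \<in> carrier (Ext T X A)\<rbrakk>
        \<Longrightarrow> Realn T X A d \<in> short_seqs T X A // seq_equiv T X A"
    and realn_morphism:
      "\<lbrakk>X \<in> Ob T; A \<in> Ob T; X' \<in> Ob T; A' \<in> Ob T;
        d \<in> carrier (Ext T X A); d' \<in> carrier (Ext T X' A');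
        (B, x, y) \<in> Realn T X A d; (B', x', y') \<in> Realn T X' A' d';
        a \<in> mor T A A'; c \<in> mor T X X'; Push T X A A' a d = Pull T X X' A' c d'\<rbrakk>
        \<Longrightarrow> \<exists>b \<in> mor T B B'. Comp T A B B' b x = Comp T A A' B' x' a \<and>
              Comp T B B' X' y' b = Comp T B X X' c y"
    and realn_zero:
      "biproduct T A X B i j p q \<Longrightarrow> (B, i, q) \<in> Realn T X A \<zero>\<^bsub>Ext T X A\<^esub>"
  \<comment> \<open>The last four hypotheses express \<open>e = d \<oplus> d'\<close>.\<close>
    and realn_sum:
      "\<lbrakk>d \<in> carrier (Ext T X A); d' \<in> carrier (Ext T X' A');
        (B, x, y) \<in> Realn T X A d; (B', x', y') \<in> Realn T X' A' d';
        biproduct T A A' PA iA jA pA qA; biproduct T B B' PB iB jB pB qB;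
        biproduct T X X' PX iX jX pX qX; e \<in> carrier (Ext T PX PA);
        Push T X PA A pA (Pull T X PX PA iX e) = d;
        Push T X' PA A' qA (Pull T X' PX PA jX e) = d';
        Push T X PA A' qA (Pull T X PX PA iX e) = \<zero>\<^bsub>Ext T X A'\<^esub>;
        Push T X' PA A pA (Pull T X' PX PA jX e) = \<zero>\<^bsub>Ext T X' A\<^esub>\<rbrakk>
        \<Longrightarrow> (PB, sum_mor T A A' PA pA qA B B' PB iB jB x x',
                sum_mor T B B' PB pB qB X X' PX iX jX y y') \<in> Realn T PX PA e"
  \<comment> \<open>(ET3) and its dual.\<close>
    and ET3:
      "\<lbrakk>X \<in> Ob T; A \<in> Ob T; X' \<in> Ob T; A' \<in> Ob T;
        d \<in> carrier (Ext T X A); d' \<in> carrier (Ext T X' A');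
        (B, x, y) \<in> Realn T X A d; (B', x', y') \<in> Realn T X' A' d';
        a \<in> mor T A A'; b \<in> mor T B B'; Comp T A B B' b x = Comp T A A' B' x' a\<rbrakk>
        \<Longrightarrow> \<exists>c \<in> mor T X X'. Push T X A A' a d = Pull T X X' A' c d' \<and>
              Comp T B B' X' y' b = Comp T B X X' c y"
    and ET3_op:
      "\<lbrakk>X \<in> Ob T; A \<in> Ob T; X' \<in> Ob T; A' \<in> Ob T;
        d \<in> carrier (Ext T X A); d' \<in> carrier (Ext T X' A');
        (B, x, y) \<in> Realn T X A d; (B', x', y') \<in> Realn T X' A' d';
        b \<in> mor T B B'; c \<in> mor T X X'; Comp T B B' X' y' b = Comp T B X X' c y\<rbrakk>
        \<Longrightarrow> \<exists>a \<in> mor T A A'. Push T X A A' a d = Pull T X X' A' c d' \<and>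
              Comp T A B B' b x = Comp T A A' B' x' a"
  \<comment> \<open>(ET4): \<open>d \<in> E(D, A)\<close> and \<open>d' \<in> E(F, B)\<close> are realized by \<open>A \<rightarrow> B \<rightarrow> D\<close> (via \<open>f, f'\<close>) and
      \<open>B \<rightarrow> G \<rightarrow> F\<close> (via \<open>g, g'\<close>); the new sequences are \<open>A \<rightarrow> G \<rightarrow> E\<close> (via \<open>g f, h'\<close>) and
      \<open>D \<rightarrow> E \<rightarrow> F\<close> (via \<open>u, v\<close>).\<close>
    and ET4:
      "\<lbrakk>A \<in> Ob T; B \<in> Ob T; D \<in> Ob T; F \<in> Ob T; G \<in> Ob T;
        d \<in> carrier (Ext T D A); d' \<in> carrier (Ext T F B);
        (B, f, f') \<in> Realn T D A d; (G, g, g') \<in> Realn T F B d'\<rbrakk>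
        \<Longrightarrow> \<exists>E \<in> Ob T. \<exists>h' \<in> mor T G E. \<exists>u \<in> mor T D E. \<exists>v \<in> mor T E F.
              \<exists>d'' \<in> carrier (Ext T E A).
              Comp T B D E u f' = Comp T B G E h' g \<and> Comp T G E F v h' = g' \<and>
              (G, Comp T A B G g f, h') \<in> Realn T E A d'' \<and>
              (E, u, v) \<in> Realn T F D (Push T F B D f' d') \<and>
              Pull T D E A u d'' = d \<and>
              Push T E A B f d'' = Pull T E F B v d'"
  \<comment> \<open>Dually: \<open>d \<in> E(B, D)\<close> and \<open>d' \<in> E(G, F)\<close> are realized by \<open>D \<rightarrow> A \<rightarrow> B\<close> (via \<open>f', f\<close>) and
      \<open>F \<rightarrow> B \<rightarrow> G\<close> (via \<open>g', g\<close>); the new sequences are \<open>E \<rightarrow> A \<rightarrow> G\<close> (via \<open>h', g f\<close>) and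
      \<open>D \<rightarrow> E \<rightarrow> F\<close> (via \<open>u, v\<close>).\<close>
    and ET4_op:
      "\<lbrakk>A \<in> Ob T; B \<in> Ob T; D \<in> Ob T; F \<in> Ob T; G \<in> Ob T;
        d \<in> carrier (Ext T B D); d' \<in> carrier (Ext T G F);
        (A, f', f) \<in> Realn T B D d; (B, g', g) \<in> Realn T G F d'\<rbrakk>
        \<Longrightarrow> \<exists>E \<in> Ob T. \<exists>h' \<in> mor T E A. \<exists>u \<in> mor T D E. \<exists>v \<in> mor T E F.
              \<exists>d'' \<in> carrier (Ext T G E).
              Comp T D E A h' u = f' \<and> Comp T E F B g' v = Comp T E A B f h' \<and>
              (A, h', Comp T A B G g f) \<in> Realn T G E d'' \<and>
              (E, u, v) \<in> Realn T F D (Pull T F B D g' d) \<and>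
              d' = Push T G E F v d'' \<and>
              Push T B D E u d = Pull T B G E g d''"

text \<open>
  The E-triangle formed by \<open>x : A \<rightarrow> B\<close>, \<open>y : B \<rightarrow> X\<close> and \<open>\<delta> \<in> E(X, A)\<close>.  As all three objects are
  required to lie in \<open>Ob T\<close>, the E-triangles of \<open>full_sub T S\<close> are those of \<open>T\<close> with terms in \<open>S\<close>.
\<close>

definition etriangle ::
  "('o, 'm, 'k, 'e) extri \<Rightarrow> 'o \<Rightarrow> 'm \<Rightarrow> 'o \<Rightarrow> 'm \<Rightarrow> 'o \<Rightarrow> 'e \<Rightarrow> bool" where
  "etriangle T A x B y X d \<longleftrightarrow> A \<in> Ob T \<and> B \<in> Ob T \<and> X \<in> Ob T \<and>
    d \<in> carrier (Ext T X A) \<and> (B, x, y) \<in> Realn T X A d"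

definition conflation :: "('o, 'm, 'k, 'e) extri \<Rightarrow> 'o \<Rightarrow> 'o \<Rightarrow> 'o \<Rightarrow> bool" where
  "conflation T A B X \<longleftrightarrow> (\<exists>x y d. etriangle T A x B y X d)"

definition inflation :: "('o, 'm, 'k, 'e) extri \<Rightarrow> 'o \<Rightarrow> 'o \<Rightarrow> 'm \<Rightarrow> bool" where
  "inflation T A B x \<longleftrightarrow> (\<exists>y X d. etriangle T A x B y X d)"

definition deflation :: "('o, 'm, 'k, 'e) extri \<Rightarrow> 'o \<Rightarrow> 'o \<Rightarrow> 'm \<Rightarrow> bool" where
  "deflation T B X y \<longleftrightarrow> (\<exists>A x d. etriangle T A x B y X d)"

definition WIC :: "('o, 'm, 'k, 'e) extri \<Rightarrow> bool" where
  "WIC T \<longleftrightarrow> (\<forall>A \<in> Ob T. \<forall>B \<in> Ob T. \<forall>X \<in> Ob T. \<forall>f \<in> mor T A B. \<forall>g \<in> mor T B X.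
    (deflation T A X (Comp T A B X g f) \<longrightarrow> deflation T B X g) \<and>
    (inflation T A X (Comp T A B X g f) \<longrightarrow> inflation T A B f))"

definition projectives :: "('o, 'm, 'k, 'e) extri \<Rightarrow> 'o set" where
  "projectives T = {P \<in> Ob T. \<forall>A x B y X d. etriangle T A x B y X d \<longrightarrow>
    (\<forall>f \<in> mor T P X. \<exists>g \<in> mor T P B. Comp T P B X y g = f)}"

definition injectives :: "('o, 'm, 'k, 'e) extri \<Rightarrow> 'o set" where
  "injectives T = {I \<in> Ob T. \<forall>A x B y X d. etriangle T A x B y X d \<longrightarrow>
    (\<forall>f \<in> mor T A I. \<exists>g \<in> mor T B I. Comp T A B I g x = f)}"

definition enough_projectives :: "('o, 'm, 'k, 'e) extri \<Rightarrow> bool" where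
  "enough_projectives T \<longleftrightarrow> (\<forall>X \<in> Ob T. \<exists>A. \<exists>P \<in> projectives T. conflation T A P X)"

definition enough_injectives :: "('o, 'm, 'k, 'e) extri \<Rightarrow> bool" where
  "enough_injectives T \<longleftrightarrow> (\<forall>A \<in> Ob T. \<exists>X. \<exists>I \<in> injectives T. conflation T A I X)"

text \<open>
  Higher extensions (for \<open>n \<ge> 1\<close>) by dimension shifting along a chosen E-triangle \<open>A \<rightarrow> I \<rightarrow> cosyzygy T A\<close>
  with \<open>I\<close> injective; another choice gives an isomorphic module.
\<close>

definition cosyzygy :: "('o, 'm, 'k, 'e) extri \<Rightarrow> 'o \<Rightarrow> 'o" where
  "cosyzygy T A = (SOME A'. \<exists>I \<in> injectives T. conflation T A I A')"

definition higher_Ext ::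
  "('o, 'm, 'k, 'e) extri \<Rightarrow> nat \<Rightarrow> 'o \<Rightarrow> 'o \<Rightarrow> ('k, 'e) module" where
  "higher_Ext T n X A = Ext T X ((cosyzygy T ^^ (n - 1)) A)"

definition two_rigid :: "('o, 'm, 'k, 'e) extri \<Rightarrow> 'o set \<Rightarrow> bool" where
  "two_rigid T W \<longleftrightarrow> (\<forall>n \<in> {1, 2}. \<forall>X \<in> W. \<forall>Y \<in> W.
    carrier (higher_Ext T n X Y) = {\<zero>\<^bsub>higher_Ext T n X Y\<^esub>})"

definition Cone :: "('o, 'm, 'k, 'e) extri \<Rightarrow> 'o set \<Rightarrow> 'o set \<Rightarrow> 'o set" where
  "Cone T S S' = {X \<in> Ob T. \<exists>A \<in> S. \<exists>B \<in> S'. conflation T A B X}"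

definition Sigma_sub :: "('o, 'm, 'k, 'e) extri \<Rightarrow> 'o set \<Rightarrow> 'o set" where
  "Sigma_sub T S = Cone T S (injectives T)"

definition cotorsion_pair :: "('o, 'm, 'k, 'e) extri \<Rightarrow> 'o set \<Rightarrow> 'o set \<Rightarrow> bool" where
  "cotorsion_pair T X Y \<longleftrightarrow>
    strict_subcat T X \<and> summand_closed T X \<and> strict_subcat T Y \<and> summand_closed T Y \<and>
    (\<forall>A \<in> X. \<forall>B \<in> Y. carrier (Ext T A B) = {\<zero>\<^bsub>Ext T A B\<^esub>}) \<and>
    (\<forall>M \<in> Ob T. (\<exists>B \<in> Y. \<exists>A \<in> X. conflation T B A M) \<and>
                (\<exists>B \<in> Y. \<exists>A \<in> X. conflation T M B A))"


section \<open>Support tau-tilting subcategories\<close>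

text \<open>\<open>Hom(f, M)\<close> is surjective, for \<open>f : A \<rightarrow> B\<close>.\<close>

definition hom_surj :: "('o, 'm, 'k, 'z) lcat_scheme \<Rightarrow> 'o \<Rightarrow> 'o \<Rightarrow> 'm \<Rightarrow> 'o \<Rightarrow> bool" where
  "hom_surj C A B f M \<longleftrightarrow> (\<lambda>g. Comp C A B M g f) ` mor C B M = mor C A M"

definition left_approximation ::
  "('o, 'm, 'k, 'z) lcat_scheme \<Rightarrow> 'o set \<Rightarrow> 'o \<Rightarrow> 'o \<Rightarrow> 'm \<Rightarrow> bool" where
  "left_approximation C S A M f \<longleftrightarrow> M \<in> S \<and> f \<in> mor C A M \<and> (\<forall>M' \<in> S. hom_surj C A M f M')"

text \<open>In the following two definitions \<open>W\<close> is the subcategory supplying the presentations.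
  As usual in a Krull-Schmidt setting, the subcategories considered here are closed under finite
  direct sums and direct summands.  This matters: over the path algebra of A2, with
  \<open>P2 \<oplus> S2\<close> support tau-tilting, the non-additive subcategory of all powers of \<open>P2\<close>
  and all powers of \<open>S2\<close> would otherwise be a second support tau-tilting subcategory.\<close>

definition tau_rigid :: "('o, 'm, 'k, 'z) lcat_scheme \<Rightarrow> 'o set \<Rightarrow> 'o set \<Rightarrow> bool" where
  "tau_rigid C W S \<longleftrightarrow> additive_subcat C S \<and>
    (\<forall>M \<in> S. \<exists>W1 \<in> W. \<exists>W0 \<in> W. \<exists>f g. right_exact C W1 W0 M f g \<and>
      (\<forall>M' \<in> S. hom_surj C W1 W0 f M'))"

definition support_tau_tilting :: "('o, 'm, 'k, 'z) lcat_scheme \<Rightarrow> 'o set \<Rightarrow> 'o set \<Rightarrow> bool" where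
  "support_tau_tilting C W S \<longleftrightarrow> tau_rigid C W S \<and>
    (\<forall>P. projective_object C P \<longrightarrow> (\<exists>M0 \<in> S. \<exists>M1 \<in> S. \<exists>m g.
      right_exact C P M0 M1 m g \<and> left_approximation C S P M0 m))"

definition two_term :: "('o, 'm, 'k, 'e) extri \<Rightarrow> 'o set \<Rightarrow> 'o set" where
  "two_term T W = Cone T W W"

definition two_term_quotient ::
  "('o, 'm, 'k, 'e) extri \<Rightarrow> 'o set \<Rightarrow> ('o, 'm set, 'k) lcat" where
  "two_term_quotient T W = ideal_quotient T (two_term T W) (Sigma_sub T W)"

definition bar :: "('o, 'm, 'k, 'e) extri \<Rightarrow> 'o set \<Rightarrow> 'o set \<Rightarrow> 'o set" where
  "bar T W S = iso_closure (two_term_quotient T W) S"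

end

theory Submission
  imports Defs
begin

text \<open>
  The subcategory \<open>\<G> = Cone(W, W)\<close> is extension-closed; in it the objects of \<open>W\<close> are
  projective, those of \<open>\<Sigma>W\<close> are injective, and \<open>E(X, -)\<close> is right exact on \<open>\<G>\<close>.  Hence for a
  cotorsion pair \<open>(X, Y)\<close> the class \<open>Y\<close> is closed under quotients and contains \<open>\<Sigma>W\<close>, so it is closed
  under isomorphism in the ideal quotient, and \<open>bar X \<inter> bar Y\<close> is the image of \<open>X \<inter> Y\<close>.  An E-triangle
  \<open>V \<rightarrow> A \<rightarrow> C\<close> with \<open>V \<in> W\<close> becomes a cokernel sequence in the quotient; applied to presentations of objects
  of \<open>X \<inter> Y\<close> and to the triangles \<open>V \<rightarrow> T0 \<rightarrow> T1\<close> that the pair provides, this gives support tau-tilting.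

  Conversely, adding to a map \<open>V \<rightarrow> A\<close> a component \<open>V \<rightarrow> J\<close> into an injective makes it an inflation without
  changing the cokernel in the quotient.  So every object of a support tau-tilting \<open>M\<close> is isomorphic,
  in the quotient, to one in \<open>T = {N \<in> M. E(N, M) = 0}\<close>, and each \<open>V \<in> W\<close> has an E-triangle
  \<open>V \<rightarrow> T0 \<rightarrow> T1\<close> with terms in \<open>T\<close>.  Then \<open>Y = {N. E(T, N) = 0}\<close> and \<open>X = {A. E(A, Y) = 0}\<close> form a cotorsion
  pair with \<open>X \<inter> Y = T\<close>, and \<open>Y\<close> is recovered from \<open>M\<close> in this way for every cotorsion pair.
\<close>

text \<open>The quotient remembers E only in its second argument. A retract of \<open>B\<close> in
  the quotient is an honest retract of \<open>B \<oplus> S\<close> with \<open>S\<close> in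
  \<Sigma>W, and E(U, -) vanishes on \<Sigma>W for \<open>U\<close> in \<G>, whereas E(-, N) need
  not. So a pair is recovered from its image through \<open>Y\<close>, with \<open>X\<close>
  following as its perpendicular, and objects of \<open>M\<close> need better representatives before
  E can be used in the first argument. The same asymmetry calls for Krull-Schmidt decompositions: a
  quotient retract of an object of \<open>X\<close> need not lie in \<open>X\<close>, and its
  summands that vanish in the quotient have to be split off. The degree 2 part of rigidity gives
  E(W, \<Sigma>W) = 0 by dimension shifting, the source of the other vanishing results against
  \<Sigma>W. Condition (WIC) makes a map an inflation as soon as one of its components is, and
  provides complements of retracts. Abelianness of the quotient turns right exact sequences into
  cokernels, the form in which triangles \<open>V -> A -> C\<close> appear there.\<close>

context linear_category
begin

section \<open>Zero morphisms of a linear category\<close>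

lemma abelian_group_hom: "X \<in> Ob C \<Longrightarrow> Y \<in> Ob C \<Longrightarrow> abelian_group (Hom C X Y)"
  using hom_module by (simp add: module_def)

lemma hom_zero_closed: "X \<in> Ob C \<Longrightarrow> Y \<in> Ob C \<Longrightarrow> \<zero>\<^bsub>Hom C X Y\<^esub> \<in> mor C X Y"
  using abelian_group_hom abelian_groupE(2) by blast

lemma abelian_idem_zero: assumes "abelian_group M" "x \<in> carrier M" "x \<oplus>\<^bsub>M\<^esub> x = x" shows "x = \<zero>\<^bsub>M\<^esub>"
proof -
  interpret abelian_group M by fact
  show ?thesis using assms(2,3) add.l_cancel_one by simp
qed

lemma comp_zero_right: assumes "X \<in> Ob C" "Y \<in> Ob C" "Z \<in> Ob C" "g \<in> mor C Y Z"
  shows "Comp C X Y Z g \<zero>\<^bsub>Hom C X Y\<^esub> = \<zero>\<^bsub>Hom C X Z\<^esub>"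
proof -
  note z = hom_zero_closed[OF assms(1,2)]
  have "\<zero>\<^bsub>Hom C X Y\<^esub> \<oplus>\<^bsub>Hom C X Y\<^esub> \<zero>\<^bsub>Hom C X Y\<^esub> = \<zero>\<^bsub>Hom C X Y\<^esub>"
    using abelian_groupE(5)[OF abelian_group_hom[OF assms(1,2)]] z by blast
  then show ?thesis
    using comp_add_right[OF assms(1-3) z z assms(4)] comp_closed[OF assms(1-3) z assms(4)]
      abelian_idem_zero[OF abelian_group_hom[OF assms(1,3)]] by simp
qed

lemma comp_zero_left: assumes "X \<in> Ob C" "Y \<in> Ob C" "Z \<in> Ob C" "f \<in> mor C X Y"
  shows "Comp C X Y Z \<zero>\<^bsub>Hom C Y Z\<^esub> f = \<zero>\<^bsub>Hom C X Z\<^esub>"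
proof -
  note z = hom_zero_closed[OF assms(2,3)]
  have "\<zero>\<^bsub>Hom C Y Z\<^esub> \<oplus>\<^bsub>Hom C Y Z\<^esub> \<zero>\<^bsub>Hom C Y Z\<^esub> = \<zero>\<^bsub>Hom C Y Z\<^esub>"
    using abelian_groupE(5)[OF abelian_group_hom[OF assms(2,3)]] z by blast
  then show ?thesis
    using comp_add_left[OF assms(1-4) z z] comp_closed[OF assms(1-4) z]
      abelian_idem_zero[OF abelian_group_hom[OF assms(1,3)]] by simp
qed

end

section \<open>Morphisms and extensions as arrows of degree 0 and 1\<close>

text \<open>
  An element of E(X, A) is treated as an arrow from \<open>X\<close> to \<open>A\<close> of degree 1, so that \<open>Push\<close> and \<open>Pull\<close> are
  both composition.  Ill-typed composites and sums are \<open>Null\<close>; this makes associativity and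
  distributivity hold without typing hypotheses.
\<close>

datatype (plugins only:) ('o, 'm, 'e) arrow = Null | Mor 'o 'm 'o | Exn 'o 'e 'o

context extriangulated_category
begin

definition H :: "'o \<Rightarrow> 'o \<Rightarrow> ('o, 'm, 'e) arrow set" where
  "H A B = {Mor A f B | f. A \<in> Ob T \<and> B \<in> Ob T \<and> f \<in> mor T A B}"

definition E :: "'o \<Rightarrow> 'o \<Rightarrow> ('o, 'm, 'e) arrow set" where
  "E X A = {Exn X d A | d. X \<in> Ob T \<and> A \<in> Ob T \<and> d \<in> carrier (Ext T X A)}"

fun cmp :: "('o, 'm, 'e) arrow \<Rightarrow> ('o, 'm, 'e) arrow \<Rightarrow> ('o, 'm, 'e) arrow" (infixl "\<cdot>" 70) where
  "Mor B' g C \<cdot> Mor A f B = (if B' = B \<and> Mor A f B \<in> H A B \<and> Mor B g C \<in> H B C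
     then Mor A (Comp T A B C g f) C else Null)"
| "Mor A' a B \<cdot> Exn X d A = (if A' = A \<and> Mor A a B \<in> H A B \<and> Exn X d A \<in> E X A
     then Exn X (Push T X A B a d) B else Null)"
| "Exn X' d A \<cdot> Mor Y c X = (if X' = X \<and> Mor Y c X \<in> H Y X \<and> Exn X d A \<in> E X A
     then Exn Y (Pull T Y X A c d) A else Null)"
| "_ \<cdot> _ = Null"

fun plus_arr :: "('o, 'm, 'e) arrow \<Rightarrow> ('o, 'm, 'e) arrow \<Rightarrow> ('o, 'm, 'e) arrow" (infixl "\<^bold>+" 65) where
  "Mor A f B \<^bold>+ Mor A' g B' = (if A' = A \<and> B' = B \<and> Mor A f B \<in> H A B \<and> Mor A g B \<in> H A B
     then Mor A (f \<oplus>\<^bsub>Hom T A B\<^esub> g) B else Null)"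
| "Exn A f B \<^bold>+ Exn A' g B' = (if A' = A \<and> B' = B \<and> Exn A f B \<in> E A B \<and> Exn A g B \<in> E A B
     then Exn A (f \<oplus>\<^bsub>Ext T A B\<^esub> g) B else Null)"
| "_ \<^bold>+ _ = Null"

fun neg :: "('o, 'm, 'e) arrow \<Rightarrow> ('o, 'm, 'e) arrow" where
  "neg (Mor A f B) = (if Mor A f B \<in> H A B then Mor A (\<ominus>\<^bsub>Hom T A B\<^esub> f) B else Null)"
| "neg (Exn A f B) = (if Exn A f B \<in> E A B then Exn A (\<ominus>\<^bsub>Ext T A B\<^esub> f) B else Null)"
| "neg Null = Null"

abbreviation minus_arr (infixl "\<^bold>-" 65) where "f \<^bold>- g \<equiv> f \<^bold>+ neg g"

definition ZH :: "'o \<Rightarrow> 'o \<Rightarrow> ('o, 'm, 'e) arrow" where "ZH A B = Mor A \<zero>\<^bsub>Hom T A B\<^esub> B"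
definition ZE :: "'o \<Rightarrow> 'o \<Rightarrow> ('o, 'm, 'e) arrow" where "ZE X A = Exn X \<zero>\<^bsub>Ext T X A\<^esub> A"
definition idm :: "'o \<Rightarrow> ('o, 'm, 'e) arrow" where "idm A = Mor A (Idm T A) A"

lemma H_Mor: "Mor A f B \<in> H A' B' \<longleftrightarrow> A' = A \<and> B' = B \<and> A \<in> Ob T \<and> B \<in> Ob T \<and> f \<in> mor T A B"
  and E_Exn: "Exn A d B \<in> E A' B' \<longleftrightarrow> A' = A \<and> B' = B \<and> A \<in> Ob T \<and> B \<in> Ob T \<and> d \<in> carrier (Ext T A B)"
  by (auto simp: H_def E_def)

lemma H_E: assumes "f \<in> H A B" obtains f' where "f = Mor A f' B" "A \<in> Ob T" "B \<in> Ob T" "f' \<in> mor T A B"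
  using assms by (auto simp: H_def)

lemma E_E: assumes "f \<in> E A B" obtains f' where "f = Exn A f' B" "A \<in> Ob T" "B \<in> Ob T" "f' \<in> carrier (Ext T A B)"
  using assms by (auto simp: E_def)

lemma H_ob: "f \<in> H A B \<Longrightarrow> A \<in> Ob T" "f \<in> H A B \<Longrightarrow> B \<in> Ob T" by (auto elim!: H_E E_E)

lemma E_ob: "f \<in> E A B \<Longrightarrow> A \<in> Ob T" "f \<in> E A B \<Longrightarrow> B \<in> Ob T" by (auto elim!: H_E E_E)

lemma ab_Ext: "X \<in> Ob T \<Longrightarrow> Y \<in> Ob T \<Longrightarrow> abelian_group (Ext T X Y)"
  using ext_module[of X Y] by (simp add: module_def)

lemmas group_closed = abelian_groupE(1,2)[OF abelian_group_hom] abelian_groupE(1,2)[OF ab_Ext]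
  abelian_group.a_inv_closed[OF abelian_group_hom] abelian_group.a_inv_closed[OF ab_Ext]

lemma cmp_HH: "g \<in> H B C \<Longrightarrow> f \<in> H A B \<Longrightarrow> g \<cdot> f \<in> H A C"
  by (auto simp: H_Mor comp_closed elim!: H_E)

lemma cmp_HE: "g \<in> H B C \<Longrightarrow> f \<in> E A B \<Longrightarrow> g \<cdot> f \<in> E A C"
  by (auto simp: H_Mor E_Exn push_closed elim!: H_E E_E)

lemma cmp_EH: "g \<in> E B C \<Longrightarrow> f \<in> H A B \<Longrightarrow> g \<cdot> f \<in> E A C"
  by (auto simp: H_Mor E_Exn pull_closed elim!: H_E E_E)

lemma idm_H: "A \<in> Ob T \<Longrightarrow> idm A \<in> H A A"
  by (simp add: idm_def H_Mor id_closed)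

lemma ZH_H: "A \<in> Ob T \<Longrightarrow> B \<in> Ob T \<Longrightarrow> ZH A B \<in> H A B"
  using abelian_group_hom by (simp add: ZH_def H_Mor abelian_groupE(2))

lemma ZE_E: "A \<in> Ob T \<Longrightarrow> B \<in> Ob T \<Longrightarrow> ZE A B \<in> E A B"
  using ab_Ext by (simp add: ZE_def E_Exn abelian_groupE(2))

lemma plus_H: "f \<in> H A B \<Longrightarrow> g \<in> H A B \<Longrightarrow> f \<^bold>+ g \<in> H A B"
  by (auto simp: H_Mor group_closed elim!: H_E)

lemma plus_E: "f \<in> E A B \<Longrightarrow> g \<in> E A B \<Longrightarrow> f \<^bold>+ g \<in> E A B"
  by (auto simp: E_Exn group_closed elim!: E_E)

lemma neg_H: "f \<in> H A B \<Longrightarrow> neg f \<in> H A B"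
  by (auto simp: H_Mor group_closed elim!: H_E)

lemma neg_E: "f \<in> E A B \<Longrightarrow> neg f \<in> E A B"
  by (auto simp: E_Exn group_closed elim!: E_E)

lemmas arrI = cmp_HH cmp_HE cmp_EH idm_H ZH_H ZE_E plus_H plus_E neg_H neg_E

text \<open>The case of a morphism on each side of an extension is the bifunctor law
  \<open>push_pull\<close>. Composites of two extensions are \<open>Null\<close>, so degree 2 never
  arises.\<close>

lemma cmp_assoc: "(h \<cdot> g) \<cdot> f = h \<cdot> (g \<cdot> f)"
  by (cases h; cases g; cases f)
    (auto simp: H_Mor E_Exn comp_closed push_closed pull_closed comp_assoc push_comp pull_comp push_pull)

lemma plus_assoc: "(f \<^bold>+ g) \<^bold>+ h = f \<^bold>+ (g \<^bold>+ h)"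
  by (cases h; cases g; cases f)
   (auto simp: H_Mor E_Exn group_closed abelian_groupE(3)[OF abelian_group_hom] abelian_groupE(3)[OF ab_Ext])

lemma plus_commute: "f \<^bold>+ g = g \<^bold>+ f"
  by (cases g; cases f)
   (auto simp: H_Mor E_Exn group_closed abelian_groupE(4)[OF abelian_group_hom] abelian_groupE(4)[OF ab_Ext])

lemma plus_left_commute: "f \<^bold>+ (g \<^bold>+ h) = g \<^bold>+ (f \<^bold>+ h)"
  by (metis plus_assoc plus_commute)

lemmas plus_ac = plus_assoc plus_commute plus_left_commute

lemma cmp_plus: "h \<cdot> (f \<^bold>+ g) = h \<cdot> f \<^bold>+ h \<cdot> g"
  by (cases h; cases g; cases f)
    (auto simp: H_Mor E_Exn comp_closed push_closed pull_closed comp_add_right push_add add_pull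
    abelian_groupE(1)[OF abelian_group_hom] abelian_groupE(1)[OF ab_Ext])

lemma plus_cmp: "(f \<^bold>+ g) \<cdot> h = f \<cdot> h \<^bold>+ g \<cdot> h"
  by (cases h; cases g; cases f)
    (auto simp: H_Mor E_Exn comp_closed push_closed pull_closed comp_add_left pull_add add_push
    abelian_groupE(1)[OF abelian_group_hom] abelian_groupE(1)[OF ab_Ext])

lemma cmp_idm [simp]: "f \<in> H A B \<Longrightarrow> f \<cdot> idm A = f" "f \<in> E A B \<Longrightarrow> f \<cdot> idm A = f"
  by (auto simp: H_Mor E_Exn idm_def id_closed id_right pull_id elim!: H_E E_E)

lemma idm_cmp [simp]: "f \<in> H A B \<Longrightarrow> idm B \<cdot> f = f" "f \<in> E A B \<Longrightarrow> idm B \<cdot> f = f"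
  by (auto simp: H_Mor E_Exn idm_def id_closed id_left push_id elim!: H_E E_E)

text \<open>\<open>d\<close> is the degree: \<open>False\<close> for morphisms, \<open>True\<close> for extensions.\<close>

definition arr where "arr d A B = (if d then E A B else H A B)"

definition zero_arr where "zero_arr d A B = (if d then ZE A B else ZH A B)"

lemma arr_ob: "f \<in> arr d A B \<Longrightarrow> A \<in> Ob T" "f \<in> arr d A B \<Longrightarrow> B \<in> Ob T"
  by (auto simp: arr_def H_ob E_ob split: if_splits)

lemma arr_plus: "f \<in> arr d A B \<Longrightarrow> zero_arr d A B \<^bold>+ f = f" "f \<in> arr d A B \<Longrightarrow> f \<^bold>+ neg f = zero_arr d A B"
  by (auto simp: arr_def zero_arr_def H_Mor E_Exn ZH_def ZE_def abelian_monoid.l_zero abelian_group.axioms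
      abelian_group.r_neg abelian_group_hom ab_Ext group_closed elim!: H_E E_E split: if_splits)

lemma arr_neg: "f \<in> arr d A B \<Longrightarrow> neg f \<in> arr d A B"
  by (auto simp: arr_def neg_H neg_E split: if_splits)

lemma arr_cmp: "g \<in> arr d B C \<Longrightarrow> f \<in> arr d' A B \<Longrightarrow> \<not> (d \<and> d') \<Longrightarrow> g \<cdot> f \<in> arr (d \<or> d') A C"
  by (auto simp: arr_def intro: cmp_HH cmp_HE cmp_EH split: if_splits)

lemma arr_zero: "A \<in> Ob T \<Longrightarrow> B \<in> Ob T \<Longrightarrow> zero_arr d A B \<in> arr d A B"
  by (simp add: arr_def zero_arr_def ZH_H ZE_E)

lemma arr_idem: assumes "f \<in> arr d A B" "f \<^bold>+ f = f" shows "f = zero_arr d A B"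
proof -
  have "f \<^bold>+ neg f = f \<^bold>+ (f \<^bold>+ neg f)" by (simp only: plus_assoc[symmetric] assms(2))
  also have "\<dots> = f" using arr_plus[OF assms(1)] by (simp add: plus_commute)
  finally show ?thesis using arr_plus[OF assms(1)] by simp
qed

lemma arr_neg_unique: assumes "f \<in> arr d A B" "g \<in> arr d A B" "f \<^bold>+ g = zero_arr d A B" shows "g = neg f"
proof -
  have "g = (f \<^bold>+ neg f) \<^bold>+ g" using arr_plus assms(1,2) by simp
  also have "\<dots> = (f \<^bold>+ g) \<^bold>+ neg f" by (simp add: plus_ac)
  also have "\<dots> = neg f" using arr_plus arr_neg[OF assms(1)] by (simp add: assms(3))
  finally show ?thesis .
qed

lemma arr_cmp_zero: assumes "f \<in> arr d A B" "C \<in> Ob T" "\<not> (d \<and> d')" shows "f \<cdot> zero_arr d' C A = zero_arr (d \<or> d') C B"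
proof (rule arr_idem)
  have z: "zero_arr d' C A \<in> arr d' C A" using assms(2) arr_ob[OF assms(1)] arr_zero by blast
  show "f \<cdot> zero_arr d' C A \<in> arr (d \<or> d') C B" by (rule arr_cmp[OF assms(1) z assms(3)])
  show "f \<cdot> zero_arr d' C A \<^bold>+ f \<cdot> zero_arr d' C A = f \<cdot> zero_arr d' C A" using arr_plus(1)[OF z] by (simp flip: cmp_plus)
qed

lemma arr_zero_cmp: assumes "f \<in> arr d A B" "C \<in> Ob T" "\<not> (d' \<and> d)" shows "zero_arr d' B C \<cdot> f = zero_arr (d' \<or> d) A C"
proof (rule arr_idem)
  have z: "zero_arr d' B C \<in> arr d' B C" using assms(2) arr_ob[OF assms(1)] arr_zero by blast
  show "zero_arr d' B C \<cdot> f \<in> arr (d' \<or> d) A C" by (rule arr_cmp[OF z assms(1,3)])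
  show "zero_arr d' B C \<cdot> f \<^bold>+ zero_arr d' B C \<cdot> f = zero_arr d' B C \<cdot> f" using arr_plus(1)[OF z] by (simp flip: plus_cmp)
qed

lemma arr_cases: assumes "g \<cdot> f \<noteq> Null"
  obtains d d' A B C where "g \<in> arr d B C" "f \<in> arr d' A B" "\<not> (d \<and> d')"
proof -
  have "(\<exists>A B C. g \<in> H B C \<and> f \<in> H A B) \<or> (\<exists>A B C. g \<in> H B C \<and> f \<in> E A B)
      \<or> (\<exists>A B C. g \<in> E B C \<and> f \<in> H A B)"
    using assms by (cases g; cases f) (simp_all add: H_Mor E_Exn split: if_splits)
  then show ?thesis
    using that[of False _ _ False] that[of False _ _ True] that[of True _ _ False] by (auto simp: arr_def)
qed

text \<open>Either the composite is ill-typed and both sides are \<open>Null\<close>, or all degrees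
  and types are known; then adding \<open>h \<cdot> f\<close> to the left side gives zero by
  distributivity, and additive inverses are unique.\<close>

lemma cmp_neg: "h \<cdot> neg f = neg (h \<cdot> f)"
proof (cases "h \<cdot> f = Null")
  case True
  then show ?thesis
    by (cases h; cases f) (auto simp: H_Mor E_Exn group_closed split: if_splits)
next
  case False
  then obtain d d' A B C where a: "h \<in> arr d B C" "f \<in> arr d' A B" "\<not> (d \<and> d')" by (rule arr_cases)
  have "h \<cdot> f \<^bold>+ h \<cdot> neg f = zero_arr (d \<or> d') A C"
    using arr_plus(2)[OF a(2)] arr_cmp_zero[OF a(1) arr_ob(1)[OF a(2)] a(3)] by (simp flip: cmp_plus)
  then show ?thesis by (rule arr_neg_unique[OF arr_cmp[OF a] arr_cmp[OF a(1) arr_neg[OF a(2)] a(3)]])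
qed

lemma neg_cmp: "neg h \<cdot> f = neg (h \<cdot> f)"
proof (cases "h \<cdot> f = Null")
  case True
  then show ?thesis
    by (cases h; cases f) (auto simp: H_Mor E_Exn group_closed split: if_splits)
next
  case False
  then obtain d d' A B C where a: "h \<in> arr d B C" "f \<in> arr d' A B" "\<not> (d \<and> d')" by (rule arr_cases)
  have "h \<cdot> f \<^bold>+ neg h \<cdot> f = zero_arr (d \<or> d') A C"
    using arr_plus(2)[OF a(1)] arr_zero_cmp[OF a(2) arr_ob(2)[OF a(1)] a(3)] by (simp flip: plus_cmp)
  then show ?thesis by (rule arr_neg_unique[OF arr_cmp[OF a] arr_cmp[OF arr_neg[OF a(1)] a(2,3)]])
qed

lemma plus_zero [simp]: "f \<in> H A B \<Longrightarrow> f \<^bold>+ ZH A B = f" "f \<in> H A B \<Longrightarrow> ZH A B \<^bold>+ f = f"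
  "f \<in> E A B \<Longrightarrow> f \<^bold>+ ZE A B = f" "f \<in> E A B \<Longrightarrow> ZE A B \<^bold>+ f = f"
  using arr_plus(1)[of f False A B] arr_plus(1)[of f True A B] by (simp_all add: arr_def zero_arr_def plus_commute)

lemma plus_neg [simp]: "f \<in> H A B \<Longrightarrow> f \<^bold>+ neg f = ZH A B" "f \<in> E A B \<Longrightarrow> f \<^bold>+ neg f = ZE A B"
  "f \<in> H A B \<Longrightarrow> neg f \<^bold>+ f = ZH A B"
  using arr_plus(2)[of f False A B] arr_plus(2)[of f True A B] by (simp_all add: arr_def zero_arr_def plus_commute)

lemma cmp_zero [simp]: "f \<in> H A B \<Longrightarrow> C \<in> Ob T \<Longrightarrow> f \<cdot> ZH C A = ZH C B"
  "f \<in> H A B \<Longrightarrow> C \<in> Ob T \<Longrightarrow> ZH B C \<cdot> f = ZH A C"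
  "f \<in> H A B \<Longrightarrow> C \<in> Ob T \<Longrightarrow> f \<cdot> ZE C A = ZE C B"
  "f \<in> H A B \<Longrightarrow> C \<in> Ob T \<Longrightarrow> ZE B C \<cdot> f = ZE A C"
  "f \<in> E A B \<Longrightarrow> C \<in> Ob T \<Longrightarrow> f \<cdot> ZH C A = ZE C B"
  "f \<in> E A B \<Longrightarrow> C \<in> Ob T \<Longrightarrow> ZH B C \<cdot> f = ZE A C"
  using arr_cmp_zero[of f False A B C False] arr_zero_cmp[of f False A B C False] arr_cmp_zero[of f False A B C True]
    arr_zero_cmp[of f False A B C True] arr_cmp_zero[of f True A B C False] arr_zero_cmp[of f True A B C False]
  by (simp_all add: arr_def zero_arr_def)

lemma neg_unique: "f \<in> H A B \<Longrightarrow> g \<in> H A B \<Longrightarrow> f \<^bold>+ g = ZH A B \<Longrightarrow> g = neg f"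
  using arr_neg_unique[of f False A B g] by (simp add: arr_def zero_arr_def)

lemma neg_zero [simp]: "A \<in> Ob T \<Longrightarrow> B \<in> Ob T \<Longrightarrow> neg (ZH A B) = ZH A B"
  using neg_unique[of "ZH A B" A B "ZH A B"] by (simp add: ZH_H)

lemma minus_eqD: assumes "f \<in> H A B" "g \<in> H A B" "f \<^bold>- g = h" shows "f = g \<^bold>+ h"
proof -
  have "f = (f \<^bold>- g) \<^bold>+ g" using assms(1,2) by (simp add: plus_assoc)
  then show ?thesis using assms(3) by (simp add: plus_commute)
qed

lemma neg_neg [simp]: "f \<in> H A B \<Longrightarrow> neg (neg f) = f"
  using neg_unique[of "neg f" A B f] by (simp add: neg_H)

lemma neg_plus: "neg (f \<^bold>+ g) = neg f \<^bold>+ neg g"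
  by (cases f; cases g)
   (auto simp: H_Mor E_Exn abelian_group.minus_add abelian_group.a_inv_closed abelian_group_hom ab_Ext
    abelian_groupE(1)[OF abelian_group_hom] abelian_groupE(1)[OF ab_Ext])

section \<open>E-triangles and their exact sequences\<close>

definition tri :: "'o \<Rightarrow> ('o, 'm, 'e) arrow \<Rightarrow> 'o \<Rightarrow> ('o, 'm, 'e) arrow \<Rightarrow> 'o \<Rightarrow> ('o, 'm, 'e) arrow \<Rightarrow> bool" where
  "tri A x B y C d \<longleftrightarrow> (\<exists>x' y' d'. x = Mor A x' B \<and> y = Mor B y' C \<and> d = Exn C d' A \<and> etriangle T A x' B y' C d')"

definition bip where
  "bip A B P i j p q \<longleftrightarrow> i \<in> H A P \<and> j \<in> H B P \<and> p \<in> H P A \<and> q \<in> H P B \<and>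
    p \<cdot> i = idm A \<and> q \<cdot> j = idm B \<and> p \<cdot> j = ZH B A \<and> q \<cdot> i = ZH A B \<and> i \<cdot> p \<^bold>+ j \<cdot> q = idm P"

lemma bip_Mor: "biproduct T A B P i j p q \<longleftrightarrow> bip A B P (Mor A i P) (Mor B j P) (Mor P p A) (Mor P q B)"
  by (auto simp: biproduct_def bip_def H_Mor idm_def ZH_def comp_closed)

lemma bip_ex: assumes "A \<in> Ob T" "B \<in> Ob T" obtains P i j p q where "bip A B P i j p q"
  using ex_biproduct[OF assms] bip_Mor by blast

lemma bip_swap: "bip A B P i j p q \<Longrightarrow> bip B A P j i q p"
  by (auto simp: bip_def plus_commute)

lemma bip_ty: assumes "bip A B P i j p q"
  shows "i \<in> H A P" "j \<in> H B P" "p \<in> H P A" "q \<in> H P B" "A \<in> Ob T" "B \<in> Ob T" "P \<in> Ob T"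
  using assms by (auto simp: bip_def dest: H_ob)

lemma bip_eq: assumes "bip A B P i j p q"
  shows "p \<cdot> i = idm A" "q \<cdot> j = idm B" "p \<cdot> j = ZH B A" "q \<cdot> i = ZH A B" "i \<cdot> p \<^bold>+ j \<cdot> q = idm P"
  using assms by (auto simp: bip_def)

lemma bip_cmp: assumes "bip A B P i j p q"
  shows "p \<cdot> (i \<cdot> k) = idm A \<cdot> k" "q \<cdot> (j \<cdot> k) = idm B \<cdot> k" "p \<cdot> (j \<cdot> k) = ZH B A \<cdot> k" "q \<cdot> (i \<cdot> k) = ZH A B \<cdot> k"
  by (simp_all add: bip_eq[OF assms] flip: cmp_assoc)

text \<open>A class of \<open>seq_equiv\<close> is nonempty because the identity of the middle term
  relates its representative to itself.\<close>

lemma class_mem: assumes "X \<in> Ob T" "A \<in> Ob T" "d \<in> carrier (Ext T X A)"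
  shows "Realn T X A d \<subseteq> short_seqs T X A" "Realn T X A d \<noteq> {}"
proof -
  obtain s where s: "s \<in> short_seqs T X A" "Realn T X A d = seq_equiv T X A `` {s}"
    using realn_class[OF assms] by (auto elim: quotientE)
  then show "Realn T X A d \<subseteq> short_seqs T X A" by (auto simp: seq_equiv_def)
  have "is_iso T B B (Idm T B)" if "B \<in> Ob T" for B
    using that by (auto simp: is_iso_def id_closed id_left)
  moreover obtain B a b where "s = (B, a, b)" by (cases s)
  ultimately have "(s, s) \<in> seq_equiv T X A"
    using s(1) assms by (auto simp: seq_equiv_def short_seqs_def id_left id_right intro!: exI[of _ "Idm T B"])
  then show "Realn T X A d \<noteq> {}" using s(2) by auto
qed

lemma tri_ty: assumes "tri A x B y C d"
  shows "x \<in> H A B" "y \<in> H B C" "d \<in> E C A" "A \<in> Ob T" "B \<in> Ob T" "C \<in> Ob T"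
  by (use assms class_mem(1) in \<open>fastforce simp: tri_def etriangle_def H_Mor E_Exn short_seqs_def\<close>)+

lemma tri_ex: assumes "d \<in> E C A" obtains B x y where "tri A x B y C d"
proof -
  obtain d' where d: "d = Exn C d' A" "C \<in> Ob T" "A \<in> Ob T" "d' \<in> carrier (Ext T C A)"
    using assms by (rule E_E)
  obtain B x y where "(B, x, y) \<in> Realn T C A d'" using class_mem(2)[OF d(2-4)] by auto
  moreover have "B \<in> Ob T" using calculation class_mem(1)[OF d(2-4)] by (auto simp: short_seqs_def)
  ultimately have "tri A (Mor A x B) B (Mor B y C) C d" using d by (auto simp: tri_def etriangle_def)
  then show ?thesis by (rule that)
qed

lemma tri_mor:
  assumes "tri A x B y C d" "tri A' x' B' y' C' d'" "a \<in> H A A'" "c \<in> H C C'" "a \<cdot> d = d' \<cdot> c"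
  obtains b where "b \<in> H B B'" "b \<cdot> x = x' \<cdot> a" "y' \<cdot> b = c \<cdot> y"
proof -
  note ty = tri_ty[OF assms(1)] tri_ty[OF assms(2)]
  obtain X Y D X' Y' D' where e: "x = Mor A X B" "y = Mor B Y C" "d = Exn C D A" "etriangle T A X B Y C D"
    "x' = Mor A' X' B'" "y' = Mor B' Y' C'" "d' = Exn C' D' A'" "etriangle T A' X' B' Y' C' D'"
    using assms(1,2) unfolding tri_def by auto
  obtain a' c' where rep: "a = Mor A a' A'" "c = Mor C c' C'" using assms(3,4) by (auto elim!: H_E)
  have "\<exists>b \<in> mor T B B'. Comp T A B B' b X = Comp T A A' B' X' a' \<and>
              Comp T B B' C' Y' b = Comp T B C C' c' Y"
    by (rule realn_morphism[of C A C' A' D D'])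
      (use e assms(3-5) ty in \<open>auto simp: rep etriangle_def H_Mor E_Exn\<close>)
  then obtain b where "b \<in> mor T B B'" "Comp T A B B' b X = Comp T A A' B' X' a'"
              "Comp T B B' C' Y' b = Comp T B C C' c' Y" by blast
  then show ?thesis
    using that[of "Mor B b B'"] ty assms(3,4) by (simp add: e rep H_Mor)
qed

lemma tri_ET3:
  assumes "tri A x B y C d" "tri A' x' B' y' C' d'" "a \<in> H A A'" "b \<in> H B B'" "b \<cdot> x = x' \<cdot> a"
  obtains c where "c \<in> H C C'" "a \<cdot> d = d' \<cdot> c" "y' \<cdot> b = c \<cdot> y"
proof -
  note ty = tri_ty[OF assms(1)] tri_ty[OF assms(2)]
  obtain X Y D X' Y' D' where e: "x = Mor A X B" "y = Mor B Y C" "d = Exn C D A" "etriangle T A X B Y C D"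
    "x' = Mor A' X' B'" "y' = Mor B' Y' C'" "d' = Exn C' D' A'" "etriangle T A' X' B' Y' C' D'"
    using assms(1,2) unfolding tri_def by auto
  obtain a' b' where rep: "a = Mor A a' A'" "b = Mor B b' B'" using assms(3,4) by (auto elim!: H_E)
  have "\<exists>c \<in> mor T C C'. Push T C A A' a' D = Pull T C C' A' c D' \<and>
              Comp T B B' C' Y' b' = Comp T B C C' c Y"
    by (rule ET3[of C A C' A' D D' B X Y B' X' Y'])
      (use e assms(3-5) ty in \<open>auto simp: rep etriangle_def H_Mor E_Exn\<close>)
  then obtain c where "c \<in> mor T C C'" "Push T C A A' a' D = Pull T C C' A' c D'"
              "Comp T B B' C' Y' b' = Comp T B C C' c Y" by blast
  then show ?thesis
    using that[of "Mor C c C'"] ty assms(3,4) by (simp add: e rep H_Mor E_Exn)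
qed

lemma tri_ET3_op:
  assumes "tri A x B y C d" "tri A' x' B' y' C' d'" "b \<in> H B B'" "c \<in> H C C'" "y' \<cdot> b = c \<cdot> y"
  obtains a where "a \<in> H A A'" "a \<cdot> d = d' \<cdot> c" "b \<cdot> x = x' \<cdot> a"
proof -
  note ty = tri_ty[OF assms(1)] tri_ty[OF assms(2)]
  obtain X Y D X' Y' D' where e: "x = Mor A X B" "y = Mor B Y C" "d = Exn C D A" "etriangle T A X B Y C D"
    "x' = Mor A' X' B'" "y' = Mor B' Y' C'" "d' = Exn C' D' A'" "etriangle T A' X' B' Y' C' D'"
    using assms(1,2) unfolding tri_def by auto
  obtain c' b' where rep: "c = Mor C c' C'" "b = Mor B b' B'" using assms(3,4) by (auto elim!: H_E)
  have "\<exists>a \<in> mor T A A'. Push T C A A' a D = Pull T C C' A' c' D' \<and>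
              Comp T A B B' b' X = Comp T A A' B' X' a"
    by (rule ET3_op[of C A C' A' D D' B X Y B' X' Y'])
      (use e assms(3-5) ty in \<open>auto simp: rep etriangle_def H_Mor E_Exn\<close>)
  then obtain a where "a \<in> mor T A A'" "Push T C A A' a D = Pull T C C' A' c' D'"
              "Comp T A B B' b' X = Comp T A A' B' X' a" by blast
  then show ?thesis
    using that[of "Mor A a A'"] ty assms(3,4) by (simp add: e rep H_Mor E_Exn)
qed

lemma tri_zero: "bip A C B i j p q \<Longrightarrow> tri A i B q C (ZE C A)"
proof -
  assume b: "bip A C B i j p q"
  then obtain i' j' p' q' where "i = Mor A i' B" "j = Mor C j' B" "p = Mor B p' A" "q = Mor B q' C"
    by (auto simp: bip_def elim!: H_E)
  then show ?thesis
    using realn_zero[of A C B i' j' p' q'] b bip_ty[OF b] group_closed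
    by (auto simp: bip_Mor tri_def ZE_def etriangle_def)
qed

lemma tri_ET4:
  assumes "tri A f B f' D d" "tri B g G g' F d'"
  obtains M h u v e where "tri A (g \<cdot> f) G h M e" "tri D u M v F (f' \<cdot> d')"
    "u \<cdot> f' = h \<cdot> g" "v \<cdot> h = g'" "e \<cdot> u = d" "f \<cdot> e = d' \<cdot> v"
proof -
  note ty = tri_ty[OF assms(1)] tri_ty[OF assms(2)]
  obtain X Y Z X' Y' Z' where e: "f = Mor A X B" "f' = Mor B Y D" "d = Exn D Z A" "etriangle T A X B Y D Z"
    "g = Mor B X' G" "g' = Mor G Y' F" "d' = Exn F Z' B" "etriangle T B X' G Y' F Z'"
    using assms unfolding tri_def by auto
  have "\<exists>E \<in> Ob T. \<exists>h' \<in> mor T G E. \<exists>u \<in> mor T D E. \<exists>v \<in> mor T E F.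
              \<exists>d'' \<in> carrier (Ext T E A).
              Comp T B D E u Y = Comp T B G E h' X' \<and> Comp T G E F v h' = Y' \<and>
              (G, Comp T A B G X' X, h') \<in> Realn T E A d'' \<and>
              (E, u, v) \<in> Realn T F D (Push T F B D Y Z') \<and>
              Pull T D E A u d'' = Z \<and>
              Push T E A B X d'' = Pull T E F B v Z'"
    by (rule ET4) (use e ty in \<open>auto simp: etriangle_def H_Mor E_Exn\<close>)
  then obtain M h u v r where m: "M \<in> Ob T" "h \<in> mor T G M" "u \<in> mor T D M" "v \<in> mor T M F"
    "r \<in> carrier (Ext T M A)" "Comp T B D M u Y = Comp T B G M h X'" "Comp T G M F v h = Y'"
              "(G, Comp T A B G X' X, h) \<in> Realn T M A r"
              "(M, u, v) \<in> Realn T F D (Push T F B D Y Z')"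
              "Pull T D M A u r = Z" "Push T M A B X r = Pull T M F B v Z'"
    by blast
  show ?thesis
    by (rule that[of "Mor G h M" M "Exn M r A" "Mor D u M" "Mor M v F"])
      (use m ty in \<open>auto simp: e tri_def etriangle_def H_Mor E_Exn push_closed\<close>)
qed

lemma tri_ET4_op:
  assumes "tri D f' A f B d" "tri F g' B g G d'"
  obtains M h u v e where "tri M h A (g \<cdot> f) G e" "tri D u M v F (d \<cdot> g')"
    "h \<cdot> u = f'" "g' \<cdot> v = f \<cdot> h" "d' = v \<cdot> e" "u \<cdot> d = e \<cdot> g"
proof -
  note ty = tri_ty[OF assms(1)] tri_ty[OF assms(2)]
  obtain X Y Z X' Y' Z' where e: "f' = Mor D X A" "f = Mor A Y B" "d = Exn B Z D" "etriangle T D X A Y B Z"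
    "g' = Mor F X' B" "g = Mor B Y' G" "d' = Exn G Z' F" "etriangle T F X' B Y' G Z'"
    using assms unfolding tri_def by auto
  have "\<exists>E \<in> Ob T. \<exists>h' \<in> mor T E A. \<exists>u \<in> mor T D E. \<exists>v \<in> mor T E F.
              \<exists>d'' \<in> carrier (Ext T G E).
              Comp T D E A h' u = X \<and> Comp T E F B X' v = Comp T E A B Y h' \<and>
              (A, h', Comp T A B G Y' Y) \<in> Realn T G E d'' \<and>
              (E, u, v) \<in> Realn T F D (Pull T F B D X' Z) \<and>
              Z' = Push T G E F v d'' \<and>
              Push T B D E u Z = Pull T B G E Y' d''"
    by (rule ET4_op) (use e ty in \<open>auto simp: etriangle_def H_Mor E_Exn\<close>)
  then obtain M h u v r where m: "M \<in> Ob T" "h \<in> mor T M A" "u \<in> mor T D M" "v \<in> mor T M F"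
    "r \<in> carrier (Ext T G M)" "Comp T D M A h u = X" "Comp T M F B X' v = Comp T M A B Y h"
              "(A, h, Comp T A B G Y' Y) \<in> Realn T G M r"
              "(M, u, v) \<in> Realn T F D (Pull T F B D X' Z)"
              "Z' = Push T G M F v r" "Push T B D M u Z = Pull T B G M Y' r"
    by blast
  show ?thesis
    by (rule that[of M "Mor M h A" "Exn G r M" "Mor D u M" "Mor M v F"])
      (use m ty in \<open>auto simp: e tri_def etriangle_def H_Mor E_Exn pull_closed\<close>)
qed

definition zero_ob where "zero_ob = (SOME Z. zero_object T Z)"

lemma zero_ob: "zero_object T zero_ob" unfolding zero_ob_def using ex_zero_object by (rule someI_ex)

lemma zero_ob_Ob [simp]: "zero_ob \<in> Ob T" using zero_ob by (simp add: zero_object_def)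

lemma zero_ob_H: "f \<in> H zero_ob X \<Longrightarrow> f = ZH zero_ob X" "f \<in> H X zero_ob \<Longrightarrow> f = ZH X zero_ob"
proof -
  show "f \<in> H zero_ob X \<Longrightarrow> f = ZH zero_ob X"
    using zero_ob abelian_group_hom[THEN abelian_groupE(2)] by (fastforce simp: zero_object_def ZH_def elim!: H_E)
  show "f \<in> H X zero_ob \<Longrightarrow> f = ZH X zero_ob"
    using zero_ob abelian_group_hom[THEN abelian_groupE(2)] by (fastforce simp: zero_object_def ZH_def elim!: H_E)
qed

lemma bip_zero_ob: "A \<in> Ob T \<Longrightarrow> bip zero_ob A A (ZH zero_ob A) (idm A) (ZH A zero_ob) (idm A)"
  using zero_ob_H(1)[OF idm_H[OF zero_ob_Ob]] by (auto simp: bip_def ZH_H idm_H cmp_idm(1)[OF idm_H] plus_zero(2)[OF idm_H] cmp_zero(2)[OF ZH_H])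

text \<open>The degenerate triangles \<open>0 -> A -> A\<close> and \<open>A -> A -> 0\<close> are
  the test objects for exactness: mapping them to or from a given triangle with
  \<open>tri_mor\<close>, \<open>tri_ET3\<close> or \<open>tri_ET3_op\<close> yields the
  factorizations below.\<close>

lemma tri_zero_ob_l: "A \<in> Ob T \<Longrightarrow> tri zero_ob (ZH zero_ob A) A (idm A) A (ZE A zero_ob)"
  by (rule tri_zero, erule bip_zero_ob)

lemma tri_zero_ob_r: "A \<in> Ob T \<Longrightarrow> tri A (idm A) A (ZH A zero_ob) zero_ob (ZE zero_ob A)"
  by (rule tri_zero, rule bip_swap, erule bip_zero_ob)

lemma idm_simps [simp]: "A \<in> Ob T \<Longrightarrow> idm A \<cdot> idm A = idm A"
  "A \<in> Ob T \<Longrightarrow> B \<in> Ob T \<Longrightarrow> idm A \<cdot> ZH B A = ZH B A"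
  "A \<in> Ob T \<Longrightarrow> B \<in> Ob T \<Longrightarrow> ZH A B \<cdot> idm A = ZH A B"
  "A \<in> Ob T \<Longrightarrow> B \<in> Ob T \<Longrightarrow> idm A \<cdot> ZE B A = ZE B A"
  "A \<in> Ob T \<Longrightarrow> B \<in> Ob T \<Longrightarrow> ZE A B \<cdot> idm A = ZE A B"
  by (rule cmp_idm idm_cmp, blast intro: idm_H ZH_H ZE_E)+

lemma zero_simps [simp]: "A \<in> Ob T \<Longrightarrow> B \<in> Ob T \<Longrightarrow> C \<in> Ob T \<Longrightarrow> ZH B C \<cdot> ZH A B = ZH A C"
  "A \<in> Ob T \<Longrightarrow> B \<in> Ob T \<Longrightarrow> C \<in> Ob T \<Longrightarrow> ZE B C \<cdot> ZH A B = ZE A C"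
  "A \<in> Ob T \<Longrightarrow> B \<in> Ob T \<Longrightarrow> C \<in> Ob T \<Longrightarrow> ZH B C \<cdot> ZE A B = ZE A C"
  by (rule cmp_zero, blast intro: ZH_H ZE_E, assumption)+

lemma zero_plus_zero [simp]: "A \<in> Ob T \<Longrightarrow> B \<in> Ob T \<Longrightarrow> ZH A B \<^bold>+ ZH A B = ZH A B"
  by (rule plus_zero, blast intro: ZH_H)

text \<open>With composites normalized to the right, an equation for \<open>g \<cdot> f\<close> no
  longer matches inside \<open>g \<cdot> (f \<cdot> k)\<close>; this restores it as a rewrite
  rule.\<close>

lemma cmp_reassoc: "g \<cdot> f = h \<Longrightarrow> g \<cdot> (f \<cdot> k) = h \<cdot> k"
  by (simp flip: cmp_assoc)

section \<open>Half-exactness of Hom and E along an E-triangle\<close>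

lemma tri_yx: assumes "tri A x B y C d" shows "y \<cdot> x = ZH A C"
proof -
  note ty = tri_ty[OF assms]
  obtain c where "c \<in> H zero_ob C" "y \<cdot> x = c \<cdot> ZH A zero_ob"
    using tri_ET3[OF tri_zero_ob_r assms, of A "idm A" x] ty by (auto simp: idm_H)
  then show ?thesis using ty by simp
qed

lemma tri_dy: assumes "tri A x B y C d" shows "d \<cdot> y = ZE B A"
proof -
  note ty = tri_ty[OF assms]
  obtain a where "a \<in> H zero_ob A" "a \<cdot> ZE B zero_ob = d \<cdot> y"
    using tri_ET3_op[OF tri_zero_ob_l assms, of B "idm B" y] ty by (auto simp: idm_H)
  then show ?thesis using ty by (metis cmp_zero(3))
qed

lemma tri_xd: assumes "tri A x B y C d" shows "x \<cdot> d = ZE C B"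
proof -
  note ty = tri_ty[OF assms]
  obtain c where "c \<in> H C zero_ob" "x \<cdot> d = ZE zero_ob B \<cdot> c"
    using tri_ET3[OF assms tri_zero_ob_r, of B x "idm B"] ty by (auto simp: idm_H)
  then show ?thesis using ty by simp
qed

lemma tri_factor_out: assumes "tri A x B y C d" "g \<in> H B Z" "g \<cdot> x = ZH A Z"
  obtains h where "h \<in> H C Z" "g = h \<cdot> y"
proof -
  note ty = tri_ty[OF assms(1)] H_ob[OF assms(2)]
  obtain c where "c \<in> H C Z" "idm Z \<cdot> g = c \<cdot> y"
    using tri_ET3[OF assms(1) tri_zero_ob_l, of Z "ZH A zero_ob" g] ty assms(2,3) by (auto simp: ZH_H)
  then show ?thesis using that assms(2) by simp
qed

lemma tri_factor_in: assumes "tri A x B y C d" "g \<in> H Z B" "y \<cdot> g = ZH Z C"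
  obtains h where "h \<in> H Z A" "g = x \<cdot> h"
proof -
  note ty = tri_ty[OF assms(1)] H_ob[OF assms(2)]
  obtain c where "c \<in> H Z A" "g \<cdot> idm Z = x \<cdot> c"
    using tri_ET3_op[OF tri_zero_ob_r assms(1), of Z g "ZH zero_ob C"] ty assms(2,3) by (auto simp: ZH_H)
  then show ?thesis using that assms(2) by simp
qed

lemma tri_extend: assumes "tri A x B y C d" "a \<in> H A Z" "a \<cdot> d = ZE C Z"
  obtains b where "b \<in> H B Z" "b \<cdot> x = a"
proof -
  note ty = tri_ty[OF assms(1)] H_ob[OF assms(2)]
  obtain b where "b \<in> H B Z" "b \<cdot> x = idm Z \<cdot> a"
    using tri_mor[OF assms(1) tri_zero_ob_r, of Z a "ZH C zero_ob"] ty assms(2,3) by (auto simp: ZH_H)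
  then show ?thesis using that assms(2) by simp
qed

lemma tri_lift: assumes "tri A x B y C d" "c \<in> H Z C" "d \<cdot> c = ZE Z A"
  obtains b where "b \<in> H Z B" "y \<cdot> b = c"
proof -
  note ty = tri_ty[OF assms(1)] H_ob[OF assms(2)]
  obtain b where "b \<in> H Z B" "y \<cdot> b = c \<cdot> idm Z"
    using tri_mor[OF tri_zero_ob_l assms(1), of Z "ZH zero_ob A" c] ty assms(2,3) by (auto simp: ZH_H)
  then show ?thesis using that assms(2) by simp
qed

text \<open>Realize \<open>e\<close> by \<open>Z -> N -> C\<close>. Since \<open>e\<close> pulls
  back to zero along \<open>y\<close>, the map \<open>y\<close> lifts to \<open>N\<close>; the lift
  is the middle of a morphism of triangles over the identity of \<open>C\<close>, and its left
  component is \<open>a\<close>.\<close>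

lemma tri_E_left: assumes "tri A x B y C d" "e \<in> E C Z" "e \<cdot> y = ZE B Z"
  obtains a where "a \<in> H A Z" "e = a \<cdot> d"
proof -
  note ty = tri_ty[OF assms(1)]
  obtain N u v where N: "tri Z u N v C e" by (rule tri_ex[OF assms(2)])
  obtain b where b: "b \<in> H B N" "v \<cdot> b = y" using tri_lift[OF N _ assms(3)] ty by blast
  have "v \<cdot> b = idm C \<cdot> y" using b(2) ty by simp
  then obtain a where "a \<in> H A Z" "a \<cdot> d = e \<cdot> idm C"
    using tri_ET3_op[OF assms(1) N b(1) idm_H] ty by blast
  then show ?thesis using that assms(2) by simp
qed

text \<open>The dual of (ET4) gives the kernel \<open>M\<close> of \<open>N -> B -> C\<close> as an
  extension of \<open>A\<close> by \<open>Z\<close> with class \<open>e \<cdot> x\<close>. It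
  splits, and the retraction \<open>M -> Z\<close> pushes the class \<open>r\<close> of
  \<open>M -> N -> C\<close> to the wanted \<open>e'\<close>.\<close>

lemma tri_E_mid_l: assumes "tri A x B y C d" "e \<in> E B Z" "e \<cdot> x = ZE A Z"
  obtains e' where "e' \<in> E C Z" "e = e' \<cdot> y"
proof -
  note ty = tri_ty[OF assms(1)] E_ob[OF assms(2)]
  obtain N f' f where N: "tri Z f' N f B e" by (rule tri_ex[OF assms(2)])
  obtain M h u v r where M: "tri M h N (y \<cdot> f) C r" "tri Z u M v A (e \<cdot> x)" "u \<cdot> e = r \<cdot> y"
    by (rule tri_ET4_op[OF N assms(1)])
  obtain p where p: "p \<in> H M Z" "p \<cdot> u = idm Z"
    using tri_extend[OF M(2), of "idm Z" Z] assms(3) ty by (auto simp: idm_H)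
  have "e = (p \<cdot> u) \<cdot> e" using p assms(2) by simp
  also have "\<dots> = (p \<cdot> r) \<cdot> y" by (simp add: cmp_assoc M(3))
  finally show ?thesis using that[of "p \<cdot> r"] p(1) tri_ty[OF M(1)] cmp_HE by blast
qed

lemma tri_E_mid_r: assumes "tri A x B y C d" "e \<in> E Z B" "y \<cdot> e = ZE Z C"
  obtains e' where "e' \<in> E Z A" "e = x \<cdot> e'"
proof -
  note ty = tri_ty[OF assms(1)] E_ob[OF assms(2)]
  obtain N g g' where N: "tri B g N g' Z e" by (rule tri_ex[OF assms(2)])
  obtain M h u v r where M: "tri A (g \<cdot> x) N h M r" "tri C u M v Z (y \<cdot> e)" "x \<cdot> r = e \<cdot> v"
    by (rule tri_ET4[OF assms(1) N])
  obtain s where s: "s \<in> H Z M" "v \<cdot> s = idm Z"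
    using tri_lift[OF M(2), of "idm Z" Z] assms(3) ty by (auto simp: idm_H)
  have "e = e \<cdot> (v \<cdot> s)" using s assms(2) by simp
  also have "\<dots> = x \<cdot> (r \<cdot> s)" by (simp add: M(3) flip: cmp_assoc)
  finally show ?thesis using that[of "r \<cdot> s"] s(1) tri_ty[OF M(1)] cmp_EH by blast
qed

section \<open>Isomorphisms of E-triangles and split E-triangles\<close>

definition inverse_pair where
  "inverse_pair A B f g \<longleftrightarrow> f \<in> H A B \<and> g \<in> H B A \<and> g \<cdot> f = idm A \<and> f \<cdot> g = idm B"

lemma iso_sym: "inverse_pair A B f g \<Longrightarrow> inverse_pair B A g f" by (auto simp: inverse_pair_def)

lemma isoI: assumes "f \<in> H A B" "g \<in> H B A" "g' \<in> H B A" "f \<cdot> g = idm B" "g' \<cdot> f = idm A"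
  shows "inverse_pair A B f g"
proof -
  have "g' = g' \<cdot> (f \<cdot> g)" using assms by simp
  also have "\<dots> = (g' \<cdot> f) \<cdot> g" by (rule cmp_assoc[symmetric])
  also have "\<dots> = g" using assms by simp
  finally show ?thesis using assms by (simp add: inverse_pair_def)
qed

text \<open>In place of a diagram chase, a right and a left inverse of \<open>b\<close> are built
  separately, each by correcting a first guess; \<open>isoI\<close> merges them.\<close>

lemma tri_five:
  assumes t: "tri A x B y C d" "tri A' x' B' y' C' d'" and a: "inverse_pair A A' a a'" and c: "inverse_pair C C' c c'"
    and b: "b \<in> H B B'" "b \<cdot> x = x' \<cdot> a" "y' \<cdot> b = c \<cdot> y" and e: "a \<cdot> d = d' \<cdot> c"
  obtains b' where "inverse_pair B B' b b'"
proof -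
  note ty = tri_ty[OF t(1)] tri_ty[OF t(2)]
  have a': "a \<in> H A A'" "a' \<in> H A' A" "a' \<cdot> a = idm A" "a \<cdot> a' = idm A'" using a by (auto simp: inverse_pair_def)
  have c': "c \<in> H C C'" "c' \<in> H C' C" "c' \<cdot> c = idm C" "c \<cdot> c' = idm C'" using c by (auto simp: inverse_pair_def)
  have e': "a' \<cdot> d' = d \<cdot> c'"
  proof -
    have "a' \<cdot> d' = a' \<cdot> (d' \<cdot> (c \<cdot> c'))" using ty c' by simp
    also have "\<dots> = a' \<cdot> (a \<cdot> d) \<cdot> c'" by (simp add: e cmp_assoc)
    also have "\<dots> = d \<cdot> c'" using ty a' by (simp flip: cmp_assoc)
    finally show ?thesis .
  qed
  have "d \<cdot> (c' \<cdot> y') = a' \<cdot> (d' \<cdot> y')" by (simp add: e' flip: cmp_assoc)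
  then have "d \<cdot> (c' \<cdot> y') = ZE B' A"
    using tri_dy[OF t(2)] a' ty by simp
  \<comment> \<open>The guess \<open>t0\<close> inverts \<open>b\<close> after projection to
    \<open>C'\<close>, so its error maps to zero there and factors through \<open>x'\<close> as
    \<open>m\<close>; adding \<open>x \<cdot> (a' \<cdot> m)\<close> removes it.\<close>
  then obtain t0 where t0: "t0 \<in> H B' B" "y \<cdot> t0 = c' \<cdot> y'"
    using tri_lift[OF t(1), of "c' \<cdot> y'" B'] c' ty cmp_HH by blast
  have "y' \<cdot> (idm B' \<^bold>- b \<cdot> t0) = ZH B' C'"
    using ty t0 c' by (simp add: cmp_plus cmp_neg cmp_reassoc[OF b(3)] cmp_assoc) (simp add: cmp_reassoc[OF c'(4)])
  moreover have "idm B' \<^bold>- b \<cdot> t0 \<in> H B' B'" using ty b t0 by (blast intro: arrI)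
  ultimately obtain m where m: "m \<in> H B' A'" "idm B' \<^bold>- b \<cdot> t0 = x' \<cdot> m"
    using tri_factor_in[OF t(2)] by blast
  have "x' \<cdot> m = b \<cdot> (x \<cdot> (a' \<cdot> m))"
    using m a' by (simp add: cmp_reassoc[OF b(2)] cmp_assoc cmp_reassoc[OF a'(4)])
  then have r: "b \<cdot> (t0 \<^bold>+ x \<cdot> (a' \<cdot> m)) = idm B'"
    using minus_eqD[OF idm_H[OF ty(11)] cmp_HH[OF b(1) t0(1)] m(2)] by (simp add: cmp_plus)
  have "x \<cdot> a' \<cdot> d' = ZE C' B"
    using tri_xd[OF t(1)] c' ty by (simp add: cmp_assoc e' cmp_reassoc[OF tri_xd[OF t(1)]])
  \<comment> \<open>Dually, \<open>s0\<close> inverts \<open>b\<close> on the image of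
    \<open>A\<close>; the error vanishes on \<open>x\<close> and hence factors through
    \<open>y\<close>.\<close>
  then obtain s0 where s0: "s0 \<in> H B' B" "s0 \<cdot> x' = x \<cdot> a'"
    using tri_extend[OF t(2), of "x \<cdot> a'" B] a' ty cmp_HH by blast
  have "(idm B \<^bold>- s0 \<cdot> b) \<cdot> x = ZH A B"
    using ty s0 a' by (simp add: plus_cmp neg_cmp b(2) cmp_assoc cmp_reassoc[OF s0(2)])
  moreover have "idm B \<^bold>- s0 \<cdot> b \<in> H B B" using ty b s0 by (blast intro: arrI)
  ultimately obtain n where n: "n \<in> H C B" "idm B \<^bold>- s0 \<cdot> b = n \<cdot> y"
    using tri_factor_out[OF t(1)] by blast
  have "n \<cdot> y = n \<cdot> c' \<cdot> y' \<cdot> b"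
    using n c' ty by (simp add: cmp_assoc b(3) cmp_reassoc[OF c'(3)])
  then have l: "(s0 \<^bold>+ n \<cdot> c' \<cdot> y') \<cdot> b = idm B"
    using minus_eqD[OF idm_H[OF ty(5)] cmp_HH[OF s0(1) b(1)] n(2)] by (simp add: plus_cmp)
  show ?thesis
    by (rule that, rule isoI[OF b(1) _ _ r l]) (use t0 s0 ty a' c' m n in \<open>blast intro: arrI\<close>)+
qed

lemma class_iso: assumes "X \<in> Ob T" "A \<in> Ob T" "d \<in> carrier (Ext T X A)" "(B, x, y) \<in> Realn T X A d"
  "is_iso T B B' b" "B' \<in> Ob T" "y' \<in> mor T B' X" "Comp T B B' X y' b = y"
  shows "(B', Comp T A B B' b x, y') \<in> Realn T X A d"
proof -
  obtain s where s: "s \<in> short_seqs T X A" "Realn T X A d = seq_equiv T X A `` {s}"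
    using realn_class[OF assms(1-3)] by (auto elim: quotientE)
  obtain S u v where S: "s = (S, u, v)" by (cases s)
  have m: "(B, x, y) \<in> short_seqs T X A" using class_mem(1)[OF assms(1-3)] assms(4) by blast
  obtain f where f: "is_iso T S B f" "Comp T A S B f u = x" "Comp T S B X y f = v"
    using s(2) assms(4) by (auto simp: S seq_equiv_def)
  obtain f' where f': "f' \<in> mor T B S" "Comp T S B S f' f = Idm T S" "Comp T B S B f f' = Idm T B" "f \<in> mor T S B"
    using f(1) by (auto simp: is_iso_def)
  obtain b' where b': "b' \<in> mor T B' B" "Comp T B B' B b' b = Idm T B" "Comp T B' B B' b b' = Idm T B'" "b \<in> mor T B B'"
    using assms(5) by (auto simp: is_iso_def)
  have o: "S \<in> Ob T" "B \<in> Ob T" "u \<in> mor T A S" "v \<in> mor T S X" "x \<in> mor T A B" "y \<in> mor T B X"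
    using s(1) m by (auto simp: S short_seqs_def)
  have M: "inverse_pair S B (Mor S f B) (Mor B f' S)" "inverse_pair B B' (Mor B b B') (Mor B' b' B)"
    using f' b' o assms(6) by (auto simp: inverse_pair_def H_Mor idm_def)
  have "inverse_pair S B' (Mor B b B' \<cdot> Mor S f B) (Mor B f' S \<cdot> Mor B' b' B)"
  proof -
    have "Mor B f' S \<cdot> (Mor B' b' B \<cdot> (Mor B b B' \<cdot> Mor S f B)) = idm S"
      "Mor B b B' \<cdot> (Mor S f B \<cdot> (Mor B f' S \<cdot> Mor B' b' B)) = idm B'"
      using M unfolding inverse_pair_def by (metis cmp_assoc idm_cmp(1))+
    then show ?thesis using M unfolding inverse_pair_def by (metis cmp_assoc cmp_HH)
  qed
  then have "is_iso T S B' (Comp T S B B' b f)"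
    using f' b' o assms(6) by (auto simp: inverse_pair_def is_iso_def H_Mor idm_def intro!: bexI[of _ "Comp T B' B S f' b'"])
  moreover have "Comp T A S B' (Comp T S B B' b f) u = Comp T A B B' b x"
    using f f' b' o assms(2,6) by (simp flip: comp_assoc)
  moreover have "Comp T S B' X y' (Comp T S B B' b f) = v"
    using f f' b' o assms(1,6-8) by (simp add: comp_assoc)
  ultimately have "((S, u, v), (B', Comp T A B B' b x, y')) \<in> seq_equiv T X A"
    using s(1) assms o b' by (auto simp: S seq_equiv_def short_seqs_def comp_closed)
  then show ?thesis by (simp add: s(2) S)
qed

lemma tri_iso_mid: assumes "tri A x B y C d" "inverse_pair B B' b b'" shows "tri A (b \<cdot> x) B' (y \<cdot> b') C d"
proof -
  note ty = tri_ty[OF assms(1)]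
  obtain X Y D where e: "x = Mor A X B" "y = Mor B Y C" "d = Exn C D A" "etriangle T A X B Y C D"
    using assms unfolding tri_def by auto
  obtain f f' where b: "b = Mor B f B'" "b' = Mor B' f' B" "f \<in> mor T B B'" "f' \<in> mor T B' B" "B' \<in> Ob T"
    "Comp T B B' B f' f = Idm T B" "Comp T B' B B' f f' = Idm T B'"
    using assms(2) by (auto simp: inverse_pair_def idm_def H_Mor elim!: H_E)
  have o: "X \<in> mor T A B" "Y \<in> mor T B C" "D \<in> carrier (Ext T C A)" using ty by (auto simp: e H_Mor E_Exn)
  have "Comp T B B' C (Comp T B' B C Y f') f = Y"
    using b o ty by (simp add: comp_assoc[symmetric] id_right)
  then have "(B', Comp T A B B' f X, Comp T B' B C Y f') \<in> Realn T C A D"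
    using e(4) b o ty by (intro class_iso[of C A D B X Y]) (auto simp: etriangle_def is_iso_def comp_closed)
  then show ?thesis using b ty o by (auto simp: e tri_def etriangle_def H_Mor)
qed

lemma iso_one: "A \<in> Ob T \<Longrightarrow> inverse_pair A A (idm A) (idm A)"
  by (simp add: inverse_pair_def idm_H)

lemma tri_unique: assumes "tri A x B y C d" "tri A x' B' y' C d"
  obtains b b' where "inverse_pair B B' b b'" "b \<cdot> x = x'" "y' \<cdot> b = y"
proof -
  note ty = tri_ty[OF assms(1)] tri_ty[OF assms(2)]
  have "idm A \<cdot> d = d \<cdot> idm C" using ty by simp
  then obtain b where b: "b \<in> H B B'" "b \<cdot> x = x' \<cdot> idm A" "y' \<cdot> b = idm C \<cdot> y"
    using tri_mor[OF assms idm_H idm_H] ty by blast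
  obtain b' where "inverse_pair B B' b b'"
    using tri_five[OF assms iso_one iso_one b] ty by auto
  then show ?thesis using that b ty by simp
qed

text \<open>A realization class fixes both end terms, so changing an end means realizing the
  transported extension afresh and comparing the two triangles by \<open>tri_five\<close>.\<close>

lemma tri_iso_l: assumes "tri A x B y C d" "inverse_pair A A' a a'" shows "tri A' (x \<cdot> a') B y C (a \<cdot> d)"
proof -
  note ty = tri_ty[OF assms(1)]
  have a: "a \<in> H A A'" "a' \<in> H A' A" "a' \<cdot> a = idm A" "a \<cdot> a' = idm A'" using assms(2) by (auto simp: inverse_pair_def)
  obtain B1 x1 y1 where t: "tri A' x1 B1 y1 C (a \<cdot> d)" using tri_ex cmp_HE[OF a(1) ty(3)] by blast
  note ty' = tri_ty[OF t]
  have e: "a \<cdot> d = (a \<cdot> d) \<cdot> idm C" using ty' by simp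
  obtain b where b: "b \<in> H B B1" "b \<cdot> x = x1 \<cdot> a" "y1 \<cdot> b = idm C \<cdot> y"
    by (rule tri_mor[OF assms(1) t a(1) idm_H[OF ty(6)] e])
  obtain b' where b': "inverse_pair B B1 b b'" by (rule tri_five[OF assms(1) t assms(2) iso_one[OF ty(6)] b e])
  have "b' \<cdot> x1 = b' \<cdot> (x1 \<cdot> (a \<cdot> a'))" using a ty' by simp
  also have "\<dots> = (b' \<cdot> b) \<cdot> x \<cdot> a'" by (simp add: cmp_assoc b(2) cmp_reassoc[OF b(2)])
  also have "\<dots> = x \<cdot> a'" using b' ty by (simp add: inverse_pair_def)
  finally show ?thesis using tri_iso_mid[OF t iso_sym[OF b']] b(3) ty by simp
qed

lemma tri_iso_r: assumes "tri A x B y C d" "inverse_pair C C' c c'" shows "tri A x B (c \<cdot> y) C' (d \<cdot> c')"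
proof -
  note ty = tri_ty[OF assms(1)]
  have a: "c \<in> H C C'" "c' \<in> H C' C" "c' \<cdot> c = idm C" "c \<cdot> c' = idm C'" using assms(2) by (auto simp: inverse_pair_def)
  obtain B1 x1 y1 where t: "tri A x1 B1 y1 C' (d \<cdot> c')" using tri_ex cmp_EH[OF ty(3) a(2)] by blast
  note ty' = tri_ty[OF t]
  have e: "idm A \<cdot> d = (d \<cdot> c') \<cdot> c" using ty a by (simp add: cmp_assoc)
  obtain b where b: "b \<in> H B B1" "b \<cdot> x = x1 \<cdot> idm A" "y1 \<cdot> b = c \<cdot> y"
    by (rule tri_mor[OF assms(1) t idm_H[OF ty(4)] a(1) e])
  obtain b' where b': "inverse_pair B B1 b b'" by (rule tri_five[OF assms(1) t iso_one[OF ty(4)] assms(2) b e])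
  have "b' \<cdot> x1 = b' \<cdot> (x1 \<cdot> idm A)" using ty' by simp
  also have "\<dots> = (b' \<cdot> b) \<cdot> x" by (simp add: cmp_assoc b(2))
  also have "\<dots> = x" using b' ty by (simp add: inverse_pair_def)
  finally show ?thesis using tri_iso_mid[OF t iso_sym[OF b']] b(3) ty by simp
qed

lemma bip_iso: assumes "bip A B P i j p q" "inverse_pair P Q f g" shows "bip A B Q (f \<cdot> i) (f \<cdot> j) (p \<cdot> g) (q \<cdot> g)"
proof -
  note ty = bip_ty[OF assms(1)] and e = bip_eq[OF assms(1)]
  have f: "f \<in> H P Q" "g \<in> H Q P" "g \<cdot> f = idm P" "f \<cdot> g = idm Q" using assms(2) by (auto simp: inverse_pair_def)
  have "f \<cdot> (i \<cdot> p \<^bold>+ j \<cdot> q) \<cdot> g = idm Q" using f by (simp add: e(5))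
  then have "f \<cdot> (i \<cdot> (p \<cdot> g)) \<^bold>+ f \<cdot> (j \<cdot> (q \<cdot> g)) = idm Q" by (simp add: cmp_plus plus_cmp cmp_assoc)
  then show ?thesis using ty f e by (auto simp: bip_def cmp_assoc cmp_reassoc[OF f(3)] intro: cmp_HH)
qed

lemma tri_split: assumes "tri A x B y C (ZE C A)"
  obtains s r where "bip A C B x s r y"
proof -
  note ty = tri_ty[OF assms]
  obtain P i j p q where b: "bip A C P i j p q" by (rule bip_ex[OF ty(4,6)])
  obtain f g where f: "inverse_pair P B f g" "f \<cdot> i = x" "y \<cdot> f = q" by (rule tri_unique[OF tri_zero[OF b] assms])
  have "q \<cdot> g = y"
  proof -
    have "q \<cdot> g = y \<cdot> (f \<cdot> g)" by (simp add: cmp_assoc flip: f(3))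
    then show ?thesis using f(1) ty by (simp add: inverse_pair_def)
  qed
  then show ?thesis using that bip_iso[OF b f(1)] f(2) by metis
qed

lemma tri_split_section: assumes "tri A x B y C d" "s \<in> H C B" "y \<cdot> s = idm C"
  obtains s r where "bip A C B x s r y"
proof -
  note ty = tri_ty[OF assms(1)]
  have "d = (d \<cdot> y) \<cdot> s" using assms(3) ty by (simp add: cmp_assoc)
  then have "d = ZE C A" using tri_dy[OF assms(1)] assms(2) ty by simp
  then show ?thesis using tri_split assms(1) that by metis
qed

section \<open>Pushouts and pullbacks of E-triangles\<close>

text \<open>Here \<open>N\<close> is an extension of \<open>C \<oplus> D\<close> by
  \<open>V\<close>. The kernel of \<open>N -> D\<close> is an extension of \<open>C\<close> by
  \<open>V\<close> with class \<open>\<nu> \<cdot> iC\<close>, so it can be taken to be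
  \<open>A\<close>.\<close>

lemma pushout_half:
  assumes b: "bip C D Q iC iD pC pD" and N: "tri V f' N f Q \<nu>" and t: "tri V x A y C (\<nu> \<cdot> iC)"
  obtains n where "tri A n N (pD \<cdot> f) D (x \<cdot> (\<nu> \<cdot> iD))" "n \<cdot> x = f'" "pC \<cdot> f \<cdot> n = y"
proof -
  note ty = bip_ty[OF b] tri_ty[OF N] tri_ty[OF t] and e = bip_eq[OF b]
  obtain M h u v r where M: "tri M h N (pD \<cdot> f) D r" "tri V u M v C (\<nu> \<cdot> iC)" "h \<cdot> u = f'" "iC \<cdot> v = f \<cdot> h"
    "u \<cdot> \<nu> = r \<cdot> pD"
    by (rule tri_ET4_op[OF N tri_zero[OF b]])
  obtain k k' where k: "inverse_pair M A k k'" "k \<cdot> u = x" "y \<cdot> k = v" by (rule tri_unique[OF M(2) t])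
  have k': "k' \<in> H A M" "k \<in> H M A" "k' \<cdot> k = idm M" "k \<cdot> k' = idm A" using k(1) by (auto simp: inverse_pair_def)
  have r: "r = u \<cdot> (\<nu> \<cdot> iD)"
    using e(2) tri_ty[OF M(1)] by (simp add: M(5) cmp_assoc flip: cmp_assoc[of u \<nu> iD])
  have "tri A (h \<cdot> k') N (pD \<cdot> f) D (x \<cdot> (\<nu> \<cdot> iD))"
    using tri_iso_l[OF M(1) k(1)] by (simp add: r cmp_reassoc[OF k(2)])
  moreover have "h \<cdot> k' \<cdot> x = f'"
    using tri_ty[OF M(2)] by (simp add: k'(3) M(3) cmp_assoc cmp_reassoc[OF k'(3)] flip: k(2))
  moreover have "pC \<cdot> f \<cdot> (h \<cdot> k') = y"
  proof -
    have "pC \<cdot> f \<cdot> (h \<cdot> k') = (pC \<cdot> iC) \<cdot> (y \<cdot> (k \<cdot> k'))"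
      by (simp add: cmp_assoc cmp_reassoc[OF M(4)[symmetric]] cmp_reassoc[OF k(3)])
    then show ?thesis using k'(4) ty e by simp
  qed
  ultimately show ?thesis by (rule that)
qed

lemma pushout:
  assumes "tri V x A y C d" "tri V s B t D d'"
  obtains N n1 m1 n2 m2 where "tri A n1 N m1 D (x \<cdot> d')" "tri B n2 N m2 C (s \<cdot> d)"
    "n1 \<cdot> x = n2 \<cdot> s" "m2 \<cdot> n1 = y" "m1 \<cdot> n2 = t"
proof -
  note ty = tri_ty[OF assms(1)] tri_ty[OF assms(2)]
  obtain Q iC iD pC pD where b: "bip C D Q iC iD pC pD" by (rule bip_ex[OF ty(6) ty(12)])
  note bt = bip_ty[OF b] and e = bip_eq[OF b]
  \<comment> \<open>The extension of \<open>C \<oplus> D\<close> by \<open>V\<close> with components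
    \<open>d\<close> and \<open>d'\<close>; its middle term plays the role of the pushout of
    \<open>A\<close> and \<open>B\<close> under \<open>V\<close>.\<close>
  let ?n = "d \<cdot> pC \<^bold>+ d' \<cdot> pD"
  have n: "?n \<in> E Q V" using ty bt by (blast intro: arrI)
  obtain N f' f where N: "tri V f' N f Q ?n" by (rule tri_ex[OF n])
  have 1: "?n \<cdot> iC = d" "?n \<cdot> iD = d'" using ty bt e by (simp_all add: plus_cmp cmp_assoc)
  obtain n1 where n1: "tri A n1 N (pD \<cdot> f) D (x \<cdot> d')" "n1 \<cdot> x = f'" "pC \<cdot> f \<cdot> n1 = y"
    using pushout_half[OF b N] assms(1) unfolding 1 by blast
  obtain n2 where n2: "tri B n2 N (pC \<cdot> f) C (s \<cdot> d)" "n2 \<cdot> s = f'" "pD \<cdot> f \<cdot> n2 = t"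
    using pushout_half[OF bip_swap[OF b] N] assms(2) unfolding 1 by blast
  show ?thesis using that[OF n1(1) n2(1)] n1 n2 by simp
qed

lemma pullback_half:
  assumes b: "bip A A' Q i j p q" and N: "tri Q f N f' C \<nu>" and t: "tri A' x' B' y' C (q \<cdot> \<nu>)"
  obtains m where "tri A (f \<cdot> i) N m B' (p \<cdot> \<nu> \<cdot> y')" "y' \<cdot> m = f'"
proof -
  note ty = bip_ty[OF b] tri_ty[OF N] tri_ty[OF t] and e = bip_eq[OF b]
  obtain M h u v r where M: "tri A (f \<cdot> i) N h M r" "tri A' u M v C (q \<cdot> \<nu>)" "v \<cdot> h = f'" "i \<cdot> r = \<nu> \<cdot> v"
    by (rule tri_ET4[OF tri_zero[OF b] N])
  obtain k k' where k: "inverse_pair M B' k k'" "k \<cdot> u = x'" "y' \<cdot> k = v" by (rule tri_unique[OF M(2) t])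
  have k': "k' \<in> H B' M" "k \<in> H M B'" "k' \<cdot> k = idm M" "k \<cdot> k' = idm B'" using k(1) by (auto simp: inverse_pair_def)
  have "r = (p \<cdot> i) \<cdot> r" using e(1) tri_ty[OF M(1)] by simp
  then have r: "r = p \<cdot> \<nu> \<cdot> v" by (simp add: cmp_assoc M(4))
  have "v \<cdot> k' = y'" using k'(4) ty by (simp add: cmp_assoc flip: k(3))
  then have "tri A (f \<cdot> i) N (k \<cdot> h) B' (p \<cdot> \<nu> \<cdot> y')"
    using tri_iso_r[OF M(1) k(1)] by (simp add: r cmp_assoc)
  moreover have "y' \<cdot> (k \<cdot> h) = f'" using M(3) by (simp add: k(3) flip: cmp_assoc)
  ultimately show ?thesis by (rule that)
qed

lemma pullback:
  assumes "tri A x B y C d" "tri A' x' B' y' C d'"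
  obtains N n1 m1 n2 m2 where "tri A n1 N m1 B' (d \<cdot> y')" "tri A' n2 N m2 B (d' \<cdot> y)"
    "y' \<cdot> m1 = y \<cdot> m2"
proof -
  note ty = tri_ty[OF assms(1)] tri_ty[OF assms(2)]
  obtain Q i j p q where b: "bip A A' Q i j p q" by (rule bip_ex[OF ty(4) ty(10)])
  note bt = bip_ty[OF b] and e = bip_eq[OF b]
  \<comment> \<open>Dually, the extension of \<open>C\<close> by \<open>A \<oplus> A'\<close> with
    components \<open>d\<close> and \<open>d'\<close>.\<close>
  let ?n = "i \<cdot> d \<^bold>+ j \<cdot> d'"
  have n: "?n \<in> E C Q" using ty bt by (blast intro: arrI)
  obtain N f' f where N: "tri Q f N f' C ?n" using tri_ex[OF n] by blast
  have 1: "p \<cdot> ?n = d" "q \<cdot> ?n = d'"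
    using ty bt e by (simp_all add: cmp_plus cmp_reassoc)
  obtain m1 where m1: "tri A (f \<cdot> i) N m1 B' (d \<cdot> y')" "y' \<cdot> m1 = f'"
    using pullback_half[OF b N] assms(2) unfolding 1 by blast
  obtain m2 where m2: "tri A' (f \<cdot> j) N m2 B (d' \<cdot> y)" "y \<cdot> m2 = f'"
    using pullback_half[OF bip_swap[OF b] N] assms(1) unfolding 1 by blast
  show ?thesis using that[OF m1(1) m2(1)] m1 m2 by simp
qed

section \<open>Vanishing extensions, retracts, inflations\<close>

definition E0 where "E0 X A \<longleftrightarrow> (\<forall>e \<in> E X A. e = ZE X A)"

definition retract where "retract A B \<longleftrightarrow> (\<exists>f \<in> H A B. \<exists>g \<in> H B A. g \<cdot> f = idm A)"

definition confl where "confl A B C \<longleftrightarrow> (\<exists>x y d. tri A x B y C d)"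

lemma confl_iff: "conflation T A B C \<longleftrightarrow> confl A B C"
proof
  assume "conflation T A B C"
  then obtain x y d where e: "etriangle T A x B y C d" by (auto simp: conflation_def)
  then show "confl A B C" by (auto simp: confl_def tri_def)
qed (auto simp: conflation_def confl_def tri_def)

lemma E0_iff: "X \<in> Ob T \<Longrightarrow> A \<in> Ob T \<Longrightarrow> carrier (Ext T X A) = {\<zero>\<^bsub>Ext T X A\<^esub>} \<longleftrightarrow> E0 X A"
  using ZE_E[of X A] by (auto simp: E0_def E_def ZE_def)

lemma retract_ob: "retract A B \<Longrightarrow> A \<in> Ob T \<and> B \<in> Ob T" by (auto simp: retract_def dest: H_ob)

lemma retract_trans: assumes "retract A B" "retract B C" shows "retract A C"
proof -
  obtain f g where f: "f \<in> H A B" "g \<in> H B A" "g \<cdot> f = idm A" using assms(1) by (auto simp: retract_def)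
  obtain h k where h: "h \<in> H B C" "k \<in> H C B" "k \<cdot> h = idm B" using assms(2) by (auto simp: retract_def)
  have "(g \<cdot> k) \<cdot> (h \<cdot> f) = g \<cdot> ((k \<cdot> h) \<cdot> f)" by (simp add: cmp_assoc)
  also have "\<dots> = idm A" using f h by simp
  finally show ?thesis using f h unfolding retract_def by (blast intro: cmp_HH)
qed

lemma iso_retract: "inverse_pair A B f g \<Longrightarrow> retract A B" "inverse_pair A B f g \<Longrightarrow> retract B A" by (auto simp: inverse_pair_def retract_def)

lemma bip_retract: "bip A B P i j p q \<Longrightarrow> retract A P" "bip A B P i j p q \<Longrightarrow> retract B P"
  by (auto simp: bip_def retract_def)

lemma retract_bip_sum: assumes "bip B C P i j p q" "f \<in> H A B" "f' \<in> H B A" "g \<in> H A C" "g' \<in> H C A"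
  "f' \<cdot> f \<^bold>+ g' \<cdot> g = idm A"
  shows "retract A P"
proof -
  note ty = bip_ty[OF assms(1)] and e = bip_eq[OF assms(1)]
  have "f' \<cdot> f \<in> H A A" "g' \<cdot> g \<in> H A A" using assms by (blast intro: cmp_HH)+
  then have "(f' \<cdot> p \<^bold>+ g' \<cdot> q) \<cdot> (i \<cdot> f \<^bold>+ j \<cdot> g) = idm A"
    using ty assms(2-5) assms(6) H_ob[OF assms(2)]
    by (simp add: cmp_plus plus_cmp cmp_assoc bip_cmp[OF assms(1)] del: cmp_zero zero_simps)
       (simp add: plus_commute)
  then show ?thesis using ty assms(2-5) unfolding retract_def by (blast intro: arrI)
qed

lemma E0_retract_l: assumes "retract A B" "E0 B C" shows "E0 A C"
  unfolding E0_def
proof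
  fix e assume e: "e \<in> E A C"
  obtain f g where f: "f \<in> H A B" "g \<in> H B A" "g \<cdot> f = idm A" using assms(1) by (auto simp: retract_def)
  have "e = e \<cdot> g \<cdot> f" using e f by (simp add: cmp_assoc)
  also have "e \<cdot> g = ZE B C" using assms(2) e f(2) cmp_EH by (auto simp: E0_def)
  finally show "e = ZE A C" using f(1) E_ob[OF e] by simp
qed

lemma E0_retract_r: assumes "retract A B" "E0 C B" shows "E0 C A"
  unfolding E0_def
proof
  fix e assume e: "e \<in> E C A"
  obtain f g where f: "f \<in> H A B" "g \<in> H B A" "g \<cdot> f = idm A" using assms(1) by (auto simp: retract_def)
  have "e = g \<cdot> (f \<cdot> e)" using e f by (simp flip: cmp_assoc)
  also have "f \<cdot> e = ZE C B" using assms(2) e f(1) cmp_HE by (auto simp: E0_def)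
  finally show "e = ZE C A" using f(2) E_ob[OF e] by simp
qed

lemma E0_ext_l: assumes "tri A x B y C d" "E0 A Z" "E0 C Z" shows "E0 B Z"
  unfolding E0_def
proof
  fix e assume e: "e \<in> E B Z"
  note ty = tri_ty[OF assms(1)]
  have "e \<cdot> x = ZE A Z" using assms(2) e ty cmp_EH by (auto simp: E0_def)
  then obtain e' where "e' \<in> E C Z" "e = e' \<cdot> y" by (rule tri_E_mid_l[OF assms(1) e])
  then show "e = ZE B Z" using assms(3) ty E_ob[OF e] by (auto simp: E0_def)
qed

lemma E0_ext_r: assumes "tri A x B y C d" "E0 Z A" "E0 Z C" shows "E0 Z B"
  unfolding E0_def
proof
  fix e assume e: "e \<in> E Z B"
  note ty = tri_ty[OF assms(1)]
  have "y \<cdot> e = ZE Z C" using assms(3) e ty cmp_HE by (auto simp: E0_def)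
  then obtain e' where "e' \<in> E Z A" "e = x \<cdot> e'" by (rule tri_E_mid_r[OF assms(1) e])
  then show "e = ZE Z B" using assms(2) ty E_ob[OF e] by (auto simp: E0_def)
qed

lemma E0_zero_ob: "A \<in> Ob T \<Longrightarrow> E0 A zero_ob" "A \<in> Ob T \<Longrightarrow> E0 zero_ob A"
proof -
  assume A: "A \<in> Ob T"
  have z: "idm zero_ob = ZH zero_ob zero_ob" by (rule zero_ob_H(1)[OF idm_H[OF zero_ob_Ob]])
  show "E0 A zero_ob" unfolding E0_def
  proof
    fix e assume e: "e \<in> E A zero_ob"
    then have "e = idm zero_ob \<cdot> e" by simp
    then show "e = ZE A zero_ob" using e by (simp add: z)
  qed
  show "E0 zero_ob A" unfolding E0_def
  proof
    fix e assume e: "e \<in> E zero_ob A"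
    then have "e = e \<cdot> idm zero_ob" by simp
    then show "e = ZE zero_ob A" using e A by (simp add: z)
  qed
qed

lemma E0_split: assumes "tri A x B y C d" "E0 C A" obtains s r where "bip A C B x s r y"
proof -
  have "d = ZE C A" using assms tri_ty[OF assms(1)] by (auto simp: E0_def)
  then show ?thesis using tri_split[of A x B y C] assms(1) that by blast
qed

lemma E0_lift: assumes "tri A x B y C d" "E0 Z A" "c \<in> H Z C" obtains b where "b \<in> H Z B" "y \<cdot> b = c"
proof -
  have "d \<cdot> c = ZE Z A" using assms tri_ty[OF assms(1)] cmp_EH by (auto simp: E0_def)
  then show ?thesis by (rule tri_lift[OF assms(1,3)]) (rule that)
qed

lemma E0_extend: assumes "tri A x B y C d" "E0 C Z" "a \<in> H A Z" obtains b where "b \<in> H B Z" "b \<cdot> x = a"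
proof -
  have "a \<cdot> d = ZE C Z" using assms tri_ty[OF assms(1)] cmp_HE by (auto simp: E0_def)
  then show ?thesis by (rule tri_extend[OF assms(1,3)]) (rule that)
qed

text \<open>If \<open>I\<close> is injective, the inflation \<open>x\<close> of any triangle
  \<open>I -> B -> X\<close> has a left inverse; as \<open>x\<close> kills the extension of its own
  triangle, that extension is zero.\<close>

lemma injectives_iff: "I \<in> injectives T \<longleftrightarrow> I \<in> Ob T \<and> (\<forall>X \<in> Ob T. E0 X I)"
proof
  assume I: "I \<in> injectives T"
  then have ob: "I \<in> Ob T" by (simp add: injectives_def)
  have "e = ZE X I" if X: "X \<in> Ob T" "e \<in> E X I" for X e
  proof -
    obtain B x y where t: "tri I x B y X e" by (rule tri_ex[OF X(2)])
    then obtain x' y' e' where e: "x = Mor I x' B" "y = Mor B y' X" "e = Exn X e' I" "etriangle T I x' B y' X e'"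
      by (auto simp: tri_def)
    obtain g where g: "g \<in> mor T B I" "Comp T I B I g x' = Idm T I"
      using I e(4) id_closed[OF ob] unfolding injectives_def by blast
    then have "Mor B g I \<cdot> x = idm I" "Mor B g I \<in> H B I"
      using tri_ty[OF t] by (auto simp: e(1) idm_def H_Mor)
    have "e = (Mor B g I \<cdot> x) \<cdot> e" using \<open>Mor B g I \<cdot> x = idm I\<close> X by simp
    also have "\<dots> = Mor B g I \<cdot> (x \<cdot> e)" by (rule cmp_assoc)
    also have "\<dots> = ZE X I" using tri_xd[OF t] \<open>Mor B g I \<in> H B I\<close> X(1) by simp
    finally show ?thesis .
  qed
  then show "I \<in> Ob T \<and> (\<forall>X \<in> Ob T. E0 X I)" using ob by (auto simp: E0_def)
next
  assume I: "I \<in> Ob T \<and> (\<forall>X \<in> Ob T. E0 X I)"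
  have "\<exists>g \<in> mor T B I. Comp T A B I g x = f" if e: "etriangle T A x B y X d" and f: "f \<in> mor T A I" for A x B y X d f
  proof -
    have t: "tri A (Mor A x B) B (Mor B y X) X (Exn X d A)" using e by (auto simp: tri_def)
    have "Mor A f I \<in> H A I" using f e I by (auto simp: etriangle_def H_Mor)
    then obtain b where "b \<in> H B I" "b \<cdot> Mor A x B = Mor A f I"
      using E0_extend[OF t, of I] tri_ty[OF t] I by blast
    then show ?thesis using tri_ty[OF t] by (auto elim!: H_E simp: H_Mor)
  qed
  then show "I \<in> injectives T" using I unfolding injectives_def by blast
qed

lemma Cone_iff: "X \<in> Cone T U V \<longleftrightarrow> X \<in> Ob T \<and> (\<exists>A \<in> U. \<exists>B \<in> V. confl A B X)"
  by (simp add: Cone_def confl_iff)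

lemma inflation_iff: "x \<in> H A B \<Longrightarrow> (\<exists>C y d. tri A x B y C d) \<longleftrightarrow> (\<exists>x'. x = Mor A x' B \<and> inflation T A B x')"
  by (force simp: inflation_def tri_def)

lemma deflation_iff: "y \<in> H B C \<Longrightarrow> (\<exists>A x d. tri A x B y C d) \<longleftrightarrow> (\<exists>y'. y = Mor B y' C \<and> deflation T B C y')"
  by (force simp: deflation_def tri_def)

lemma WIC_infl: assumes "WIC T" "f \<in> H A B" "g \<in> H B C" "tri A (g \<cdot> f) C y D d"
  obtains E y' d' where "tri A f B y' E d'"
proof -
  obtain f' g' where f: "f = Mor A f' B" "f' \<in> mor T A B" "g = Mor B g' C" "g' \<in> mor T B C"
    "A \<in> Ob T" "B \<in> Ob T" "C \<in> Ob T"
    using assms(2,3) by (auto elim!: H_E)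
  have "inflation T A C (Comp T A B C g' f')"
    using inflation_iff[of "g \<cdot> f" A C] assms cmp_HH by (fastforce simp: f H_Mor)
  then have "inflation T A B f'" using assms(1) f unfolding WIC_def by blast
  then have "\<exists>E y' d'. tri A f B y' E d'" using inflation_iff[OF assms(2)] f by blast
  then show ?thesis using that by blast
qed

lemma WIC_defl: assumes "WIC T" "f \<in> H A B" "g \<in> H B C" "tri D x A (g \<cdot> f) C d"
  obtains E x' d' where "tri E x' B g C d'"
proof -
  obtain f' g' where f: "f = Mor A f' B" "f' \<in> mor T A B" "g = Mor B g' C" "g' \<in> mor T B C"
    "A \<in> Ob T" "B \<in> Ob T" "C \<in> Ob T"
    using assms(2,3) by (auto elim!: H_E)
  have "deflation T A C (Comp T A B C g' f')"
    using deflation_iff[of "g \<cdot> f" A C] assms cmp_HH by (fastforce simp: f H_Mor)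
  then have "deflation T B C g'" using assms(1) f unfolding WIC_def by blast
  then have "\<exists>E y' d'. tri E y' B g C d'" using deflation_iff[OF assms(3)] f by blast
  then show ?thesis using that by blast
qed

text \<open>(WIC) makes the retraction \<open>g\<close> a deflation because the identity
  \<open>g \<cdot> f\<close> is one, and \<open>f\<close> splits the resulting triangle. Thus
  closure under summands of biproducts gives closure under \<open>retract\<close>.\<close>

lemma retract_complement: assumes "WIC T" "retract A B"
  obtains C i j p q where "bip A C B i j p q"
proof -
  obtain f g where f: "f \<in> H A B" "g \<in> H B A" "g \<cdot> f = idm A" using assms(2) by (auto simp: retract_def)
  then have "tri zero_ob (ZH zero_ob A) A (g \<cdot> f) A (ZE A zero_ob)" using tri_zero_ob_l H_ob by auto
  then obtain C x d where t: "tri C x B g A d" by (rule WIC_defl[OF assms(1) f(1,2)])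
  obtain s r where "bip C A B x s r g" by (rule tri_split_section[OF t f(1,3)])
  then show ?thesis using that bip_swap by blast
qed

text \<open>Since \<open>s\<close> extends along \<open>x\<close>, the pushout triangle
  \<open>S -> N -> C\<close> splits. This presents the cone \<open>C\<close>, up to retracts, as an
  extension of \<open>S'\<close> by \<open>B\<close>, to which vanishing and closure results
  apply.\<close>

lemma pushout_retract:
  assumes "tri A x B y C d" "tri A s S t S' d'" "r \<in> H B S" "r \<cdot> x = s"
  obtains N n m where "tri B n N m S' (x \<cdot> d')" "retract C N"
proof -
  note ty = tri_ty[OF assms(1)] tri_ty[OF assms(2)]
  obtain N n1 m1 n2 m2 where p: "tri B n1 N m1 S' (x \<cdot> d')" "tri S n2 N m2 C (s \<cdot> d)"
    by (rule pushout[OF assms(1,2)])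
  have "s \<cdot> d = r \<cdot> (x \<cdot> d)" by (simp add: assms(4) flip: cmp_assoc)
  also have "\<dots> = ZE C S" using tri_xd[OF assms(1)] assms(3) ty by simp
  finally obtain a b where "bip S C N n2 a b m2" using tri_split p(2) by metis
  then show ?thesis using that p(1) bip_retract by blast
qed

end

section \<open>The two-term subcategory\<close>

locale two_term_setting = extriangulated_category K T
  for K (structure) and T :: "('o, 'm, 'k, 'e) extri" +
  fixes W :: "'o set"
  assumes ks: "krull_schmidt T"
    and inj_enough: "enough_injectives T"
    and wic: "WIC T"
    and W_add: "additive_subcat T W"
    and W_rigid: "two_rigid T W"
    and inj_W: "injectives T \<subseteq> W"
begin

abbreviation "\<I> \<equiv> injectives T"
abbreviation "\<G> \<equiv> two_term T W"
abbreviation "\<S> \<equiv> Sigma_sub T W"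

lemma G_iff: "X \<in> \<G> \<longleftrightarrow> X \<in> Ob T \<and> (\<exists>A \<in> W. \<exists>B \<in> W. confl A B X)"
  by (simp add: two_term_def Cone_iff)

lemma S_iff: "X \<in> \<S> \<longleftrightarrow> X \<in> Ob T \<and> (\<exists>A \<in> W. \<exists>B \<in> \<I>. confl A B X)"
  by (simp add: Sigma_sub_def Cone_iff)

lemma W_Ob: "V \<in> W \<Longrightarrow> V \<in> Ob T"
  using W_add by (auto simp: additive_subcat_def strict_subcat_def)

lemma G_Ob: "V \<in> \<G> \<Longrightarrow> V \<in> Ob T" by (simp add: G_iff)

lemma S_Ob: "V \<in> \<S> \<Longrightarrow> V \<in> Ob T" by (simp add: S_iff)

lemma I_Ob: "V \<in> \<I> \<Longrightarrow> V \<in> Ob T" by (simp add: injectives_iff)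

lemma I_E0: "J \<in> \<I> \<Longrightarrow> X \<in> Ob T \<Longrightarrow> E0 X J" by (simp add: injectives_iff)

lemma G_tri: assumes "X \<in> \<G>"
  obtains W1 f W0 g d where "W1 \<in> W" "W0 \<in> W" "tri W1 f W0 g X d"
  using assms unfolding G_iff confl_def by blast

lemma S_tri: assumes "X \<in> \<S>"
  obtains V f J g d where "V \<in> W" "J \<in> \<I>" "tri V f J g X d"
  using assms unfolding S_iff confl_def by blast

lemma W_sum: assumes "bip A B P i j p q" "A \<in> W" "B \<in> W" shows "P \<in> W"
proof -
  obtain i' j' p' q' where "i = Mor A i' P" "j = Mor B j' P" "p = Mor P p' A" "q = Mor P q' B"
    using bip_ty[OF assms(1)] by (auto elim!: H_E)
  then show ?thesis using W_add assms unfolding additive_subcat_def sum_closed_def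
    by (metis bip_Mor)
qed

lemma W_retract: assumes "retract A B" "B \<in> W" shows "A \<in> W"
proof -
  obtain C i j p q where b: "bip A C B i j p q" by (rule retract_complement[OF wic assms(1)])
  obtain i' j' p' q' where "i = Mor A i' B" "j = Mor C j' B" "p = Mor B p' A" "q = Mor B q' C"
    using bip_ty[OF b] by (auto elim!: H_E)
  then show ?thesis using b W_add assms(2) unfolding additive_subcat_def summand_closed_def
    by (metis bip_Mor)
qed

lemma zero_ob_W: "zero_ob \<in> W"
  using W_add zero_ob by (auto simp: additive_subcat_def sum_closed_def)

lemma I_sum: assumes "bip A B P i j p q" "A \<in> \<I>" "B \<in> \<I>" shows "P \<in> \<I>"
  using assms E0_ext_r[OF tri_zero[OF assms(1)]] bip_ty(7)[OF assms(1)] by (auto simp: injectives_iff)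

lemma I_retract: "retract A B \<Longrightarrow> B \<in> \<I> \<Longrightarrow> A \<in> \<I>"
  using E0_retract_r retract_ob by (auto simp: injectives_iff)

lemma I_S: "J \<in> \<I> \<Longrightarrow> J \<in> \<S>"
  using tri_zero_ob_l[of J] zero_ob_W I_Ob unfolding S_iff confl_def by blast

lemma W_G: "V \<in> W \<Longrightarrow> V \<in> \<G>"
  using tri_zero_ob_l[of V] zero_ob_W W_Ob unfolding G_iff confl_def by blast

lemma S_G: "V \<in> \<S> \<Longrightarrow> V \<in> \<G>"
  using inj_W unfolding S_iff G_iff by blast

section \<open>Vanishing of E on W, \<Sigma>W and \<G>\<close>

lemma E0_W_W: assumes "V \<in> W" "V' \<in> W" shows "E0 V V'"
proof -
  have "carrier (higher_Ext T 1 V V') = {\<zero>\<^bsub>higher_Ext T 1 V V'\<^esub>}"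
    using W_rigid assms by (auto simp: two_rigid_def)
  then show ?thesis using E0_iff[of V V'] assms W_Ob by (simp add: higher_Ext_def)
qed

lemma inj_env: assumes "A \<in> Ob T"
  obtains i J p B d where "J \<in> \<I>" "tri A i J p B d"
  using inj_enough assms unfolding enough_injectives_def confl_iff confl_def by blast

lemma W_env: assumes "V \<in> W"
  obtains i J p B d where "J \<in> \<I>" "B \<in> \<S>" "tri V i J p B d"
proof -
  obtain i J p B d where t: "J \<in> \<I>" "tri V i J p B d" by (rule inj_env[OF W_Ob[OF assms]])
  then have "B \<in> \<S>" using assms tri_ty[OF t(2)] unfolding S_iff confl_def by blast
  then show ?thesis using that t by blast
qed

text \<open>In degree 2, \<open>higher_Ext\<close> is E with values in one chosen cosyzygy of
  \<open>V'\<close>, while \<open>S\<close> comes from another triangle \<open>V' -> J -> S\<close>.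
  Comparing the two by \<open>pushout_retract\<close> makes \<open>S\<close> a retract of an
  extension of the chosen cosyzygy by the injective \<open>J\<close>.\<close>

lemma E0_W_S: assumes "V \<in> W" "S \<in> \<S>" shows "E0 V S"
proof -
  obtain V' f J g d where t: "V' \<in> W" "J \<in> \<I>" "tri V' f J g S d" by (rule S_tri[OF assms(2)])
  let ?C = "cosyzygy T V'"
  have "\<exists>A'. \<exists>I \<in> \<I>. conflation T V' I A'"
    using inj_enough W_Ob[OF t(1)] unfolding enough_injectives_def by blast
  then have "\<exists>I \<in> \<I>. conflation T V' I ?C" unfolding cosyzygy_def by (rule someI_ex)
  then obtain J' f' g' d' where t': "J' \<in> \<I>" "tri V' f' J' g' ?C d'" unfolding confl_iff confl_def by blast
  have "carrier (higher_Ext T 2 V V') = {\<zero>\<^bsub>higher_Ext T 2 V V'\<^esub>}"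
    using W_rigid assms t(1) by (auto simp: two_rigid_def)
  then have C: "E0 V ?C" using E0_iff[of V ?C] W_Ob[OF assms(1)] tri_ty[OF t'(2)] by (simp add: higher_Ext_def)
  obtain r where r: "r \<in> H J J'" "r \<cdot> f = f'"
    using E0_extend[OF t(3), of J' f'] tri_ty[OF t(3)] tri_ty[OF t'(2)] I_E0[OF t'(1)] by blast
  obtain N n m where N: "tri J n N m ?C (f \<cdot> d')" "retract S N" by (rule pushout_retract[OF t(3) t'(2) r])
  have "E0 V N" using E0_ext_r[OF N(1) I_E0[OF t(2) W_Ob[OF assms(1)]] C] .
  then show ?thesis using E0_retract_r N(2) by blast
qed

text \<open>Extensions preserve the vanishing of E(V, -) by half-exactness, which is why the cone
  \<open>X\<close> is traded for a retract of an extension.\<close>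

lemma G_resolve: assumes "tri W1 f W0 g X d" "W1 \<in> W" "W0 \<in> W"
  obtains N n m S e where "S \<in> \<S>" "tri W0 n N m S e" "retract X N"
proof -
  obtain i J p S e where t: "J \<in> \<I>" "S \<in> \<S>" "tri W1 i J p S e" by (rule W_env[OF assms(2)])
  obtain r where r: "r \<in> H W0 J" "r \<cdot> f = i"
    using E0_extend[OF assms(1), of J i] tri_ty[OF assms(1)] tri_ty[OF t(3)] I_E0[OF t(1)] by blast
  show ?thesis by (rule pushout_retract[OF assms(1) t(3) r]) (use that t(2) in blast)
qed

lemma E0_W_G: assumes "V \<in> W" "X \<in> \<G>" shows "E0 V X"
proof -
  obtain W1 f W0 g d where t: "W1 \<in> W" "W0 \<in> W" "tri W1 f W0 g X d" by (rule G_tri[OF assms(2)])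
  obtain N n m S e where N: "S \<in> \<S>" "tri W0 n N m S e" "retract X N" by (rule G_resolve[OF t(3,1,2)])
  have "E0 V N" using E0_ext_r[OF N(2) E0_W_W[OF assms(1) t(2)] E0_W_S[OF assms(1) N(1)]] .
  then show ?thesis using E0_retract_r N(3) by blast
qed

text \<open>The presentation of \<open>U\<close> has length one: an extension in E(U, C) dies on
  \<open>W0\<close>, so it comes from a morphism \<open>W1 -> C\<close>, and this lifts to
  \<open>B\<close> because E(W1, A) = 0.\<close>

lemma E0_quotient: assumes "tri A x B y C d" "A \<in> \<G>" "E0 U B" "U \<in> \<G>" "\<And>V. V \<in> W \<Longrightarrow> E0 V C"
  shows "E0 U C"
  unfolding E0_def
proof
  fix e assume e: "e \<in> E U C"
  note ty = tri_ty[OF assms(1)]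
  obtain W1 f W0 g d' where t: "W1 \<in> W" "W0 \<in> W" "tri W1 f W0 g U d'" by (rule G_tri[OF assms(4)])
  note ty' = tri_ty[OF t(3)]
  have "e \<cdot> g = ZE W0 C" using assms(5)[OF t(2)] cmp_EH[OF e ty'(2)] by (auto simp: E0_def)
  then obtain a where a: "a \<in> H W1 C" "e = a \<cdot> d'" by (rule tri_E_left[OF t(3) e])
  obtain b where b: "b \<in> H W1 B" "y \<cdot> b = a" by (rule E0_lift[OF assms(1) E0_W_G[OF t(1) assms(2)] a(1)])
  have "b \<cdot> d' = ZE U B" using assms(3) cmp_HE[OF b(1) ty'(3)] by (auto simp: E0_def)
  then show "e = ZE U C" using ty ty' by (simp add: a(2) cmp_assoc flip: b(2))
qed

lemma E0_G_S: assumes "X \<in> \<G>" "S \<in> \<S>" shows "E0 X S"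
proof -
  obtain V f J g d where t: "V \<in> W" "J \<in> \<I>" "tri V f J g S d" by (rule S_tri[OF assms(2)])
  show ?thesis
    by (rule E0_quotient[OF t(3) W_G[OF t(1)] I_E0[OF t(2) G_Ob[OF assms(1)]] assms(1)]) (rule E0_W_S[OF _ assms(2)])
qed

lemma E0_G_quotient: assumes "tri A x B y C d" "A \<in> \<G>" "C \<in> \<G>" "E0 U B" "U \<in> \<G>" shows "E0 U C"
  using E0_quotient[OF assms(1,2,4,5)] E0_W_G assms(3) by blast

text \<open>A horseshoe argument, parametrized by \<open>U\<close> to cover both
  \<open>U = W\<close>, which gives \<G>, and \<open>U\<close> the injectives, which gives
  \<Sigma>W.\<close>

lemma cone_ext:
  assumes U: "U \<subseteq> W" "\<And>A B P i j p q. bip A B P i j p q \<Longrightarrow> A \<in> U \<Longrightarrow> B \<in> U \<Longrightarrow> P \<in> U"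
    "\<And>A B. retract A B \<Longrightarrow> B \<in> U \<Longrightarrow> A \<in> U"
    and t: "tri A x B y C d" and A: "A \<in> Cone T W U" and C: "C \<in> Cone T W U" and E: "\<And>V. V \<in> U \<Longrightarrow> E0 V A"
  shows "B \<in> Cone T W U"
proof -
  note ty = tri_ty[OF t]
  obtain W1 w1 U1 u1 dA where a: "W1 \<in> W" "U1 \<in> U" "tri W1 w1 U1 u1 A dA"
    using A unfolding Cone_iff confl_def by blast
  obtain W2 w2 U2 u2 dC where c: "W2 \<in> W" "U2 \<in> U" "tri W2 w2 U2 u2 C dC"
    using C unfolding Cone_iff confl_def by blast
  obtain N n1 m1 n2 m2 where N: "tri A n1 N m1 U2 (d \<cdot> u2)" "tri W2 n2 N m2 B (dC \<cdot> y)"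
    by (rule pullback[OF t c(3)])
  \<comment> \<open>Since E(U2, A) = 0, the pullback \<open>N\<close> is
    \<open>A \<oplus> U2\<close>. Covering it by \<open>U1 \<oplus> U2\<close> means pulling
    \<open>dA\<close> back along the projection \<open>r\<close>.\<close>
  obtain s r where b: "bip A U2 N n1 s r m1" by (rule E0_split[OF N(1) E[OF c(2)]])
  note bt = bip_ty[OF b]
  obtain P p q where P: "tri W1 p P q N (dA \<cdot> r)" using tri_ex cmp_EH[OF tri_ty(3)[OF a(3)] bt(3)] by blast
  obtain M h u v e where M: "tri M h P (m1 \<cdot> q) U2 e" "tri W1 u M v A (dA \<cdot> r \<cdot> n1)"
    by (rule tri_ET4_op[OF P N(1)])
  have "dA \<cdot> r \<cdot> n1 = dA" using bip_eq[OF b] tri_ty[OF a(3)] by (simp add: cmp_assoc)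
  then obtain k k' where "inverse_pair M U1 k k'" using tri_unique[OF _ a(3)] M(2) by metis
  then have M': "M \<in> U" using U(3) iso_retract(1) a(2) by blast
  obtain s' r' where "bip M U2 P h s' r' (m1 \<cdot> q)"
    using E0_split[OF M(1)] E0_W_W[of U2 M] U(1) c(2) M' by blast
  then have P': "P \<in> U" using U(2) M' c(2) by blast
  \<comment> \<open>The kernel of \<open>P -> N -> B\<close> is an extension of \<open>W2\<close> by
    \<open>W1\<close>, hence split and in \<open>W\<close>.\<close>
  obtain L h' u' v' e' where L: "tri L h' P (m2 \<cdot> q) B e'" "tri W1 u' L v' W2 (dA \<cdot> r \<cdot> n2)"
    by (rule tri_ET4_op[OF P N(2)])
  obtain s'' r'' where "bip W1 W2 L u' s'' r'' v'" by (rule E0_split[OF L(2) E0_W_W[OF c(1) a(1)]])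
  then have "L \<in> W" using W_sum a(1) c(1) by blast
  then show ?thesis using P' L(1) ty unfolding Cone_iff confl_def by blast
qed

lemma G_ext: assumes "tri A x B y C d" "A \<in> \<G>" "C \<in> \<G>" shows "B \<in> \<G>"
  using assms(2,3) E0_W_G[OF _ assms(2)] unfolding two_term_def
  by (intro cone_ext[OF subset_refl _ _ assms(1)]) (auto intro: W_sum W_retract)

lemma S_ext: assumes "tri A x B y C d" "A \<in> \<S>" "C \<in> \<S>" shows "B \<in> \<S>"
  using assms(2,3) E0_W_S[OF _ assms(2)] inj_W unfolding Sigma_sub_def
  by (intro cone_ext[OF inj_W _ _ assms(1)]) (auto intro: I_sum I_retract)

lemma G_sum: "bip A B P i j p q \<Longrightarrow> A \<in> \<G> \<Longrightarrow> B \<in> \<G> \<Longrightarrow> P \<in> \<G>"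
  using G_ext tri_zero by blast

lemma S_sum: "bip A B P i j p q \<Longrightarrow> A \<in> \<S> \<Longrightarrow> B \<in> \<S> \<Longrightarrow> P \<in> \<S>"
  using S_ext tri_zero by blast

text \<open>
  Let \<open>M\<close> be the kernel of the deflation \<open>W0 \<rightarrow> P \<rightarrow> A\<close>.  Lifting \<open>A \<rightarrow> P \<rightarrow> A\<close> to the presentations gives an
  endomorphism of \<open>M\<close> through \<open>W1\<close> that differs from the identity by a map through \<open>W0\<close>, so \<open>M\<close> is a
  retract of \<open>W1 \<oplus> W0\<close>.
\<close>

lemma G_retract: assumes "retract A P" "P \<in> \<G>" shows "A \<in> \<G>"
proof -
  obtain C i j r q where b: "bip A C P i j r q" by (rule retract_complement[OF wic assms(1)])
  note bt = bip_ty[OF b] and be = bip_eq[OF b]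
  obtain W1 w W0 p d where t: "W1 \<in> W" "W0 \<in> W" "tri W1 w W0 p P d" by (rule G_tri[OF assms(2)])
  note ty = tri_ty[OF t(3)]
  obtain M k u v e where M: "tri M k W0 (r \<cdot> p) A e"
    by (rule tri_ET4_op[OF t(3) tri_zero[OF bip_swap[OF b]]])
  note tm = tri_ty[OF M]
  obtain w0 where w0: "w0 \<in> H W0 W0" "p \<cdot> w0 = i \<cdot> (r \<cdot> p)"
    using E0_lift[OF t(3) E0_W_W[OF t(2,1)]] cmp_HH[OF bt(1) tm(2)] by blast
  obtain k1 where k1: "k1 \<in> H M W1" "k1 \<cdot> e = d \<cdot> i" by (rule tri_ET3_op[OF M t(3) w0(1) bt(1) w0(2)])
  have "r \<cdot> p \<cdot> idm W0 = r \<cdot> p" using tm by simp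
  then obtain k2 where k2: "k2 \<in> H W1 M" "k2 \<cdot> d = e \<cdot> r"
    using tri_ET3_op[OF t(3) M idm_H bt(3)] ty by blast
  have "(k2 \<cdot> k1) \<cdot> e = e \<cdot> (r \<cdot> i)" by (simp add: cmp_assoc k1(2) cmp_reassoc[OF k2(2)])
  then have "(k2 \<cdot> k1 \<^bold>- idm M) \<cdot> e = ZE A M" using be tm by (simp add: plus_cmp neg_cmp)
  moreover have "k2 \<cdot> k1 \<^bold>- idm M \<in> H M M" using k1 k2 tm by (blast intro: arrI)
  ultimately obtain s where s: "s \<in> H W0 M" "s \<cdot> k = k2 \<cdot> k1 \<^bold>- idm M"
    using tri_extend[OF M] by blast
  have "k2 \<cdot> k1 = idm M \<^bold>+ s \<cdot> k"
    using minus_eqD[OF cmp_HH[OF k2(1) k1(1)] idm_H[OF tm(4)] s(2)[symmetric]] .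
  then have "k2 \<cdot> k1 \<^bold>+ neg s \<cdot> k = idm M"
    using cmp_HH[OF s(1) tm(1)] idm_H[OF tm(4)] by (simp add: neg_cmp plus_assoc)
  moreover obtain Q i1 i2 p1 p2 where Q: "bip W1 W0 Q i1 i2 p1 p2" by (rule bip_ex[OF W_Ob[OF t(1)] W_Ob[OF t(2)]])
  ultimately have "retract M Q" using retract_bip_sum[OF Q k1(1) k2(1) tm(1) neg_H[OF s(1)]] by blast
  then have "M \<in> W" using W_retract W_sum[OF Q t(1,2)] by blast
  then show ?thesis using M t(2) tm unfolding G_iff confl_def by blast
qed

text \<open>\<open>nul A B f\<close>: the class of \<open>f\<close> in the ideal quotient vanishes.\<close>

definition nul where
  "nul A B f \<longleftrightarrow> (\<exists>S \<in> \<S>. \<exists>g \<in> H A S. \<exists>h \<in> H S B. f = h \<cdot> g)"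

lemma nulI: "g \<in> H A S \<Longrightarrow> h \<in> H S B \<Longrightarrow> S \<in> \<S> \<Longrightarrow> nul A B (h \<cdot> g)"
  by (auto simp: nul_def)

lemma nul_H: "nul A B f \<Longrightarrow> f \<in> H A B" by (auto simp: nul_def intro: cmp_HH)

lemma nul_l: "nul A B f \<Longrightarrow> k \<in> H B C \<Longrightarrow> nul A C (k \<cdot> f)"
  unfolding nul_def by (metis cmp_assoc cmp_HH)

lemma nul_r: "nul A B f \<Longrightarrow> k \<in> H C A \<Longrightarrow> nul C B (f \<cdot> k)"
  unfolding nul_def by (metis cmp_assoc cmp_HH)

lemma nul_neg: "nul A B f \<Longrightarrow> nul A B (neg f)"
  unfolding nul_def by (metis neg_cmp neg_H)

lemma nul_add: assumes "nul A B f" "nul A B g" shows "nul A B (f \<^bold>+ g)"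
proof -
  obtain S f1 f2 where f: "S \<in> \<S>" "f1 \<in> H A S" "f2 \<in> H S B" "f = f2 \<cdot> f1" using assms(1) by (auto simp: nul_def)
  obtain S' g1 g2 where g: "S' \<in> \<S>" "g1 \<in> H A S'" "g2 \<in> H S' B" "g = g2 \<cdot> g1" using assms(2) by (auto simp: nul_def)
  obtain P i j p q where b: "bip S S' P i j p q" by (rule bip_ex[OF S_Ob[OF f(1)] S_Ob[OF g(1)]])
  note bt = bip_ty[OF b] and e = bip_eq[OF b]
  have "f \<in> H A B" "g \<in> H A B" using assms nul_H by auto
  then have "f \<^bold>+ g = (f2 \<cdot> p \<^bold>+ g2 \<cdot> q) \<cdot> (i \<cdot> f1 \<^bold>+ j \<cdot> g1)"
    using bt f g H_ob[OF f(2)] H_ob[OF f(3)]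
    by (simp add: cmp_plus plus_cmp cmp_assoc bip_cmp[OF b])
  moreover have "f2 \<cdot> p \<^bold>+ g2 \<cdot> q \<in> H P B" "i \<cdot> f1 \<^bold>+ j \<cdot> g1 \<in> H A P" using bt f g by (blast intro: arrI)+
  ultimately show ?thesis using S_sum[OF b f(1) g(1)] unfolding nul_def by blast
qed

lemma nul_zero: "A \<in> Ob T \<Longrightarrow> B \<in> Ob T \<Longrightarrow> nul A B (ZH A B)"
  using nulI[of "ZH A zero_ob" A zero_ob "ZH zero_ob B" B] ZH_H I_S[of zero_ob] E0_zero_ob by (auto simp: injectives_iff)

lemma nul_S: "S \<in> \<S> \<Longrightarrow> f \<in> H A S \<Longrightarrow> nul A S f" "S \<in> \<S> \<Longrightarrow> f \<in> H S A \<Longrightarrow> nul S A f"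
  using nulI[of f A S "idm S" S] nulI[of "idm S" S S f A] idm_H S_Ob by auto

lemma W_S_inj: assumes "V \<in> W" "S \<in> \<S>" "a \<in> H V S"
  obtains J b c where "J \<in> \<I>" "b \<in> H V J" "c \<in> H J S" "a = c \<cdot> b"
proof -
  obtain V' f J g d where t: "V' \<in> W" "J \<in> \<I>" "tri V' f J g S d" by (rule S_tri[OF assms(2)])
  obtain b where "b \<in> H V J" "g \<cdot> b = a" by (rule E0_lift[OF t(3) E0_W_W[OF assms(1) t(1)] assms(3)])
  then show ?thesis using that t(2) tri_ty[OF t(3)] by blast
qed

text \<open>An injective \<open>J\<close> also lies in \<open>W\<close>, so the first factor extends
  along inflations out of \<open>V\<close> and the second lifts along deflations onto
  \<open>B\<close> with kernel in \<G>.\<close>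

lemma nul_W: assumes "V \<in> W" "nul V B f"
  obtains J b c where "J \<in> \<I>" "b \<in> H V J" "c \<in> H J B" "f = c \<cdot> b"
proof -
  obtain S g h where S: "S \<in> \<S>" "g \<in> H V S" "h \<in> H S B" "f = h \<cdot> g" using assms(2) by (auto simp: nul_def)
  obtain J b c where "J \<in> \<I>" "b \<in> H V J" "c \<in> H J S" "g = c \<cdot> b" by (rule W_S_inj[OF assms(1) S(1,2)])
  then show ?thesis using that[of J b "h \<cdot> c"] S(3,4) cmp_HH by (metis cmp_assoc)
qed

text \<open>The map \<open>h \<cdot> x\<close> factors through an injective \<open>J\<close>, and
  its component \<open>V -> J\<close> extends to \<open>A\<close>; subtracting the resulting map
  from \<open>h\<close> leaves one that kills \<open>x\<close> exactly and so factors through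
  \<open>y\<close>.\<close>

lemma qcoker_ex: assumes "tri V x A y C d" "V \<in> W" "h \<in> H A M" "nul V M (h \<cdot> x)"
  obtains u where "u \<in> H C M" "nul A M (h \<^bold>- u \<cdot> y)"
proof -
  note ty = tri_ty[OF assms(1)]
  obtain J b c where b: "J \<in> \<I>" "b \<in> H V J" "c \<in> H J M" "h \<cdot> x = c \<cdot> b" by (rule nul_W[OF assms(2,4)])
  obtain b' where b': "b' \<in> H A J" "b' \<cdot> x = b" by (rule E0_extend[OF assms(1) I_E0[OF b(1) ty(6)] b(2)])
  have cb: "c \<cdot> b' \<in> H A M" by (rule cmp_HH[OF b(3) b'(1)])
  have "(h \<^bold>- c \<cdot> b') \<cdot> x = ZH V M" using cmp_HH[OF b(3,2)] by (simp add: plus_cmp neg_cmp b(4) cmp_assoc b'(2))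
  moreover have "h \<^bold>- c \<cdot> b' \<in> H A M" using assms(3) cb by (blast intro: arrI)
  ultimately obtain u where u: "u \<in> H C M" "h \<^bold>- c \<cdot> b' = u \<cdot> y" using tri_factor_out[OF assms(1)] by blast
  have "h = c \<cdot> b' \<^bold>+ u \<cdot> y" by (rule minus_eqD[OF assms(3) cb u(2)])
  then have "h \<^bold>- u \<cdot> y = c \<cdot> b'" using cmp_HH[OF u(1) ty(2)] cb by (simp add: plus_assoc)
  then show ?thesis using that u(1) nulI[OF b'(1) b(3) I_S[OF b(1)]] by simp
qed

text \<open>
  Since \<open>y\<close> is not epic, \<open>u y\<close> is first corrected to factor through \<open>V \<rightarrow> J0 \<rightarrow> S0\<close>; the pushout \<open>N = J0 \<oplus> C\<close> of the
  two triangles then gives a factorization through \<open>S0\<close>.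
\<close>

lemma qcoker_unique: assumes "tri V x A y C d" "V \<in> W" "u \<in> H C M" "nul A M (u \<cdot> y)"
  shows "nul C M u"
proof -
  note ty = tri_ty[OF assms(1)] H_ob[OF assms(3)]
  obtain S a b where S: "S \<in> \<S>" "a \<in> H A S" "b \<in> H S M" "u \<cdot> y = b \<cdot> a" using assms(4) by (auto simp: nul_def)
  obtain J0 i p S0 e where J0: "J0 \<in> \<I>" "S0 \<in> \<S>" "tri V i J0 p S0 e" by (rule W_env[OF assms(2)])
  note t0 = tri_ty[OF J0(3)]
  obtain N n1 m1 n2 m2 where N: "tri A n1 N m1 S0 (x \<cdot> e)" "tri J0 n2 N m2 C (i \<cdot> d)" "n1 \<cdot> x = n2 \<cdot> i" "m2 \<cdot> n1 = y"
    by (rule pushout[OF assms(1) J0(3)])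
  note tn = tri_ty[OF N(1)] tri_ty[OF N(2)]
  obtain \<sigma> \<rho> where b2: "bip J0 C N n2 \<sigma> \<rho> m2" by (rule E0_split[OF N(2) I_E0[OF J0(1) ty(6)]])
  note bt = bip_ty[OF b2] and be = bip_eq[OF b2]
  have j: "\<rho> \<cdot> n1 \<in> H A J0" "\<rho> \<cdot> n1 \<cdot> x = i"
    using bt tn cmp_HH t0 by (auto simp: cmp_assoc N(3) cmp_reassoc[OF be(1)])
  obtain J c c' where c: "J \<in> \<I>" "c \<in> H V J" "c' \<in> H J S" "a \<cdot> x = c' \<cdot> c"
    by (rule W_S_inj[OF assms(2) S(1) cmp_HH[OF S(2) ty(1)]])
  obtain c1 where c1: "c1 \<in> H J0 J" "c1 \<cdot> i = c" by (rule E0_extend[OF J0(3) I_E0[OF c(1) t0(6)] c(2)])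
  define k where "k = c' \<cdot> c1"
  have k: "k \<in> H J0 S" "k \<cdot> i = a \<cdot> x" unfolding k_def using c c1 cmp_HH by (auto simp: cmp_assoc)
  have kj: "k \<cdot> (\<rho> \<cdot> n1) \<in> H A S" using k j cmp_HH by blast
  have "(a \<^bold>- k \<cdot> (\<rho> \<cdot> n1)) \<cdot> x = ZH V S"
    using cmp_HH[OF S(2) ty(1)] j(2) k(2) by (simp add: plus_cmp neg_cmp cmp_assoc)
  moreover have "a \<^bold>- k \<cdot> (\<rho> \<cdot> n1) \<in> H A S" using S(2) kj by (blast intro: arrI)
  ultimately obtain f where f: "f \<in> H C S" "a \<^bold>- k \<cdot> (\<rho> \<cdot> n1) = f \<cdot> y" using tri_factor_out[OF assms(1)] by blast
  have a: "a = k \<cdot> (\<rho> \<cdot> n1) \<^bold>+ f \<cdot> y" by (rule minus_eqD[OF S(2) kj f(2)])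
  \<comment> \<open>\<open>z\<close> is \<open>u\<close> without its part through \<open>S\<close>.
    As \<open>z \<cdot> y\<close> equals \<open>w \<cdot> (\<rho> \<cdot> n1)\<close>, the maps
    \<open>z \<cdot> m2\<close> and \<open>w \<cdot> \<rho>\<close> on \<open>N\<close> agree after
    \<open>n1\<close> and differ by a map through \<open>S0\<close>; the section
    \<open>\<sigma>\<close> then recovers \<open>z\<close>.\<close>
  define z where "z = u \<^bold>- b \<cdot> f"
  define w where "w = b \<cdot> k"
  have bf: "b \<cdot> f \<in> H C M" and w: "w \<in> H J0 M" and z: "z \<in> H C M"
    unfolding w_def z_def using S f k assms(3) by (blast intro: arrI)+
  have "z \<cdot> y = w \<cdot> (\<rho> \<cdot> n1)"
    unfolding z_def w_def using cmp_HH[OF bf ty(2)] cmp_HH[OF w j(1)]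
    by (simp add: plus_cmp neg_cmp S(4) a cmp_plus cmp_assoc plus_assoc w_def)
  then have "(z \<cdot> m2 \<^bold>- w \<cdot> \<rho>) \<cdot> n1 = ZH A M" using cmp_HH[OF w j(1)] by (simp add: plus_cmp neg_cmp cmp_assoc N(4))
  moreover have "z \<cdot> m2 \<^bold>- w \<cdot> \<rho> \<in> H N M" using z w bt by (blast intro: arrI)
  ultimately obtain v where v: "v \<in> H S0 M" "z \<cdot> m2 \<^bold>- w \<cdot> \<rho> = v \<cdot> m1" using tri_factor_out[OF N(1)] by blast
  have "(z \<cdot> m2 \<^bold>- w \<cdot> \<rho>) \<cdot> \<sigma> = z"
    using z w ty bt be t0 by (simp add: plus_cmp neg_cmp cmp_assoc)
  then have "z = v \<cdot> (m1 \<cdot> \<sigma>)" by (simp add: v(2) cmp_assoc)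
  then have "nul C M z" using nulI[of "m1 \<cdot> \<sigma>" C S0 v M] v(1) J0(2) cmp_HH bt(2) tn(2) by blast
  moreover have "u = b \<cdot> f \<^bold>+ z" by (rule minus_eqD[OF assms(3) bf]) (simp add: z_def)
  ultimately show ?thesis using nul_add[OF nulI[OF f(1) S(3) S(1)]] by simp
qed

section \<open>The ideal quotient\<close>

definition qeq where
  "qeq A B f g \<longleftrightarrow> f \<in> H A B \<and> g \<in> H A B \<and> nul A B (f \<^bold>- g)"

lemma qeq_H: "qeq A B f g \<Longrightarrow> f \<in> H A B" "qeq A B f g \<Longrightarrow> g \<in> H A B" by (auto simp: qeq_def)

lemma qeq_refl: "f \<in> H A B \<Longrightarrow> qeq A B f f"
  using nul_zero H_ob by (auto simp: qeq_def)

lemma qeq_sym: assumes "qeq A B f g" shows "qeq A B g f"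
proof -
  have "nul A B (neg (f \<^bold>- g))" using nul_neg assms by (auto simp: qeq_def)
  then show ?thesis using qeq_H[OF assms] by (simp add: qeq_def neg_plus plus_commute)
qed

lemma qeq_trans [trans]: assumes "qeq A B f g" "qeq A B g h" shows "qeq A B f h"
proof -
  have "nul A B ((f \<^bold>- g) \<^bold>+ (g \<^bold>- h))" using assms nul_add by (auto simp: qeq_def)
  moreover have "(f \<^bold>- g) \<^bold>+ (g \<^bold>- h) = f \<^bold>+ ((neg g \<^bold>+ g) \<^bold>- h)" by (simp add: plus_assoc)
  moreover have "\<dots> = f \<^bold>- h" using qeq_H[OF assms(1)] neg_H[OF qeq_H(2)[OF assms(2)]] by simp
  ultimately show ?thesis using assms by (simp add: qeq_def)
qed

lemma qeq_l: "qeq A B f g \<Longrightarrow> k \<in> H B C \<Longrightarrow> qeq A C (k \<cdot> f) (k \<cdot> g)"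
  using nul_l[of A B "f \<^bold>- g" k C] by (auto simp: qeq_def cmp_plus cmp_neg intro: cmp_HH)

lemma qeq_r: "qeq A B f g \<Longrightarrow> k \<in> H C A \<Longrightarrow> qeq C B (f \<cdot> k) (g \<cdot> k)"
  using nul_r[of A B "f \<^bold>- g" k C] by (auto simp: qeq_def plus_cmp neg_cmp intro: cmp_HH)

lemma qeq_add: "qeq A B f g \<Longrightarrow> qeq A B f' g' \<Longrightarrow> qeq A B (f \<^bold>+ f') (g \<^bold>+ g')"
  using nul_add[of A B "f \<^bold>- g" "f' \<^bold>- g'"] by (auto simp: qeq_def neg_plus plus_ac intro: plus_H)

lemma qeq_nul: "qeq A B f g \<Longrightarrow> nul A B f \<longleftrightarrow> nul A B g"
proof -
  have "nul A B g" if "qeq A B f g" "nul A B f" for f g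
  proof -
    have "nul A B (f \<^bold>+ neg (f \<^bold>- g))" using that nul_add nul_neg by (auto simp: qeq_def)
    moreover have "f \<^bold>+ neg (f \<^bold>- g) = (f \<^bold>+ neg f) \<^bold>+ neg (neg g)" by (simp add: neg_plus plus_assoc)
    moreover have "\<dots> = g" using qeq_H[OF that(1)] by simp
    ultimately show ?thesis by simp
  qed
  then show "qeq A B f g \<Longrightarrow> nul A B f \<longleftrightarrow> nul A B g" using qeq_sym by blast
qed

lemma qeq_zero: "qeq A B f (ZH A B) \<longleftrightarrow> nul A B f"
proof
  show "qeq A B f (ZH A B) \<Longrightarrow> nul A B f" using qeq_nul nul_zero qeq_H H_ob by blast
  assume n: "nul A B f"
  then show "qeq A B f (ZH A B)"
    using nul_H[OF n] H_ob[OF nul_H[OF n]] ZH_H by (simp add: qeq_def)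
qed

lemma qeq_addz: assumes "f \<in> H A B" "nul A B g" shows "qeq A B (f \<^bold>+ g) f"
  using qeq_add[OF qeq_refl[OF assms(1)] iffD2[OF qeq_zero assms(2)]] assms by simp

lemma qeq_cancel_l: assumes "qeq B B (g \<cdot> f) (idm B)" "h \<in> H A B" "g \<in> H C B" "f \<in> H B C"
  shows "qeq A B (g \<cdot> (f \<cdot> h)) h"
  using qeq_r[OF assms(1,2)] assms by (simp add: cmp_assoc)

definition qinv where "qinv A B f g \<longleftrightarrow> f \<in> H A B \<and> g \<in> H B A \<and> qeq A A (g \<cdot> f) (idm A) \<and> qeq B B (f \<cdot> g) (idm B)"

definition qiso where "qiso A B \<longleftrightarrow> A \<in> \<G> \<and> B \<in> \<G> \<and> (\<exists>f g. qinv A B f g)"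

lemma qinv_sym: "qinv A B f g \<Longrightarrow> qinv B A g f" by (auto simp: qinv_def)

lemma qinv_idm: "A \<in> Ob T \<Longrightarrow> qinv A A (idm A) (idm A)" by (simp add: qinv_def idm_H qeq_refl)

lemma qinv_trans: assumes "qinv A B f g" "qinv B C h k" shows "qinv A C (h \<cdot> f) (g \<cdot> k)"
proof -
  have a: "f \<in> H A B" "g \<in> H B A" "qeq A A (g \<cdot> f) (idm A)" "qeq B B (f \<cdot> g) (idm B)"
    "h \<in> H B C" "k \<in> H C B" "qeq B B (k \<cdot> h) (idm B)" "qeq C C (h \<cdot> k) (idm C)"
    using assms by (auto simp: qinv_def)
  have "qeq A A (g \<cdot> ((k \<cdot> h) \<cdot> f)) (g \<cdot> (idm B \<cdot> f))" "qeq C C (h \<cdot> ((f \<cdot> g) \<cdot> k)) (h \<cdot> (idm B \<cdot> k))"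
    using a by (blast intro: qeq_l qeq_r)+
  then show ?thesis using a unfolding qinv_def by (auto simp: cmp_assoc intro: cmp_HH qeq_trans)
qed

lemma qiso_refl: "A \<in> \<G> \<Longrightarrow> qiso A A" using qinv_idm G_Ob by (auto simp: qiso_def)

lemma qiso_sym: "qiso A B \<Longrightarrow> qiso B A" using qinv_sym unfolding qiso_def by blast

lemma qiso_trans: "qiso A B \<Longrightarrow> qiso B C \<Longrightarrow> qiso A C" using qinv_trans unfolding qiso_def by blast

definition qretract where "qretract A B \<longleftrightarrow> (\<exists>f \<in> H A B. \<exists>g \<in> H B A. qeq A A (g \<cdot> f) (idm A))"

lemma qiso_qretract: "qiso A B \<Longrightarrow> qretract A B" by (auto simp: qiso_def qinv_def qretract_def)

lemma retract_qretract: assumes "retract A B" shows "qretract A B"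
proof -
  have "qeq A A (idm A) (idm A)" using qeq_refl idm_H retract_ob[OF assms] by blast
  then show ?thesis using assms unfolding retract_def qretract_def by metis
qed

lemma qretract_split: assumes "qretract A B"
  obtains f g S h k where "f \<in> H A B" "g \<in> H B A" "S \<in> \<S>" "h \<in> H A S" "k \<in> H S A" "g \<cdot> f \<^bold>+ k \<cdot> h = idm A"
proof -
  obtain f g where f: "f \<in> H A B" "g \<in> H B A" "qeq A A (g \<cdot> f) (idm A)" using assms by (auto simp: qretract_def)
  have n: "nul A A (idm A \<^bold>- g \<cdot> f)" using qeq_sym[OF f(3)] by (simp add: qeq_def)
  then obtain S h k where S: "S \<in> \<S>" "h \<in> H A S" "k \<in> H S A" "idm A \<^bold>- g \<cdot> f = k \<cdot> h" unfolding nul_def by blast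
  have "idm A = g \<cdot> f \<^bold>+ k \<cdot> h" by (rule minus_eqD[OF _ _ S(4)]) (use f qeq_H in blast)+
  then show ?thesis using that f S by metis
qed

text \<open>The error term of a retraction modulo the ideal factors through some \<open>S\<close> in
  \<Sigma>W; adding \<open>S\<close> to \<open>B\<close> absorbs it.\<close>

lemma qretract_retract: assumes "qretract A B" obtains S P i j p q where "S \<in> \<S>" "bip B S P i j p q" "retract A P"
proof -
  obtain f g S h k where s: "f \<in> H A B" "g \<in> H B A" "S \<in> \<S>" "h \<in> H A S" "k \<in> H S A" "g \<cdot> f \<^bold>+ k \<cdot> h = idm A"
    by (rule qretract_split[OF assms])
  obtain P i j p q where b: "bip B S P i j p q" using bip_ex H_ob[OF s(1)] S_Ob[OF s(3)] by blast
  show ?thesis using that[OF s(3) b retract_bip_sum[OF b s(1,2,4,5,6)]] .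
qed

lemma E0_qretract: assumes "qretract A B" "E0 U B" "U \<in> \<G>" shows "E0 U A"
proof -
  obtain S P i j p q where s: "S \<in> \<S>" "bip B S P i j p q" "retract A P" by (rule qretract_retract[OF assms(1)])
  have "E0 U P" using E0_ext_r[OF tri_zero[OF s(2)] assms(2) E0_G_S[OF assms(3) s(1)]] .
  then show ?thesis by (rule E0_retract_r[OF s(3)])
qed

section \<open>Epimorphisms and cokernels of the quotient, on representatives\<close>

definition qepi where
  "qepi A B e \<longleftrightarrow> e \<in> H A B \<and> (\<forall>M \<in> \<G>. \<forall>u \<in> H B M. nul A M (u \<cdot> e) \<longrightarrow> nul B M u)"

text \<open>Uniqueness of the factorization is expressed by \<open>qepi\<close> of \<open>c\<close>,
  applied to differences.\<close>

definition qcoker where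
  "qcoker A B f C c \<longleftrightarrow> A \<in> \<G> \<and> B \<in> \<G> \<and> C \<in> \<G> \<and> f \<in> H A B \<and> nul A C (c \<cdot> f) \<and> qepi B C c \<and>
    (\<forall>M \<in> \<G>. \<forall>h \<in> H B M. nul A M (h \<cdot> f) \<longrightarrow> (\<exists>u \<in> H C M. qeq B M h (u \<cdot> c)))"

definition qsurj where
  "qsurj A B f M \<longleftrightarrow> (\<forall>h \<in> H A M. \<exists>k \<in> H B M. qeq A M (k \<cdot> f) h)"

lemma qcoker_tri: assumes "tri V x A y C d" "V \<in> W" "A \<in> \<G>" "C \<in> \<G>" shows "qcoker V A x C y"
proof -
  note ty = tri_ty[OF assms(1)]
  have "\<exists>u \<in> H C M. qeq A M h (u \<cdot> y)" if h: "h \<in> H A M" "nul V M (h \<cdot> x)" for M h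
  proof -
    obtain u where "u \<in> H C M" "nul A M (h \<^bold>- u \<cdot> y)" by (rule qcoker_ex[OF assms(1,2) h])
    then show ?thesis using h(1) ty cmp_HH unfolding qeq_def by blast
  qed
  moreover have "nul V C (y \<cdot> x)" using tri_yx[OF assms(1)] nul_zero ty by simp
  moreover have "qepi A C y" unfolding qepi_def using qcoker_unique[OF assms(1,2)] ty by blast
  ultimately show ?thesis using assms ty W_G unfolding qcoker_def by blast
qed

lemma qcoker_unique_qiso: assumes "qcoker A B f C c" "qcoker A B f C' c'" shows "qiso C C'"
proof -
  have c: "c \<in> H B C" "c' \<in> H B C'" "C \<in> \<G>" "C' \<in> \<G>" "nul A C (c \<cdot> f)" "nul A C' (c' \<cdot> f)"
    using assms by (auto simp: qcoker_def qepi_def)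
  obtain u where u: "u \<in> H C C'" "qeq B C' c' (u \<cdot> c)" using assms(1) c by (auto simp: qcoker_def)
  obtain v where v: "v \<in> H C' C" "qeq B C c (v \<cdot> c')" using assms(2) c by (auto simp: qcoker_def)
  have g: "qeq D D g (idm D)" if "qcoker A B f D k" "g \<in> H D D" "qeq B D (g \<cdot> k) k" for D g k
  proof -
    have o: "idm D \<in> H D D" "k \<in> H B D" using that(2) H_ob idm_H qeq_H[OF that(3)] by blast+
    have "nul B D (g \<cdot> k \<^bold>- idm D \<cdot> k)" using that(3) o by (simp add: qeq_def)
    then have "nul B D ((g \<^bold>- idm D) \<cdot> k)" by (simp add: plus_cmp neg_cmp)
    moreover have "g \<^bold>- idm D \<in> H D D" using that(2) o by (blast intro: arrI)
    ultimately have "nul D D (g \<^bold>- idm D)" using that(1) unfolding qcoker_def qepi_def by blast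
    then show ?thesis using that o by (auto simp: qeq_def)
  qed
  have "qeq B C ((v \<cdot> u) \<cdot> c) (v \<cdot> c')" using qeq_sym[OF qeq_l[OF u(2) v(1)]] by (simp add: cmp_assoc)
  then have 1: "qeq C C (v \<cdot> u) (idm C)" using g[OF assms(1) cmp_HH[OF v(1) u(1)]] qeq_trans qeq_sym[OF v(2)] by blast
  have "qeq B C' ((u \<cdot> v) \<cdot> c') (u \<cdot> c)" using qeq_sym[OF qeq_l[OF v(2) u(1)]] by (simp add: cmp_assoc)
  then have 2: "qeq C' C' (u \<cdot> v) (idm C')" using g[OF assms(2) cmp_HH[OF u(1) v(1)]] qeq_trans qeq_sym[OF u(2)] by blast
  show ?thesis using 1 2 u v c unfolding qiso_def qinv_def by blast
qed

text \<open>This and \<open>qcoker_qiso\<close> transport a presentation along quotient isomorphisms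
  of its terms: those supplied by \<tau>-rigidity lie in the closure of \<open>W\<close> under such
  isomorphisms, not necessarily in \<open>W\<close>.\<close>

lemma qsurj_qiso: assumes "qsurj A B f M" "f \<in> H A B" "qinv A' A a a'" "qinv B B' b b'"
  shows "qsurj A' B' (b \<cdot> f \<cdot> a) M"
  unfolding qsurj_def
proof
  fix h assume h: "h \<in> H A' M"
  have a: "a \<in> H A' A" "a' \<in> H A A'" "qeq A' A' (a' \<cdot> a) (idm A')" using assms by (auto simp: qinv_def)
  have b: "b \<in> H B B'" "b' \<in> H B' B" "qeq B B (b' \<cdot> b) (idm B)" using assms by (auto simp: qinv_def)
  obtain k where k: "k \<in> H B M" "qeq A M (k \<cdot> f) (h \<cdot> a')" using assms(1) cmp_HH[OF h a(2)] unfolding qsurj_def by blast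
  have "qeq A' M (k \<cdot> ((b' \<cdot> b) \<cdot> (f \<cdot> a))) (k \<cdot> (idm B \<cdot> (f \<cdot> a)))"
    using qeq_l[OF qeq_r[OF b(3) cmp_HH[OF assms(2) a(1)]] k(1)] .
  also have "k \<cdot> (idm B \<cdot> (f \<cdot> a)) = (k \<cdot> f) \<cdot> a" using cmp_HH[OF assms(2) a(1)] by (simp add: cmp_assoc)
  also have "qeq A' M \<dots> (h \<cdot> a' \<cdot> a)" by (rule qeq_r[OF k(2) a(1)])
  also have "h \<cdot> a' \<cdot> a = h \<cdot> (a' \<cdot> a)" by (rule cmp_assoc)
  also have "qeq A' M \<dots> (h \<cdot> idm A')" by (rule qeq_l[OF a(3) h])
  also have "h \<cdot> idm A' = h" using h by simp
  finally have "qeq A' M ((k \<cdot> b') \<cdot> (b \<cdot> f \<cdot> a)) h" by (simp add: cmp_assoc)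
  then show "\<exists>k \<in> H B' M. qeq A' M (k \<cdot> (b \<cdot> f \<cdot> a)) h" using cmp_HH[OF k(1) b(2)] by blast
qed

lemma qcoker_qiso: assumes "qcoker A B f C c" "qinv A' A a a'" "qinv B B' b b'" "qinv C C' d d'" "A' \<in> \<G>" "B' \<in> \<G>" "C' \<in> \<G>"
  shows "qcoker A' B' (b \<cdot> f \<cdot> a) C' (d \<cdot> c \<cdot> b')"
proof -
  have a: "a \<in> H A' A" "a' \<in> H A A'" "qeq A A (a \<cdot> a') (idm A)" using assms by (auto simp: qinv_def)
  have b: "b \<in> H B B'" "b' \<in> H B' B" "qeq B B (b' \<cdot> b) (idm B)" "qeq B' B' (b \<cdot> b') (idm B')" using assms by (auto simp: qinv_def)
  have d: "d \<in> H C C'" "d' \<in> H C' C" "qeq C C (d' \<cdot> d) (idm C)" "qeq C' C' (d \<cdot> d') (idm C')" using assms by (auto simp: qinv_def)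
  have c: "f \<in> H A B" "c \<in> H B C" "nul A C (c \<cdot> f)" using assms by (auto simp: qcoker_def qepi_def)
  have f': "b \<cdot> f \<cdot> a \<in> H A' B'" and c': "d \<cdot> c \<cdot> b' \<in> H B' C'" using a b c d by (blast intro: arrI)+
  have "qeq A C (c \<cdot> ((b' \<cdot> b) \<cdot> f)) (c \<cdot> (idm B \<cdot> f))" using qeq_l[OF qeq_r[OF b(3) c(1)] c(2)] .
  then have "nul A C (c \<cdot> ((b' \<cdot> b) \<cdot> f))" using qeq_nul c by simp
  then have "nul A' C' (d \<cdot> (c \<cdot> ((b' \<cdot> b) \<cdot> f)) \<cdot> a)" using nul_l nul_r a d by blast
  then have 1: "nul A' C' (d \<cdot> c \<cdot> b' \<cdot> (b \<cdot> f \<cdot> a))" by (simp add: cmp_assoc)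
  have 2: "qepi B' C' (d \<cdot> c \<cdot> b')"
    unfolding qepi_def
  proof (intro conjI c' ballI impI)
    fix M u assume M: "M \<in> \<G>" "u \<in> H C' M" "nul B' M (u \<cdot> (d \<cdot> c \<cdot> b'))"
    have "nul B M ((u \<cdot> d \<cdot> c) \<cdot> (b' \<cdot> b))" using nul_r[OF M(3) b(1)] by (simp add: cmp_assoc)
    moreover have m: "u \<cdot> d \<cdot> c \<in> H B M" using M d c by (blast intro: arrI)
    ultimately have "nul B M ((u \<cdot> d) \<cdot> c)" using qeq_nul[OF qeq_l[OF b(3) m]] m by simp
    then have "nul C M (u \<cdot> d)" using assms(1) M(1) cmp_HH[OF M(2) d(1)] unfolding qcoker_def qepi_def by blast
    then have "nul C' M (u \<cdot> (d \<cdot> d'))" using nul_r d(2) by (fastforce simp: cmp_assoc)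
    then show "nul C' M u" using qeq_nul[OF qeq_l[OF d(4) M(2)]] M(2) by simp
  qed
  have 3: "\<exists>u \<in> H C' M. qeq B' M h (u \<cdot> (d \<cdot> c \<cdot> b'))" if M: "M \<in> \<G>" "h \<in> H B' M" "nul A' M (h \<cdot> (b \<cdot> f \<cdot> a))" for M h
  proof -
    have m: "h \<cdot> b \<cdot> f \<in> H A M" using M b c by (blast intro: arrI)
    have "nul A M ((h \<cdot> b \<cdot> f) \<cdot> (a \<cdot> a'))" using nul_r[OF M(3) a(2)] by (simp add: cmp_assoc)
    then have "nul A M ((h \<cdot> b) \<cdot> f)" using qeq_nul[OF qeq_l[OF a(3) m]] m by simp
    then obtain u where u: "u \<in> H C M" "qeq B M (h \<cdot> b) (u \<cdot> c)"
      using assms(1) M(1) cmp_HH[OF M(2) b(1)] unfolding qcoker_def by blast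
    have cb: "c \<cdot> b' \<in> H B' C" using cmp_HH b c by blast
    have "qeq B' M (h \<cdot> idm B') (h \<cdot> (b \<cdot> b'))" by (rule qeq_sym[OF qeq_l[OF b(4) M(2)]])
    then have "qeq B' M h (h \<cdot> b \<cdot> b')" using M(2) by (simp add: cmp_assoc)
    also have "qeq B' M (h \<cdot> b \<cdot> b') (u \<cdot> c \<cdot> b')" by (rule qeq_r[OF u(2) b(2)])
    also have "u \<cdot> c \<cdot> b' = u \<cdot> (idm C \<cdot> (c \<cdot> b'))" using cb by (simp add: cmp_assoc)
    also have "qeq B' M \<dots> (u \<cdot> ((d' \<cdot> d) \<cdot> (c \<cdot> b')))" using qeq_sym[OF qeq_l[OF qeq_r[OF d(3) cb] u(1)]] .
    finally have "qeq B' M h ((u \<cdot> d') \<cdot> (d \<cdot> c \<cdot> b'))" by (simp add: cmp_assoc)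
    then show ?thesis using cmp_HH[OF u(1) d(2)] by blast
  qed
  show ?thesis using 1 2 3 f' assms(5-7) unfolding qcoker_def by blast
qed

text \<open>
  The deflation \<open>p : N \<rightarrow> A\<close> splits, and adding \<open>N \<rightarrow> D\<close> with \<open>D \<in> \<S>\<close> to \<open>e p\<close> gives an inflation whose cone \<open>C\<close>
  lies in \<open>\<G>\<close>.  As \<open>e\<close> is epic in the quotient, \<open>B \<rightarrow> C\<close> vanishes there.
\<close>

lemma W_projective: assumes "V \<in> W" "A \<in> \<G>" "B \<in> \<G>" "qepi A B e" "w \<in> H V B"
  obtains t where "t \<in> H V A" "qeq V B (e \<cdot> t) w"
proof -
  have e: "e \<in> H A B" using assms(4) by (simp add: qepi_def)
  obtain W1 w1 W0 w0 dA where a: "W1 \<in> W" "W0 \<in> W" "tri W1 w1 W0 w0 A dA" by (rule G_tri[OF assms(2)])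
  obtain N n m S1 e1 where N: "S1 \<in> \<S>" "tri W0 n N m S1 e1" "retract A N" by (rule G_resolve[OF a(3,1,2)])
  obtain s p where s: "s \<in> H A N" "p \<in> H N A" "p \<cdot> s = idm A" using N(3) by (auto simp: retract_def)
  obtain i0 J0 p0 S0 e0 where J0: "J0 \<in> \<I>" "S0 \<in> \<S>" "tri W0 i0 J0 p0 S0 e0" by (rule W_env[OF a(2)])
  \<comment> \<open>The pushout of \<open>N\<close> and \<open>J0\<close> under \<open>W0\<close>:
    one triangle makes \<open>N -> D\<close> an inflation with cone \<open>S0\<close>, the other
    puts \<open>D\<close> in \<Sigma>W. That the cone \<open>S0\<close> lies in \<G> later puts
    \<open>C\<close> in \<G>.\<close>
  obtain D d1 c1 d2 c2 where D: "tri N d1 D c1 S0 (n \<cdot> e0)" "tri J0 d2 D c2 S1 (i0 \<cdot> e1)"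
    by (rule pushout[OF N(2) J0(3)])
  note td = tri_ty[OF D(1)]
  have NG: "N \<in> \<G>" by (rule G_ext[OF N(2) W_G[OF a(2)] S_G[OF N(1)]])
  have DS: "D \<in> \<S>" by (rule S_ext[OF D(2) I_S[OF J0(1)] N(1)])
  obtain P i j q r where b: "bip B D P i j q r" by (rule bip_ex[OF G_Ob[OF assms(3)] S_Ob[OF DS]])
  note bt = bip_ty[OF b] and be = bip_eq[OF b]
  define x where "x = i \<cdot> (e \<cdot> p) \<^bold>+ j \<cdot> d1"
  have ep: "e \<cdot> p \<in> H N B" and x: "x \<in> H N P" unfolding x_def using e s bt td by (blast intro: arrI)+
  have rx: "r \<cdot> x = d1" "q \<cdot> x = e \<cdot> p"
    unfolding x_def using td bt ep by (simp_all add: cmp_plus bip_cmp[OF b])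
  obtain C y d where t: "tri N x P y C d"
    using WIC_infl[OF wic x bt(4)] D(1) by (metis rx(1))
  note ty = tri_ty[OF t]
  obtain N' n' m' where N': "tri P n' N' m' S0 (x \<cdot> (n \<cdot> e0))" "retract C N'"
    by (rule pushout_retract[OF t D(1) bt(4) rx(1)])
  have "P \<in> \<G>" by (rule G_sum[OF b assms(3) S_G[OF DS]])
  then have CG: "C \<in> \<G>" using G_retract[OF N'(2)] G_ext[OF N'(1)] S_G[OF J0(2)] by blast
  have "y \<cdot> i \<cdot> (e \<cdot> p) \<^bold>+ y \<cdot> j \<cdot> d1 = ZH N C" using tri_yx[OF t] by (simp add: x_def cmp_plus cmp_assoc)
  moreover have yi: "y \<cdot> i \<cdot> (e \<cdot> p) \<in> H N C" "y \<cdot> j \<cdot> d1 \<in> H N C" "y \<cdot> i \<in> H B C" "y \<cdot> j \<in> H D C"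
    using ty bt ep td by (blast intro: arrI)+
  ultimately have "y \<cdot> j \<cdot> d1 = neg (y \<cdot> i \<cdot> (e \<cdot> p))" using neg_unique by blast
  then have "nul N C (neg (neg (y \<cdot> i \<cdot> (e \<cdot> p))))" using nul_neg[OF nulI[OF td(1) yi(4) DS]] by simp
  then have "nul N C (y \<cdot> i \<cdot> (e \<cdot> p))" using yi(1) by simp
  then have "nul A C (y \<cdot> i \<cdot> (e \<cdot> p) \<cdot> s)" using s(1) nul_r by blast
  then have "nul A C (y \<cdot> i \<cdot> e)" using s e by (simp add: cmp_assoc)
  then have "nul B C (y \<cdot> i)" using assms(4) CG yi(3) unfolding qepi_def by blast
  then have "nul V C (y \<cdot> i \<cdot> w)" using nul_r assms(5) by blast
  then obtain J a1 b1 where J: "J \<in> \<I>" "a1 \<in> H V J" "b1 \<in> H J C" "y \<cdot> i \<cdot> w = b1 \<cdot> a1"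
    by (rule nul_W[OF assms(1)])
  \<comment> \<open>As \<open>J\<close> is in \<open>W\<close> and \<open>N\<close> in \<G>,
    \<open>b1\<close> lifts through \<open>y\<close>. Subtracting the lifted map from
    \<open>i \<cdot> w\<close> leaves a map killed by \<open>y\<close>, which therefore comes from
    \<open>u : V -> N\<close>; the wanted lift is \<open>p \<cdot> u\<close>.\<close>
  obtain b2 where b2: "b2 \<in> H J P" "y \<cdot> b2 = b1" using E0_lift[OF t E0_W_G[OF _ NG] J(3)] J(1) inj_W by blast
  have iw: "i \<cdot> w \<in> H V P" "b2 \<cdot> a1 \<in> H V P" using bt assms(5) b2 J by (blast intro: arrI)+
  then have "y \<cdot> (i \<cdot> w \<^bold>- b2 \<cdot> a1) = ZH V C"
    using J b2 cmp_HH[OF J(3,2)] by (simp add: cmp_plus cmp_neg cmp_reassoc[OF b2(2)] flip: cmp_assoc)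
  moreover have "i \<cdot> w \<^bold>- b2 \<cdot> a1 \<in> H V P" using iw by (blast intro: arrI)
  ultimately obtain u where u: "u \<in> H V N" "i \<cdot> w \<^bold>- b2 \<cdot> a1 = x \<cdot> u" using tri_factor_in[OF t] by blast
  have pu: "p \<cdot> u \<in> H V A" using s u cmp_HH by blast
  have "q \<cdot> (i \<cdot> w \<^bold>- b2 \<cdot> a1) = e \<cdot> (p \<cdot> u)" by (simp add: u(2) cmp_reassoc[OF rx(2)] cmp_assoc)
  then have "w \<^bold>- q \<cdot> b2 \<cdot> a1 = e \<cdot> (p \<cdot> u)" using assms(5) by (simp add: cmp_plus cmp_neg cmp_reassoc[OF be(1)] cmp_assoc)
  moreover have "nul V B (q \<cdot> b2 \<cdot> a1)" using nulI[OF J(2) cmp_HH[OF bt(3) b2(1)] I_S[OF J(1)]] .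
  ultimately have "qeq V B (e \<cdot> (p \<cdot> u)) w" using qeq_addz[OF assms(5) nul_neg] by metis
  then show ?thesis using that pu by blast
qed

text \<open>The last conclusion is where the quotient is left behind: an extension modulo the ideal
  is off by a map through an injective, and that map extends along the inflation \<open>x\<close>,
  so the extension can be made exact. When E(B, M) = 0, \<open>E0_of_extend\<close> then yields
  E(C', M) = 0.\<close>

lemma qcoker_inflation:
  assumes "V \<in> W" "A \<in> \<G>" "qcoker V A m C c"
  obtains J B i j p q x y C' d where "J \<in> \<I>" "bip A J B i j p q" "tri V x B y C' d" "C' \<in> \<G>" "qiso C' C"
    "\<forall>M. qsurj V A m M \<longrightarrow> (\<forall>h \<in> H V M. \<exists>k \<in> H B M. k \<cdot> x = h)"
proof -
  have m: "m \<in> H V A" "c \<in> H A C" "C \<in> \<G>" using assms(3) by (auto simp: qcoker_def qepi_def)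
  obtain i0 J t S e where J: "J \<in> \<I>" "S \<in> \<S>" "tri V i0 J t S e" by (rule W_env[OF assms(1)])
  note tj = tri_ty[OF J(3)]
  obtain B i j p q where b: "bip A J B i j p q" by (rule bip_ex[OF G_Ob[OF assms(2)] I_Ob[OF J(1)]])
  note bt = bip_ty[OF b] and be = bip_eq[OF b]
  define x where "x = i \<cdot> m \<^bold>+ j \<cdot> i0"
  have x: "x \<in> H V B" unfolding x_def using m tj bt by (blast intro: arrI)
  have qx: "q \<cdot> x = i0" "p \<cdot> x = m" unfolding x_def using tj bt m
    by (simp_all add: cmp_plus bip_cmp[OF b])
  obtain C' y d where t: "tri V x B y C' d" using WIC_infl[OF wic x bt(4)] J(3) by (metis qx(1))
  note ty = tri_ty[OF t]
  \<comment> \<open>Comparison with the injective envelope of \<open>V\<close> shows that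
    \<open>C'\<close> is a retract of an extension of \<open>S\<close> by \<open>B\<close>, hence
    lies in \<G>.\<close>
  obtain N n m' where N: "tri B n N m' S (x \<cdot> e)" "retract C' N" by (rule pushout_retract[OF t J(3) bt(4) qx(1)])
  have BG: "B \<in> \<G>" by (rule G_sum[OF b assms(2) S_G[OF I_S[OF J(1)]]])
  then have CG: "C' \<in> \<G>" using G_retract[OF N(2)] G_ext[OF N(1)] S_G[OF J(2)] by blast
  have "qcoker V B x C (c \<cdot> p)"
    unfolding qcoker_def qepi_def
  proof (intro conjI ballI impI W_G[OF assms(1)] BG m(3) x cmp_HH[OF m(2) bt(3)])
    show "nul V C (c \<cdot> p \<cdot> x)" using assms(3) by (simp add: cmp_assoc qx(2) qcoker_def)
  next
    fix M u assume M: "M \<in> \<G>" "u \<in> H C M" "nul B M (u \<cdot> (c \<cdot> p))"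
    have "nul A M (u \<cdot> (c \<cdot> p) \<cdot> i)" by (rule nul_r[OF M(3) bt(1)])
    then have "nul A M (u \<cdot> c)" using m(2) by (simp add: cmp_assoc be(1))
    then show "nul C M u" using assms(3) M unfolding qcoker_def qepi_def by blast
  next
    fix M h assume M: "M \<in> \<G>" "h \<in> H B M" "nul V M (h \<cdot> x)"
    have hi: "h \<cdot> i \<in> H A M" "h \<cdot> j \<in> H J M" using M bt cmp_HH by blast+
    have "qeq V M (h \<cdot> i \<cdot> m \<^bold>+ h \<cdot> j \<cdot> i0) (h \<cdot> i \<cdot> m)"
      using qeq_addz[OF cmp_HH[OF hi(1) m(1)] nulI[OF tj(1) hi(2) I_S[OF J(1)]]] .
    then have "nul V M ((h \<cdot> i) \<cdot> m)" using M(3) qeq_nul by (simp add: x_def cmp_plus cmp_assoc)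
    then obtain u where u: "u \<in> H C M" "qeq A M (h \<cdot> i) (u \<cdot> c)" using assms(3) M(1) hi(1) unfolding qcoker_def by blast
    have "h = h \<cdot> (i \<cdot> p \<^bold>+ j \<cdot> q)" using be(5) M(2) by simp
    also have "\<dots> = h \<cdot> i \<cdot> p \<^bold>+ h \<cdot> j \<cdot> q" by (simp add: cmp_plus cmp_assoc)
    also have "qeq B M \<dots> (h \<cdot> i \<cdot> p)"
      using qeq_addz[OF cmp_HH[OF hi(1) bt(3)] nulI[OF bt(4) hi(2) I_S[OF J(1)]]] .
    also have "qeq B M (h \<cdot> i \<cdot> p) (u \<cdot> c \<cdot> p)" by (rule qeq_r[OF u(2) bt(3)])
    finally have "qeq B M h (u \<cdot> (c \<cdot> p))" by (simp add: cmp_assoc)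
    then show "\<exists>u \<in> H C M. qeq B M h (u \<cdot> (c \<cdot> p))" using u(1) by blast
  qed
  then have iso: "qiso C' C" using qcoker_unique_qiso qcoker_tri[OF t assms(1) BG CG] by blast
  have ext: "\<exists>k \<in> H B M. k \<cdot> x = h" if s: "qsurj V A m M" "h \<in> H V M" for M h
  proof -
    obtain k where k: "k \<in> H A M" "qeq V M (k \<cdot> m) h" using s unfolding qsurj_def by blast
    have "nul V M (h \<^bold>- k \<cdot> m)" using qeq_sym[OF k(2)] by (simp add: qeq_def)
    then obtain J' a b' where J': "J' \<in> \<I>" "a \<in> H V J'" "b' \<in> H J' M" "h \<^bold>- k \<cdot> m = b' \<cdot> a" by (rule nul_W[OF assms(1)])
    obtain a' where a': "a' \<in> H B J'" "a' \<cdot> x = a" by (rule E0_extend[OF t I_E0[OF J'(1) ty(6)] J'(2)])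
    have "h = k \<cdot> m \<^bold>+ b' \<cdot> a" by (rule minus_eqD[OF s(2) cmp_HH[OF k(1) m(1)] J'(4)])
    then have "(k \<cdot> p \<^bold>+ b' \<cdot> a') \<cdot> x = h" by (simp add: plus_cmp cmp_assoc qx(2) a'(2))
    moreover have "k \<cdot> p \<^bold>+ b' \<cdot> a' \<in> H B M" using k bt J' a' by (blast intro: arrI)
    ultimately show ?thesis by blast
  qed
  show ?thesis by (rule that[OF J(1) b t CG iso]) (use ext in blast)
qed

text \<open>Once E(B, M) = 0, every element of E(C, M) comes from Hom(A, M), and maps that extend to
  \<open>B\<close> kill \<open>d\<close> because \<open>x\<close> does.\<close>

lemma E0_of_extend: assumes "tri A x B y C d" "E0 B M" "\<And>a. a \<in> H A M \<Longrightarrow> \<exists>k \<in> H B M. k \<cdot> x = a" shows "E0 C M"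
  unfolding E0_def
proof
  fix e assume e: "e \<in> E C M"
  note ty = tri_ty[OF assms(1)]
  have "e \<cdot> y = ZE B M" using assms(2) cmp_EH[OF e ty(2)] by (auto simp: E0_def)
  then obtain a where a: "a \<in> H A M" "e = a \<cdot> d" by (rule tri_E_left[OF assms(1) e])
  obtain k where "k \<in> H B M" "k \<cdot> x = a" using assms(3)[OF a(1)] by blast
  then show "e = ZE C M" using tri_xd[OF assms(1)] ty by (simp add: a(2) cmp_assoc flip: \<open>k \<cdot> x = a\<close>)
qed

section \<open>Krull-Schmidt reduction\<close>

lemma local_sum: assumes "local_endo T L" "f \<in> H L L" "g \<in> H L L" "f \<^bold>+ g = idm L"
  shows "(\<exists>h. inverse_pair L L f h) \<or> (\<exists>h. inverse_pair L L g h)"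
proof -
  have L: "L \<in> Ob T" using assms(1) by (simp add: local_endo_def)
  have iso: "\<exists>h. inverse_pair L L (Mor L a L) h" if a: "is_iso T L L a" for a
  proof -
    obtain b where "b \<in> mor T L L" "Comp T L L L b a = Idm T L" "Comp T L L L a b = Idm T L" "a \<in> mor T L L"
      using a by (auto simp: is_iso_def)
    then have "inverse_pair L L (Mor L a L) (Mor L b L)" using L by (simp add: inverse_pair_def H_Mor idm_def)
    then show ?thesis by blast
  qed
  obtain f' g' where f: "f = Mor L f' L" "g = Mor L g' L" "f' \<in> mor T L L" "g' \<in> mor T L L"
    using assms(2,3) by (auto elim!: H_E)
  have "f' \<oplus>\<^bsub>Hom T L L\<^esub> g' = Idm T L" using assms(4) f L by (simp add: H_Mor idm_def)
  moreover have "is_iso T L L (Idm T L)" using L by (auto simp: is_iso_def id_closed id_left)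
  ultimately have "is_iso T L L f' \<or> is_iso T L L g'"
    using assms(1) f(3,4) unfolding local_endo_def by metis
  then show ?thesis using iso f(1,2) by blast
qed

definition decomposition where
  "decomposition X n A i p \<longleftrightarrow>
    (\<forall>a<n. local_endo T (A a) \<and> i a \<in> mor T (A a) X \<and> p a \<in> mor T X (A a)) \<and>
    (\<forall>a<n. \<forall>b<n. Comp T (A b) X (A a) (p a) (i b) =
      (if a = b then Idm T (A a) else \<zero>\<^bsub>Hom T (A b) (A a)\<^esub>)) \<and>
    (\<Oplus>\<^bsub>Hom T X X\<^esub>a\<in>{..<n::nat}. Comp T X (A a) X (i a) (p a)) = Idm T X"

text \<open>Recording the partial sums \<open>s k\<close> of the idempotents replaces the finite sum
  by a recursion, which the induction in \<open>ks_reduce\<close> follows.\<close>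

definition ks_data where
  "ks_data A n L i p s \<longleftrightarrow>
    (\<forall>a<n. local_endo T (L a) \<and> i a \<in> H (L a) A \<and> p a \<in> H A (L a) \<and> p a \<cdot> i a = idm (L a)) \<and>
    (\<forall>a<n. \<forall>b<n. a \<noteq> b \<longrightarrow> p a \<cdot> i b = ZH (L b) (L a)) \<and>
    s 0 = ZH A A \<and> (\<forall>k<n. s (Suc k) = i k \<cdot> p k \<^bold>+ s k) \<and> s n = idm A"

lemma ks_decomp: assumes "A \<in> Ob T"
  obtains n :: nat and L i p s where "ks_data A n L i p s"
proof -
  have "\<forall>X \<in> Ob T. \<exists>n A i p. decomposition X n A i p"
    using ks by (simp add: krull_schmidt_def decomposition_def)
  then obtain n L i p where "decomposition A n L i p" using assms by blast
  then have d: "\<And>a. a < n \<Longrightarrow> local_endo T (L a) \<and> i a \<in> mor T (L a) A \<and> p a \<in> mor T A (L a)"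
    "\<And>a b. a < n \<Longrightarrow> b < n \<Longrightarrow> Comp T (L b) A (L a) (p a) (i b) = (if a = b then Idm T (L a) else \<zero>\<^bsub>Hom T (L b) (L a)\<^esub>)"
    "(\<Oplus>\<^bsub>Hom T A A\<^esub>a\<in>{..<n}. Comp T A (L a) A (i a) (p a)) = Idm T A"
    unfolding decomposition_def by blast+
  have L: "a < n \<Longrightarrow> L a \<in> Ob T" for a using d(1) by (auto simp: local_endo_def)
  have c: "a < n \<Longrightarrow> Comp T A (L a) A (i a) (p a) \<in> mor T A A" for a using d(1) L assms comp_closed by blast
  interpret M: abelian_group "Hom T A A" by (rule abelian_group_hom[OF assms assms])
  define S where "S k = (\<Oplus>\<^bsub>Hom T A A\<^esub>a\<in>{..<k}. Comp T A (L a) A (i a) (p a))" for k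
  have S: "S k \<in> mor T A A" if "k \<le> n" for k
    unfolding S_def using that c by (intro M.finsum_closed) auto
  have S': "S (Suc k) = Comp T A (L k) A (i k) (p k) \<oplus>\<^bsub>Hom T A A\<^esub> S k" if "k < n" for k
    unfolding S_def lessThan_Suc using that c by (subst M.finsum_insert) auto
  have 1: "Mor A (S 0) A = ZH A A" by (simp add: S_def ZH_def)
  have 2: "Mor A (S n) A = idm A" using d(3) by (simp add: S_def idm_def)
  have 3: "Mor A (S (Suc k)) A = Mor (L k) (i k) A \<cdot> Mor A (p k) (L k) \<^bold>+ Mor A (S k) A" if "k < n" for k
    using that d(1)[OF that] L[OF that] assms S'[OF that] S[of k] c[OF that] by (simp add: H_Mor)
  have "ks_data A n L (\<lambda>a. Mor (L a) (i a) A) (\<lambda>a. Mor A (p a) (L a)) (\<lambda>k. Mor A (S k) A)"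
    using 1 2 3 d(1,2) L assms by (simp add: ks_data_def H_Mor idm_def ZH_def)
  then show ?thesis by (rule that)
qed

text \<open>
  Each local summand of \<open>A\<close> is a retract of \<open>B\<close> or vanishes in the quotient; \<open>A'\<close> is the sum of the former.
\<close>

lemma ks_reduce:
  assumes q: "qretract A B" and B: "B \<in> P" and P: "zero_ob \<in> P"
    "\<And>A B Q i j p q. bip A B Q i j p q \<Longrightarrow> A \<in> P \<Longrightarrow> B \<in> P \<Longrightarrow> Q \<in> P"
    "\<And>A B. retract A B \<Longrightarrow> B \<in> P \<Longrightarrow> A \<in> P"
  obtains A' i' p' where "A' \<in> P" "retract A' A" "qinv A' A i' p'"
proof -
  obtain f g S h k where s: "f \<in> H A B" "g \<in> H B A" "S \<in> \<S>" "h \<in> H A S" "k \<in> H S A" "g \<cdot> f \<^bold>+ k \<cdot> h = idm A"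
    by (rule qretract_split[OF q])
  have A: "A \<in> Ob T" using s(1) H_ob by blast
  obtain n :: nat and L i p t where "ks_data A n L i p t" by (rule ks_decomp[OF A])
  then have d: "\<And>a. a < n \<Longrightarrow> local_endo T (L a)" "\<And>a. a < n \<Longrightarrow> i a \<in> H (L a) A" "\<And>a. a < n \<Longrightarrow> p a \<in> H A (L a)"
    "\<And>a. a < n \<Longrightarrow> p a \<cdot> i a = idm (L a)"
    "\<And>a b. a < n \<Longrightarrow> b < n \<Longrightarrow> a \<noteq> b \<Longrightarrow> p a \<cdot> i b = ZH (L b) (L a)"
    "t 0 = ZH A A" "\<And>k. k < n \<Longrightarrow> t (Suc k) = i k \<cdot> p k \<^bold>+ t k" "t n = idm A"
    by (simp_all add: ks_data_def)
  \<comment> \<open>The identity of \<open>A\<close> is a sum of a map through \<open>B\<close> and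
    one through \<open>S\<close>. Cut down to \<open>L a\<close>, it gives two endomorphisms with
    sum the identity, one of which is invertible by locality.\<close>
  have alt: "L a \<in> P \<or> nul A A (i a \<cdot> p a)" if a: "a < n" for a
  proof -
    note da = d(2)[OF a] d(3)[OF a] H_ob[OF d(2)[OF a]]
    have "p a \<cdot> ((g \<cdot> f \<^bold>+ k \<cdot> h) \<cdot> i a) = idm (L a)" using da d(4)[OF a] by (simp add: s(6))
    then have e: "(p a \<cdot> g) \<cdot> (f \<cdot> i a) \<^bold>+ (p a \<cdot> k) \<cdot> (h \<cdot> i a) = idm (L a)" by (simp add: cmp_plus plus_cmp cmp_assoc)
    have m: "p a \<cdot> g \<in> H B (L a)" "f \<cdot> i a \<in> H (L a) B" "p a \<cdot> k \<in> H S (L a)" "h \<cdot> i a \<in> H (L a) S"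
      using s da cmp_HH by blast+
    consider r where "inverse_pair (L a) (L a) ((p a \<cdot> g) \<cdot> (f \<cdot> i a)) r" | r where "inverse_pair (L a) (L a) ((p a \<cdot> k) \<cdot> (h \<cdot> i a)) r"
      using local_sum[OF d(1)[OF a] cmp_HH[OF m(1,2)] cmp_HH[OF m(3,4)] e] by blast
    then show ?thesis
    proof cases
      case 1
      then have "r \<cdot> (p a \<cdot> g) \<cdot> (f \<cdot> i a) = idm (L a)" "r \<cdot> (p a \<cdot> g) \<in> H B (L a)"
        using m cmp_HH by (auto simp: inverse_pair_def cmp_assoc)
      then have "retract (L a) B" using m(2) unfolding retract_def by blast
      then show ?thesis using P(3) B by blast
    next
      case 2
      then have "r \<cdot> ((p a \<cdot> k) \<cdot> (h \<cdot> i a)) = idm (L a)" "r \<in> H (L a) (L a)" by (auto simp: inverse_pair_def)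
      then have "nul (L a) (L a) (idm (L a))" using nul_l[OF nulI[OF m(4,3) s(3)]] by metis
      then have "nul A A (i a \<cdot> (idm (L a) \<cdot> p a))" using nul_l nul_r da by blast
      then show ?thesis using da by simp
    qed
  qed
  \<comment> \<open>Invariant: \<open>A'\<close> accounts for the first \<open>k\<close> summands
    modulo the ideal and is orthogonal to the remaining ones; orthogonality makes the mixed terms
    vanish when the next summand is added.\<close>
  have "k \<le> n \<Longrightarrow> \<exists>A' i' p'. A' \<in> P \<and> i' \<in> H A' A \<and> p' \<in> H A A' \<and> p' \<cdot> i' = idm A' \<and> qeq A A (i' \<cdot> p') (t k) \<and>
      (\<forall>b. k \<le> b \<and> b < n \<longrightarrow> p b \<cdot> i' = ZH A' (L b) \<and> p' \<cdot> i b = ZH (L b) A')" for k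
  proof (induction k)
    case 0
    have "ZH A zero_ob \<cdot> ZH zero_ob A = idm zero_ob" "ZH zero_ob A \<cdot> ZH A zero_ob = ZH A A"
      using A zero_ob_H(1)[OF idm_H[OF zero_ob_Ob]] by simp_all
    moreover have "qeq A A (ZH A A) (ZH A A)" using A ZH_H qeq_refl by blast
    moreover have "p b \<cdot> ZH zero_ob A = ZH zero_ob (L b) \<and> ZH A zero_ob \<cdot> i b = ZH (L b) zero_ob" if "b < n" for b
      using d(2,3)[OF that] by simp
    ultimately show ?case using P(1) A ZH_H[of zero_ob A] ZH_H[of A zero_ob] d(6) by (metis zero_ob_Ob)
  next
    case (Suc k)
    then obtain A' i' p' where I: "A' \<in> P" "i' \<in> H A' A" "p' \<in> H A A'" "p' \<cdot> i' = idm A'" "qeq A A (i' \<cdot> p') (t k)"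
      "\<And>b. k \<le> b \<Longrightarrow> b < n \<Longrightarrow> p b \<cdot> i' = ZH A' (L b) \<and> p' \<cdot> i b = ZH (L b) A'"
      by auto
    have k: "k < n" using Suc by simp
    note dk = d(2)[OF k] d(3)[OF k] H_ob[OF d(2)[OF k]] H_ob[OF I(2)]
    have z: "p k \<cdot> i' = ZH A' (L k)" "p' \<cdot> i k = ZH (L k) A'" using I(6) k by auto
    show ?case
    proof (cases "L k \<in> P")
      case True
      obtain Q a b u v where b: "bip A' (L k) Q a b u v" by (rule bip_ex[OF dk(5) dk(3)])
      note bt = bip_ty[OF b] and be = bip_eq[OF b]
      let ?i = "i' \<cdot> u \<^bold>+ i k \<cdot> v" and ?p = "a \<cdot> p' \<^bold>+ b \<cdot> p k"
      have H: "?i \<in> H Q A" "?p \<in> H A Q" using bt I dk by (blast intro: arrI)+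
      have "?p \<cdot> ?i = a \<cdot> u \<^bold>+ b \<cdot> v"
        using bt dk I(2,3) cmp_HH[OF bt(1,3)] cmp_HH[OF bt(2,4)]
        by (simp add: cmp_plus plus_cmp cmp_assoc cmp_reassoc[OF z(1)] cmp_reassoc[OF z(2)] cmp_reassoc[OF I(4)] cmp_reassoc[OF d(4)[OF k]])
      then have 1: "?p \<cdot> ?i = idm Q" by (simp add: be)
      have "?i \<cdot> ?p = i k \<cdot> p k \<^bold>+ i' \<cdot> p'"
        using bt dk I(2,3) cmp_HH[OF I(2,3)] cmp_HH[OF dk(1,2)]
        by (simp add: cmp_plus plus_cmp cmp_assoc bip_cmp[OF b] plus_commute)
      then have 2: "qeq A A (?i \<cdot> ?p) (t (Suc k))"
        using qeq_add[OF qeq_refl[OF cmp_HH[OF dk(1,2)]] I(5)] d(7)[OF k] by simp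
      have 3: "p c \<cdot> ?i = ZH Q (L c) \<and> ?p \<cdot> i c = ZH (L c) Q" if c: "Suc k \<le> c" "c < n" for c
      proof -
        note dc = d(2)[OF c(2)] d(3)[OF c(2)] H_ob[OF d(2)[OF c(2)]]
        have e: "p c \<cdot> i' = ZH A' (L c)" "p' \<cdot> i c = ZH (L c) A'" "p c \<cdot> i k = ZH (L k) (L c)" "p k \<cdot> i c = ZH (L c) (L k)"
          using I(6)[of c] d(5)[OF c(2) k] d(5)[OF k c(2)] c by auto
        show ?thesis using bt dc dk by (simp add: cmp_plus plus_cmp cmp_assoc e cmp_reassoc[OF e(1)] cmp_reassoc[OF e(3)])
      qed
      show ?thesis using P(2)[OF b I(1) True] H 1 2 3 by blast
    next
      case False
      then have "nul A A (i k \<cdot> p k)" using alt k by blast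
      then have "qeq A A (t k \<^bold>+ i k \<cdot> p k) (t k)" using qeq_addz qeq_H(2)[OF I(5)] by blast
      then have "qeq A A (i' \<cdot> p') (t (Suc k))" using d(7)[OF k] qeq_trans[OF I(5) qeq_sym] by (simp add: plus_commute)
      moreover have "\<forall>b. Suc k \<le> b \<and> b < n \<longrightarrow> p b \<cdot> i' = ZH A' (L b) \<and> p' \<cdot> i b = ZH (L b) A'" using I(6) by auto
      ultimately show ?thesis using I(1-4) by blast
    qed
  qed
  from this[of n] obtain A' i' p' where r: "A' \<in> P" "i' \<in> H A' A" "p' \<in> H A A'" "p' \<cdot> i' = idm A'"
    "qeq A A (i' \<cdot> p') (idm A)"
    using d(8) by auto
  have "qeq A' A' (idm A') (idm A')" using r(2) H_ob idm_H qeq_refl by blast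
  then have "qinv A' A i' p'" using r by (simp add: qinv_def)
  moreover have "retract A' A" using r unfolding retract_def by blast
  ultimately show ?thesis using that r(1) by blast
qed

section \<open>From cotorsion pairs to support tau-tilting subcategories\<close>

text \<open>Mutual orthogonality replaces closure under summands and isomorphisms, so each class
  determines the other; \<open>cot_iff\<close> proves agreement with
  \<open>cotorsion_pair\<close>.\<close>

definition cot where
  "cot X Y \<longleftrightarrow> X = {M \<in> \<G>. \<forall>B \<in> Y. E0 M B} \<and> Y = {N \<in> \<G>. \<forall>A \<in> X. E0 A N} \<and>
    (\<forall>M \<in> \<G>. (\<exists>B \<in> Y. \<exists>A \<in> X. confl B A M) \<and> (\<exists>B \<in> Y. \<exists>A \<in> X. confl M B A))"

definition qbar where "qbar S = {M. \<exists>N \<in> S. qiso N M}"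

definition qbip where
  "qbip A B P i j p q \<longleftrightarrow> A \<in> \<G> \<and> B \<in> \<G> \<and> P \<in> \<G> \<and> i \<in> H A P \<and> j \<in> H B P \<and> p \<in> H P A \<and> q \<in> H P B \<and>
    qeq A A (p \<cdot> i) (idm A) \<and> qeq B B (q \<cdot> j) (idm B) \<and> nul B A (p \<cdot> j) \<and> nul A B (q \<cdot> i) \<and>
    qeq P P (i \<cdot> p \<^bold>+ j \<cdot> q) (idm P)"

definition qproj where
  "qproj P \<longleftrightarrow> P \<in> \<G> \<and> (\<forall>A \<in> \<G>. \<forall>B \<in> \<G>. \<forall>e. qepi A B e \<longrightarrow> (\<forall>f \<in> H P B. \<exists>g \<in> H P A. qeq P B (e \<cdot> g) f))"

text \<open>Support \<tau>-tilting on representing arrows, with right exactness replaced by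
  \<open>qcoker\<close>; agreement with the quotient category is \<open>stt_iff\<close>.\<close>

definition stt where
  "stt M \<longleftrightarrow> M \<subseteq> \<G> \<and> (\<forall>A \<in> M. \<forall>B. qiso A B \<longrightarrow> B \<in> M) \<and>
    (\<forall>Z \<in> \<G>. nul Z Z (idm Z) \<longrightarrow> Z \<in> M) \<and>
    (\<forall>A B P i j p q. qbip A B P i j p q \<and> A \<in> M \<and> B \<in> M \<longrightarrow> P \<in> M) \<and>
    (\<forall>A B P i j p q. qbip A B P i j p q \<and> P \<in> M \<longrightarrow> A \<in> M) \<and>
    (\<forall>N \<in> M. \<exists>W1 \<in> qbar W. \<exists>W0 \<in> qbar W. \<exists>f g. qcoker W1 W0 f N g \<and> (\<forall>M' \<in> M. qsurj W1 W0 f M')) \<and>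
    (\<forall>P. qproj P \<longrightarrow> (\<exists>M0 \<in> M. \<exists>M1 \<in> M. \<exists>m g. qcoker P M0 m M1 g \<and> (\<forall>M' \<in> M. qsurj P M0 m M')))"

lemma cot_X: "cot X Y \<Longrightarrow> M \<in> X \<longleftrightarrow> M \<in> \<G> \<and> (\<forall>B \<in> Y. E0 M B)"
  unfolding cot_def by blast

lemma cot_Y: "cot X Y \<Longrightarrow> M \<in> Y \<longleftrightarrow> M \<in> \<G> \<and> (\<forall>A \<in> X. E0 A M)"
  unfolding cot_def by blast

lemma cot_E0: "cot X Y \<Longrightarrow> A \<in> X \<Longrightarrow> B \<in> Y \<Longrightarrow> E0 A B" using cot_X by blast

lemma cot_l: assumes "cot X Y" "M \<in> \<G>" obtains B x A y d where "B \<in> Y" "A \<in> X" "tri B x A y M d"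
  using assms unfolding cot_def confl_def by blast

lemma cot_r: assumes "cot X Y" "M \<in> \<G>" obtains B x A y d where "B \<in> Y" "A \<in> X" "tri M x B y A d"
  using assms unfolding cot_def confl_def by blast

lemma cot_W: assumes c: "cot X Y" and "V \<in> W" shows "V \<in> X"
  using cot_X[OF c] cot_Y[OF c] W_G[OF assms(2)] E0_W_G[OF assms(2)] by blast

lemma cot_qretract_Y: assumes c: "cot X Y" and "M \<in> \<G>" "qretract M B" "B \<in> Y" shows "M \<in> Y"
  using cot_X[OF c] cot_Y[OF c] E0_qretract[OF assms(3)] assms(2,4) by blast

lemma cot_X_ext: assumes c: "cot X Y" and t: "tri A x B y C d" and "A \<in> X" "C \<in> X" shows "B \<in> X"
  using cot_X[OF c] G_ext[OF t] E0_ext_l[OF t] assms(3,4) by blast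

lemma cot_Y_ext: assumes c: "cot X Y" and t: "tri A x B y C d" and "A \<in> Y" "C \<in> Y" shows "B \<in> Y"
  using cot_Y[OF c] G_ext[OF t] E0_ext_r[OF t] assms(3,4) by blast

lemma cot_Y_quot: assumes c: "cot X Y" and t: "tri A x B y C d" and "A \<in> \<G>" "C \<in> \<G>" "B \<in> Y" shows "C \<in> Y"
  using cot_Y[OF c] cot_X[OF c] E0_G_quotient[OF t assms(3,4)] assms(4,5) by blast

lemma cot_retract_X: assumes c: "cot X Y" and r: "retract A B" and "B \<in> X" shows "A \<in> X"
  using cot_X[OF c] G_retract[OF r] E0_retract_l[OF r] assms(3) by blast

lemma cot_bar: assumes "cot X Y" shows "qbar X \<inter> qbar Y = qbar (X \<inter> Y)"
proof -
  have "N \<in> Y" if "M \<in> Y" "qiso M N" for M N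
    using cot_qretract_Y[OF assms _ qiso_qretract[OF qiso_sym[OF that(2)]] that(1)] that(2) by (simp add: qiso_def)
  then show ?thesis unfolding qbar_def using qiso_sym by blast
qed

lemma cot_bar_Y: assumes c: "cot X Y" and "M \<in> qbar (X \<inter> Y)" shows "M \<in> Y"
proof -
  obtain N where "N \<in> X \<inter> Y" "qiso N M" using assms(2) by (auto simp: qbar_def)
  then show ?thesis using cot_qretract_Y[OF c _ qiso_qretract[OF qiso_sym]] by (auto simp: qiso_def)
qed

lemma cot_W_seq: assumes "cot X Y" "V \<in> W"
  obtains T0 x T1 y d where "T0 \<in> X \<inter> Y" "T1 \<in> X \<inter> Y" "tri V x T0 y T1 d"
proof -
  obtain B x A y d where t: "B \<in> Y" "A \<in> X" "tri V x B y A d" by (rule cot_r[OF assms(1) W_G[OF assms(2)]])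
  have "B \<in> X" using cot_X_ext[OF assms(1) t(3) cot_W[OF assms] t(2)] .
  moreover have "A \<in> Y" using cot_Y_quot[OF assms(1) t(3) W_G[OF assms(2)] _ t(1)] t(2) cot_X[OF assms(1)] by blast
  ultimately show ?thesis using that t by blast
qed

text \<open>Membership in \<open>Y\<close> passes to \<open>A\<close> directly, but for
  \<open>X\<close> only closure under honest retracts is available, so \<open>ks_reduce\<close>
  first removes the summands of \<open>A\<close> that vanish in the quotient.\<close>

lemma cot_bar_qretract: assumes "cot X Y" "A \<in> \<G>" "qretract A B" "B \<in> qbar (X \<inter> Y)" shows "A \<in> qbar (X \<inter> Y)"
proof -
  obtain B' f g where B': "B' \<in> X \<inter> Y" "qinv B' B f g" using assms(4) by (auto simp: qbar_def qiso_def)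
  obtain u v where u: "u \<in> H A B" "v \<in> H B A" "qeq A A (v \<cdot> u) (idm A)" using assms(3) by (auto simp: qretract_def)
  have f: "f \<in> H B' B" "g \<in> H B B'" "qeq B B (f \<cdot> g) (idm B)" using B'(2) by (auto simp: qinv_def)
  have "qeq A A (v \<cdot> ((f \<cdot> g) \<cdot> u)) (v \<cdot> (idm B \<cdot> u))" using qeq_l[OF qeq_r[OF f(3) u(1)] u(2)] .
  then have "qeq A A ((v \<cdot> f) \<cdot> (g \<cdot> u)) (v \<cdot> u)" using u(1) by (simp add: cmp_assoc)
  then have "qeq A A ((v \<cdot> f) \<cdot> (g \<cdot> u)) (idm A)" using u(3) qeq_trans by blast
  then have q: "qretract A B'" using cmp_HH[OF u(2) f(1)] cmp_HH[OF f(2) u(1)] unfolding qretract_def by blast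
  have AY: "A \<in> Y" using cot_qretract_Y[OF assms(1,2) q] B'(1) by blast
  have zX: "zero_ob \<in> X" using cot_W[OF assms(1) zero_ob_W] .
  obtain A' i' p' where A': "A' \<in> X" "retract A' A" "qinv A' A i' p'"
    by (rule ks_reduce[OF q, of X]) (use B'(1) zX cot_X_ext[OF assms(1) tri_zero] cot_retract_X[OF assms(1)] in blast)+
  have "A' \<in> \<G>" using A'(1) cot_X[OF assms(1)] by blast
  then have "qiso A' A" using A'(3) assms(2) by (auto simp: qiso_def)
  moreover have "A' \<in> Y" using cot_qretract_Y[OF assms(1) \<open>A' \<in> \<G>\<close> qiso_qretract[OF \<open>qiso A' A\<close>] AY] .
  ultimately show ?thesis using A'(1) by (auto simp: qbar_def)
qed

text \<open>Projectivity splits the presentation of \<open>P\<close> in the quotient, making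
  \<open>P\<close> a quotient retract of \<open>W0\<close>; \<open>ks_reduce\<close> then finds a
  summand of \<open>P\<close> in \<open>W\<close> with the same image.\<close>

lemma qproj_W: assumes "qproj P" obtains V i p where "V \<in> W" "qinv V P i p"
proof -
  have P: "P \<in> \<G>" using assms by (simp add: qproj_def)
  obtain W1 f W0 g d where t: "W1 \<in> W" "W0 \<in> W" "tri W1 f W0 g P d" by (rule G_tri[OF P])
  have "qepi W0 P g" using qcoker_tri[OF t(3,1) W_G[OF t(2)] P] by (simp add: qcoker_def)
  then obtain s where "s \<in> H P W0" "qeq P P (g \<cdot> s) (idm P)"
    using assms W_G[OF t(2)] idm_H[OF G_Ob[OF P]] unfolding qproj_def by blast
  then have "qretract P W0" using tri_ty(2)[OF t(3)] unfolding qretract_def by blast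
  then show ?thesis by (rule ks_reduce[of P W0 W]) (use t(2) zero_ob_W W_sum W_retract that in blast)+
qed

lemma stt_cot: assumes c: "cot X Y" shows "stt (qbar X \<inter> qbar Y)"
  unfolding cot_bar[OF c] stt_def
proof (intro conjI allI ballI impI)
  let ?M = "qbar (X \<inter> Y)"
  have XG: "A \<in> X \<Longrightarrow> A \<in> \<G>" for A using cot_X[OF c] by blast
  have XM: "A \<in> X \<inter> Y \<Longrightarrow> A \<in> ?M" for A using qiso_refl XG by (auto simp: qbar_def)
  show "?M \<subseteq> \<G>" by (auto simp: qbar_def qiso_def)
  show "B \<in> ?M" if "A \<in> ?M" "qiso A B" for A B using that qiso_trans by (auto simp: qbar_def)
  show "Z \<in> ?M" if Z: "Z \<in> \<G>" "nul Z Z (idm Z)" for Z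
  proof -
    have "zero_ob \<in> X \<inter> Y" using cot_W[OF c zero_ob_W] cot_Y[OF c, of zero_ob] W_G[OF zero_ob_W] XG G_Ob E0_zero_ob by blast
    moreover have "qeq Z Z (ZH zero_ob Z \<cdot> ZH Z zero_ob) (idm Z)"
      using qeq_sym[OF iffD2[OF qeq_zero Z(2)]] G_Ob[OF Z(1)] by simp
    then have "qretract Z zero_ob" using ZH_H[of Z zero_ob] ZH_H[of zero_ob Z] G_Ob[OF Z(1)] zero_ob_Ob unfolding qretract_def by blast
    ultimately show ?thesis using cot_bar_qretract[OF c Z(1)] XM by blast
  qed
  show "A \<in> ?M" if "qbip A B P i j p q \<and> P \<in> ?M" for A B P i j p q
    using that by (intro cot_bar_qretract[OF c, of A P]) (auto simp: qbip_def qretract_def)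
  show "P \<in> ?M" if P: "qbip A B P i j p q \<and> A \<in> ?M \<and> B \<in> ?M" for A B P i j p q
  proof -
    have b: "A \<in> \<G>" "B \<in> \<G>" "P \<in> \<G>" "i \<in> H A P" "j \<in> H B P" "p \<in> H P A" "q \<in> H P B" "qeq P P (i \<cdot> p \<^bold>+ j \<cdot> q) (idm P)"
      using P by (auto simp: qbip_def)
    obtain A0 a a' where A: "A0 \<in> X \<inter> Y" "qinv A A0 a a'" using P by (auto simp: qbar_def qiso_def intro: qinv_sym)
    obtain B0 b b' where B: "B0 \<in> X \<inter> Y" "qinv B B0 b b'" using P by (auto simp: qbar_def qiso_def intro: qinv_sym)
    have a: "a \<in> H A A0" "a' \<in> H A0 A" "qeq A A (a' \<cdot> a) (idm A)" using A(2) by (auto simp: qinv_def)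
    have b': "b \<in> H B B0" "b' \<in> H B0 B" "qeq B B (b' \<cdot> b) (idm B)" using B(2) by (auto simp: qinv_def)
    obtain P0 i0 j0 p0 q0 where b0: "bip A0 B0 P0 i0 j0 p0 q0" using bip_ex A(1) B(1) XG G_Ob by (metis Int_iff)
    note bt = bip_ty[OF b0] and be = bip_eq[OF b0]
    have P0: "P0 \<in> X \<inter> Y" using cot_X_ext[OF c tri_zero[OF b0]] cot_Y_ext[OF c tri_zero[OF b0]] A(1) B(1) by blast
    \<comment> \<open>These maps only have to make \<open>P\<close> a retract of \<open>P0\<close>
      in the quotient, so one composite suffices; \<open>cot_bar_qretract\<close> does the
      rest.\<close>
    let ?f = "i0 \<cdot> a \<cdot> p \<^bold>+ j0 \<cdot> b \<cdot> q" and ?g = "i \<cdot> a' \<cdot> p0 \<^bold>+ j \<cdot> b' \<cdot> q0"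
    have H: "?f \<in> H P P0" "?g \<in> H P0 P" using b a b' bt by (blast intro: arrI)+
    have m: "a \<cdot> p \<in> H P A0" "b \<cdot> q \<in> H P B0" "i \<cdot> a' \<in> H A0 P" "j \<cdot> b' \<in> H B0 P"
      "i \<cdot> (a' \<cdot> (a \<cdot> p)) \<in> H P P" "j \<cdot> (b' \<cdot> (b \<cdot> q)) \<in> H P P" using b a b' cmp_HH by blast+
    have "?g \<cdot> ?f = i \<cdot> (a' \<cdot> (a \<cdot> p)) \<^bold>+ j \<cdot> (b' \<cdot> (b \<cdot> q))"
      using m b a b' bt G_Ob[OF b(3)] by (simp add: cmp_plus plus_cmp cmp_assoc bip_cmp[OF b0])
    also have "qeq P P \<dots> (i \<cdot> p \<^bold>+ j \<cdot> q)"
      using qeq_add[OF qeq_l[OF qeq_cancel_l[OF a(3) b(6) a(2,1)] b(4)] qeq_l[OF qeq_cancel_l[OF b'(3) b(7) b'(2,1)] b(5)]] .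
    also have "qeq P P (i \<cdot> p \<^bold>+ j \<cdot> q) (idm P)" by (rule b(8))
    finally have "qretract P P0" using H unfolding qretract_def by blast
    then show ?thesis using cot_bar_qretract[OF c b(3)] XM P0 by blast
  qed
  show "\<exists>W1 \<in> qbar W. \<exists>W0 \<in> qbar W. \<exists>f g. qcoker W1 W0 f N g \<and> (\<forall>M' \<in> ?M. qsurj W1 W0 f M')" if N: "N \<in> ?M" for N
  proof -
    obtain A a a' where A: "A \<in> X \<inter> Y" "qinv A N a a'" "N \<in> \<G>" using N by (auto simp: qbar_def qiso_def)
    obtain W1 f W0 g d where t: "W1 \<in> W" "W0 \<in> W" "tri W1 f W0 g A d" using G_tri A(1) XG by (metis Int_iff)
    have "qcoker W1 W0 f A g" using qcoker_tri[OF t(3,1) W_G[OF t(2)]] A(1) XG by blast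
    then have "qcoker W1 W0 (idm W0 \<cdot> f \<cdot> idm W1) N (a \<cdot> g \<cdot> idm W0)"
      using qcoker_qiso qinv_idm W_Ob W_G t(1,2) A by blast
    then have "qcoker W1 W0 f N (a \<cdot> g)" using tri_ty[OF t(3)] A(2) by (simp add: cmp_assoc)
    moreover have "qsurj W1 W0 f M'" if M': "M' \<in> ?M" for M'
      unfolding qsurj_def
    proof
      fix h assume h: "h \<in> H W1 M'"
      \<comment> \<open>Although \<open>M'\<close> is only quotient-isomorphic to an object of the
        intersection, it lies in \<open>Y\<close>; so E(A, M') = 0 and maps extend along
        \<open>f\<close> without an error term.\<close>
      have "E0 A M'" using cot_E0[OF c _ cot_bar_Y[OF c M']] A(1) by blast
      then obtain k where "k \<in> H W0 M'" "k \<cdot> f = h" using E0_extend[OF t(3) _ h] by blast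
      then show "\<exists>k \<in> H W0 M'. qeq W1 M' (k \<cdot> f) h" using qeq_refl[OF h] by blast
    qed
    moreover have "W1 \<in> qbar W" "W0 \<in> qbar W" using t(1,2) qiso_refl W_G by (auto simp: qbar_def)
    ultimately show ?thesis by blast
  qed
  show "\<exists>M0 \<in> ?M. \<exists>M1 \<in> ?M. \<exists>m g. qcoker P M0 m M1 g \<and> (\<forall>M' \<in> ?M. qsurj P M0 m M')" if P: "qproj P" for P
  proof -
    obtain V i p where V: "V \<in> W" "qinv V P i p" by (rule qproj_W[OF P])
    have PG: "P \<in> \<G>" using P by (simp add: qproj_def)
    obtain T0 x T1 y d where t: "T0 \<in> X \<inter> Y" "T1 \<in> X \<inter> Y" "tri V x T0 y T1 d" by (rule cot_W_seq[OF c V(1)])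
    note ty = tri_ty[OF t(3)]
    have p: "p \<in> H P V" using V(2) by (simp add: qinv_def)
    have TG: "T0 \<in> \<G>" "T1 \<in> \<G>" using t XG by auto
    have "qcoker P T0 (idm T0 \<cdot> x \<cdot> p) T1 (idm T1 \<cdot> y \<cdot> idm T0)"
      by (rule qcoker_qiso[OF qcoker_tri[OF t(3) V(1) TG] qinv_sym[OF V(2)] qinv_idm[OF ty(5)] qinv_idm[OF ty(6)] PG TG])
    then have 1: "qcoker P T0 (x \<cdot> p) T1 y" using ty by simp
    have 2: "qsurj P T0 (x \<cdot> p) M'" if M': "M' \<in> ?M" for M'
    proof -
      have "E0 T1 M'" using cot_E0[OF c _ cot_bar_Y[OF c M']] t(2) by blast
      have "qsurj V T0 x M'" unfolding qsurj_def
      proof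
        fix h assume h: "h \<in> H V M'"
        obtain k where "k \<in> H T0 M'" "k \<cdot> x = h" by (rule E0_extend[OF t(3) \<open>E0 T1 M'\<close> h])
        then show "\<exists>k \<in> H T0 M'. qeq V M' (k \<cdot> x) h" using qeq_refl[OF h] by blast
      qed
      then have "qsurj P T0 (idm T0 \<cdot> x \<cdot> p) M'" using qsurj_qiso[OF _ ty(1) qinv_sym[OF V(2)] qinv_idm[OF ty(5)]] by blast
      then show ?thesis using ty by simp
    qed
    show ?thesis using 1 2 XM t(1,2) by blast
  qed
qed

text \<open>The class written \<open>T\<close> in the overview; in the code \<open>T\<close> is the
  ambient category.\<close>

definition "core M = {N \<in> M. \<forall>M' \<in> M. E0 N M'}"

text \<open>Gives injectivity, as the right-hand side depends on \<open>M\<close> only. An object of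
  \<open>Y\<close> is a quotient of one in the intersection of the pair, and E(A, -) vanishes there
  for \<open>A\<close> in the core. Conversely, the triangle \<open>N -> B -> A\<close> of the pair
  has \<open>A\<close> in the core and splits.\<close>

lemma cot_recover: assumes c: "cot X Y" defines "M \<equiv> qbar X \<inter> qbar Y"
  shows "Y = {N \<in> \<G>. \<forall>A \<in> core M. E0 A N}"
proof (intro equalityI subsetI CollectI conjI ballI)
  have M: "M = qbar (X \<inter> Y)" by (simp add: M_def cot_bar[OF c])
  have MY: "N \<in> M \<Longrightarrow> N \<in> Y" for N using cot_bar_Y[OF c] M by blast
  have TM: "A \<in> X \<inter> Y \<Longrightarrow> A \<in> M" for A unfolding M using cot_X[OF c] qiso_refl by (auto simp: qbar_def)
  show "N \<in> \<G>" if "N \<in> Y" for N using that cot_Y[OF c] by blast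
  show "E0 A N" if N: "N \<in> Y" and A: "A \<in> core M" for A N
  proof -
    have NG: "N \<in> \<G>" using N cot_Y[OF c] by blast
    obtain B x A' y d where t: "B \<in> Y" "A' \<in> X" "tri B x A' y N d" by (rule cot_l[OF c NG])
    have "A' \<in> Y" by (rule cot_Y_ext[OF c t(3,1) N])
    then have "E0 A A'" using A TM t(2) by (auto simp: core_def)
    then show ?thesis using E0_G_quotient[OF t(3) _ NG] t(1) A MY cot_Y[OF c] by (auto simp: core_def)
  qed
  show "N \<in> Y" if "N \<in> {N \<in> \<G>. \<forall>A \<in> core M. E0 A N}" for N
  proof -
    have N: "N \<in> \<G>" "\<And>A. A \<in> core M \<Longrightarrow> E0 A N" using that by auto
    obtain B x A y d where t: "B \<in> Y" "A \<in> X" "tri N x B y A d" by (rule cot_r[OF c N(1)])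
    have "A \<in> Y" using cot_Y_quot[OF c t(3) N(1) _ t(1)] t(2) cot_X[OF c] by blast
    then have "A \<in> core M" using TM t(2) MY cot_E0[OF c] by (auto simp: core_def)
    then obtain s r where "bip N A B x s r y" using E0_split[OF t(3)] N(2) by blast
    then show ?thesis using cot_qretract_Y[OF c N(1) retract_qretract t(1)] bip_retract(1) by blast
  qed
qed

section \<open>From support tau-tilting subcategories to cotorsion pairs\<close>

lemma bip_qbip: assumes "bip A B P i j p q" "A \<in> \<G>" "B \<in> \<G>" shows "qbip A B P i j p q"
  using bip_ty[OF assms(1)] bip_eq[OF assms(1)] G_sum[OF assms] assms(2,3) idm_H qeq_refl nul_zero
  by (simp add: qbip_def)

lemma W_qproj: "V \<in> W \<Longrightarrow> qproj V"
  unfolding qproj_def using W_projective W_G by metis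

lemma sttD: assumes "stt M" shows "M \<subseteq> \<G>" "\<And>A B. A \<in> M \<Longrightarrow> qiso A B \<Longrightarrow> B \<in> M"
  "\<And>Z. Z \<in> \<G> \<Longrightarrow> nul Z Z (idm Z) \<Longrightarrow> Z \<in> M"
  "\<And>A B P i j p q. qbip A B P i j p q \<Longrightarrow> A \<in> M \<Longrightarrow> B \<in> M \<Longrightarrow> P \<in> M"
  "\<And>A B P i j p q. qbip A B P i j p q \<Longrightarrow> P \<in> M \<Longrightarrow> A \<in> M"
  "\<And>N. N \<in> M \<Longrightarrow> \<exists>W1 \<in> qbar W. \<exists>W0 \<in> qbar W. \<exists>f g. qcoker W1 W0 f N g \<and> (\<forall>M' \<in> M. qsurj W1 W0 f M')"
  "\<And>P. qproj P \<Longrightarrow> \<exists>M0 \<in> M. \<exists>M1 \<in> M. \<exists>m g. qcoker P M0 m M1 g \<and> (\<forall>M' \<in> M. qsurj P M0 m M')"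
  using assms unfolding stt_def by metis+

lemma stt_iso: "stt M \<Longrightarrow> A \<in> M \<Longrightarrow> qiso A B \<Longrightarrow> B \<in> M" by (rule sttD(2))

lemma stt_G: "stt M \<Longrightarrow> A \<in> M \<Longrightarrow> A \<in> \<G>" using sttD(1) by blast

lemma stt_sum: assumes "stt M" "bip A B P i j p q" "A \<in> M" "B \<in> M" shows "P \<in> M"
  using sttD(4)[OF assms(1) bip_qbip[OF assms(2)]] assms(3,4) stt_G[OF assms(1)] by blast

lemma stt_S: assumes "stt M" "S \<in> \<S>" shows "S \<in> M"
  by (rule sttD(3)[OF assms(1) S_G[OF assms(2)] nul_S(1)[OF assms(2) idm_H[OF S_Ob[OF assms(2)]]]])

lemma stt_retract: assumes "stt M" "retract A B" "B \<in> M" shows "A \<in> M"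
proof -
  obtain C i j p q where b: "bip A C B i j p q" by (rule retract_complement[OF wic assms(2)])
  have "A \<in> \<G>" "C \<in> \<G>" using bip_retract[OF b] G_retract stt_G[OF assms(1,3)] by blast+
  then show ?thesis using sttD(5)[OF assms(1) bip_qbip[OF b] assms(3)] by blast
qed

lemma core_rep: assumes "stt M" "N \<in> M" obtains N' where "N' \<in> core M" "qiso N' N"
proof -
  have "\<exists>W1 \<in> qbar W. \<exists>W0 \<in> qbar W. \<exists>f g. qcoker W1 W0 f N g \<and> (\<forall>M' \<in> M. qsurj W1 W0 f M')"
    by (rule sttD(6)[OF assms])
  then obtain W1 W0 f g where w: "W1 \<in> qbar W" "W0 \<in> qbar W" "qcoker W1 W0 f N g"
    "\<And>M'. M' \<in> M \<Longrightarrow> qsurj W1 W0 f M'" by blast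
  obtain V1 a a' where V1: "V1 \<in> W" "qinv V1 W1 a a'" using w(1) by (auto simp: qbar_def qiso_def)
  obtain V0 b b' where V0: "V0 \<in> W" "qinv W0 V0 b b'" using w(2) by (auto simp: qbar_def qiso_def intro: qinv_sym)
  have NG: "N \<in> \<G>" using stt_G[OF assms] .
  have f: "f \<in> H W1 W0" using w(3) by (simp add: qcoker_def)
  have "qcoker V1 V0 (b \<cdot> f \<cdot> a) N (idm N \<cdot> g \<cdot> b')"
    by (rule qcoker_qiso[OF w(3) V1(2) V0(2) qinv_idm[OF G_Ob[OF NG]] W_G[OF V1(1)] W_G[OF V0(1)] NG])
  then obtain J B i j p q x y C' d where r: "J \<in> \<I>" "bip V0 J B i j p q" "tri V1 x B y C' d" "C' \<in> \<G>" "qiso C' N"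
    "\<forall>M. qsurj V1 V0 (b \<cdot> f \<cdot> a) M \<longrightarrow> (\<forall>h \<in> H V1 M. \<exists>k \<in> H B M. k \<cdot> x = h)"
    by (rule qcoker_inflation[OF V1(1) W_G[OF V0(1)]])
  \<comment> \<open>Adding an injective keeps the middle term in \<open>W\<close>, so E(B, -)
    vanishes on \<open>M\<close>, as \<open>E0_of_extend\<close> requires.\<close>
  have BW: "B \<in> W" using W_sum[OF r(2) V0(1)] r(1) inj_W by blast
  have "E0 C' M'" if M': "M' \<in> M" for M'
    by (rule E0_of_extend[OF r(3) E0_W_G[OF BW stt_G[OF assms(1) M']]])
      (use r(6) qsurj_qiso[OF w(4)[OF M'] f V1(2) V0(2)] in blast)
  moreover have "C' \<in> M" using stt_iso[OF assms qiso_sym[OF r(5)]] .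
  ultimately show ?thesis using that[of C'] r(5) by (simp add: core_def)
qed

lemma core_seq: assumes "stt M" "V \<in> W"
  obtains T0 x T1 y d where "T0 \<in> core M" "T1 \<in> core M" "tri V x T0 y T1 d"
proof -
  have "\<exists>M0 \<in> M. \<exists>M1 \<in> M. \<exists>m g. qcoker V M0 m M1 g \<and> (\<forall>M' \<in> M. qsurj V M0 m M')"
    by (rule sttD(7)[OF assms(1) W_qproj[OF assms(2)]])
  then obtain M0 M1 m g where w: "M0 \<in> M" "M1 \<in> M" "qcoker V M0 m M1 g" "\<And>M'. M' \<in> M \<Longrightarrow> qsurj V M0 m M'"
    by blast
  \<comment> \<open>E(M0, -) need not vanish on \<open>M\<close>; a core representative makes it
    vanish for the middle term \<open>B = N \<oplus> J\<close>, as \<open>E0_of_extend\<close>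
    requires.\<close>
  obtain N where "N \<in> core M" "qiso N M0" by (rule core_rep[OF assms(1) w(1)])
  then obtain b b' where N: "N \<in> core M" "qinv M0 N b b'" "N \<in> \<G>" by (auto simp: qiso_def intro: qinv_sym)
  have M1G: "M1 \<in> \<G>" using stt_G[OF assms(1) w(2)] .
  have m: "m \<in> H V M0" using w(3) by (simp add: qcoker_def)
  note oV = qinv_idm[OF W_Ob[OF assms(2)]]
  have "qcoker V N (b \<cdot> m \<cdot> idm V) M1 (idm M1 \<cdot> g \<cdot> b')"
    by (rule qcoker_qiso[OF w(3) oV N(2) qinv_idm[OF G_Ob[OF M1G]] W_G[OF assms(2)] N(3) M1G])
  then obtain J B i j p q x y C' d where r: "J \<in> \<I>" "bip N J B i j p q" "tri V x B y C' d" "C' \<in> \<G>" "qiso C' M1"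
    "\<forall>M. qsurj V N (b \<cdot> m \<cdot> idm V) M \<longrightarrow> (\<forall>h \<in> H V M. \<exists>k \<in> H B M. k \<cdot> x = h)"
    by (rule qcoker_inflation[OF assms(2) N(3)])
  have NM: "N \<in> M" "\<And>M'. M' \<in> M \<Longrightarrow> E0 N M'" using N(1) by (auto simp: core_def)
  have BM: "B \<in> M" using stt_sum[OF assms(1) r(2) NM(1) stt_S[OF assms(1) I_S[OF r(1)]]] .
  have J: "E0 J M'" if "M' \<in> M" for M' using E0_W_G r(1) inj_W stt_G[OF assms(1) that] by blast
  have B: "E0 B M'" if "M' \<in> M" for M' using E0_ext_l[OF tri_zero[OF r(2)] NM(2)[OF that] J[OF that]] .
  have "E0 C' M'" if M': "M' \<in> M" for M'
    by (rule E0_of_extend[OF r(3) B[OF M']]) (use r(6) qsurj_qiso[OF w(4)[OF M'] m oV N(2)] in blast)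
  moreover have "C' \<in> M" using stt_iso[OF assms(1) w(2) qiso_sym[OF r(5)]] .
  ultimately show ?thesis using that[OF _ _ r(3)] BM B by (simp add: core_def)
qed

definition right_perp where "right_perp M = {N \<in> \<G>. \<forall>A \<in> core M. E0 A N}"

definition left_perp where "left_perp M = {A \<in> \<G>. \<forall>N \<in> right_perp M. E0 A N}"

context
  fixes M assumes M: "stt M"
begin

lemma core_perp: "T0 \<in> core M \<Longrightarrow> T0 \<in> left_perp M" "T0 \<in> core M \<Longrightarrow> T0 \<in> right_perp M"
  using stt_G[OF M] by (auto simp: core_def left_perp_def right_perp_def)

lemma stt_right_perp: "N \<in> M \<Longrightarrow> N \<in> right_perp M"
  using stt_G[OF M] by (auto simp: core_def right_perp_def)

lemma cot_stt: "cot (left_perp M) (right_perp M)"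
  unfolding cot_def
proof (intro conjI ballI)
  let ?X = "left_perp M" and ?Y = "right_perp M"
  show "?X = {A \<in> \<G>. \<forall>N \<in> ?Y. E0 A N}" by (rule left_perp_def)
  show "?Y = {N \<in> \<G>. \<forall>A \<in> ?X. E0 A N}"
    using core_perp(1) by (auto simp: left_perp_def right_perp_def)
  fix C assume C: "C \<in> \<G>"
  obtain W1 f W0 g d where t: "W1 \<in> W" "W0 \<in> W" "tri W1 f W0 g C d" by (rule G_tri[OF C])
  show "\<exists>B \<in> ?Y. \<exists>A \<in> ?X. confl B A C"
  proof -
    obtain T0 x T1 y e where T: "T0 \<in> core M" "T1 \<in> core M" "tri W1 x T0 y T1 e" by (rule core_seq[OF M t(1)])
    \<comment> \<open>\<open>D\<close> is an extension of \<open>T1\<close> by \<open>W0\<close>, so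
      E(D, -) vanishes on \<open>right_perp M\<close>, while the kernel of \<open>D -> C\<close> is
      \<open>T0\<close>.\<close>
    obtain D n1 m1 n2 m2 where D: "tri W0 n1 D m1 T1 (f \<cdot> e)" "tri T0 n2 D m2 C (x \<cdot> d)" by (rule pushout[OF t(3) T(3)])
    have T1: "T1 \<in> \<G>" "\<And>N. N \<in> ?Y \<Longrightarrow> E0 T1 N" using core_perp(1)[OF T(2)] by (auto simp: left_perp_def)
    have "E0 D N" if N: "N \<in> ?Y" for N
      using E0_ext_l[OF D(1) E0_W_G[OF t(2)] T1(2)[OF N]] N by (simp add: right_perp_def)
    then have "D \<in> ?X" using G_ext[OF D(1) W_G[OF t(2)] T1(1)] by (simp add: left_perp_def)
    then show ?thesis using core_perp(2)[OF T(1)] D(2) unfolding confl_def by blast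
  qed
  show "\<exists>B \<in> ?Y. \<exists>A \<in> ?X. confl C B A"
  proof -
    obtain T0 x T1 y e where T: "T0 \<in> core M" "T1 \<in> core M" "tri W0 x T0 y T1 e" by (rule core_seq[OF M t(2)])
    \<comment> \<open>For the other approximation the sequence of \<open>W0\<close> is used:
      \<open>Q\<close> is an extension of \<open>T1\<close> by \<open>C\<close>, and as a quotient
      of \<open>T0\<close> it inherits the vanishing of E(A, -) for \<open>A\<close> in the
      core.\<close>
    obtain Q h u v r where Q: "tri W1 (x \<cdot> f) T0 h Q r" "tri C u Q v T1 (g \<cdot> e)" by (rule tri_ET4[OF t(3) T(3)])
    have T1: "T1 \<in> \<G>" using core_perp(1)[OF T(2)] by (auto simp: left_perp_def)
    have QG: "Q \<in> \<G>" by (rule G_ext[OF Q(2) C T1])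
    have "E0 A Q" if A: "A \<in> core M" for A
      using E0_G_quotient[OF Q(1) W_G[OF t(1)] QG] core_perp(2)[OF T(1)] A core_perp(1)[OF A]
      by (simp add: right_perp_def left_perp_def)
    then have "Q \<in> ?Y" using QG by (simp add: right_perp_def)
    then show ?thesis using core_perp(1)[OF T(2)] Q(2) unfolding confl_def by blast
  qed
qed

text \<open>
  For \<open>Z\<close> in the intersection, all triangles built from the approximations of its presentation split,
  which makes \<open>Z\<close> a retract of a sum of two objects of \<open>core M\<close>.
\<close>

lemma perp_core: "left_perp M \<inter> right_perp M = core M"
proof (intro equalityI subsetI)
  show "Z \<in> left_perp M \<inter> right_perp M" if "Z \<in> core M" for Z using that core_perp by blast
  fix Z assume "Z \<in> left_perp M \<inter> right_perp M"
  then have Z: "Z \<in> \<G>" "\<And>N. N \<in> right_perp M \<Longrightarrow> E0 Z N" "\<And>A. A \<in> core M \<Longrightarrow> E0 A Z"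
    by (auto simp: left_perp_def right_perp_def)
  obtain W1 f W0 g d where t: "W1 \<in> W" "W0 \<in> W" "tri W1 f W0 g Z d" by (rule G_tri[OF Z(1)])
  obtain T0 x T1 y e where T: "T0 \<in> core M" "T1 \<in> core M" "tri W0 x T0 y T1 e" by (rule core_seq[OF M t(2)])
  obtain T0' x' T1' y' e' where T': "T0' \<in> core M" "T1' \<in> core M" "tri W1 x' T0' y' T1' e'" by (rule core_seq[OF M t(1)])
  obtain Q h u v r where Q: "tri W1 (x \<cdot> f) T0 h Q r" "tri Z u Q v T1 (g \<cdot> e)" by (rule tri_ET4[OF t(3) T(3)])
  obtain a b where ZQ: "bip Z T1 Q u a b v" by (rule E0_split[OF Q(2) Z(3)[OF T(2)]])
  obtain D n1 m1 n2 m2 where D: "tri T0 n1 D m1 T1' (x \<cdot> f \<cdot> e')" "tri T0' n2 D m2 Q (x' \<cdot> r)"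
    by (rule pushout[OF Q(1) T'(3)])
  have c: "E0 A B" if "A \<in> core M" "B \<in> core M" for A B using that by (auto simp: core_def)
  have "E0 Q T0'" by (rule E0_ext_l[OF Q(2) Z(2)[OF core_perp(2)[OF T'(1)]] c[OF T(2) T'(1)]])
  then obtain a' b' where QD: "bip T0' Q D n2 a' b' m2" by (rule E0_split[OF D(2)])
  obtain a'' b'' where b: "bip T0 T1' D n1 a'' b'' m1" by (rule E0_split[OF D(1) c[OF T'(2) T(1)]])
  have "D \<in> M" using stt_sum[OF M b] T(1) T'(2) by (auto simp: core_def)
  then have "Z \<in> M" using stt_retract[OF M retract_trans[OF bip_retract(1)[OF ZQ] bip_retract(2)[OF QD]]] by blast
  then show "Z \<in> core M" using Z(2) stt_right_perp by (auto simp: core_def)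
qed

lemma qbar_perp: "qbar (left_perp M) \<inter> qbar (right_perp M) = M"
  unfolding cot_bar[OF cot_stt] perp_core
proof (intro equalityI subsetI)
  show "N \<in> M" if "N \<in> qbar (core M)" for N
    using that stt_iso[OF M] by (auto simp: qbar_def core_def)
  show "N \<in> qbar (core M)" if "N \<in> M" for N
    using core_rep[OF M that] by (auto simp: qbar_def)
qed

end

theorem cot_stt_bij: "bij_betw (\<lambda>(X, Y). qbar X \<inter> qbar Y) {(X, Y). cot X Y} {M. stt M}"
  unfolding bij_betw_def
proof
  show "inj_on (\<lambda>(X, Y). qbar X \<inter> qbar Y) {(X, Y). cot X Y}"
  proof (rule inj_onI, clarify)
    fix X Y X' Y' assume c: "cot X Y" "cot X' Y'" and e: "qbar X \<inter> qbar Y = qbar X' \<inter> qbar Y'"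
    have "Y = Y'" using cot_recover[OF c(1)] cot_recover[OF c(2)] e by simp
    moreover have "X = X'" using cot_X[OF c(1)] cot_X[OF c(2)] calculation by blast
    ultimately show "X = X' \<and> Y = Y'" by blast
  qed
  show "(\<lambda>(X, Y). qbar X \<inter> qbar Y) ` {(X, Y). cot X Y} = {M. stt M}"
  proof (intro equalityI subsetI)
    show "M \<in> {M. stt M}" if "M \<in> (\<lambda>(X, Y). qbar X \<inter> qbar Y) ` {(X, Y). cot X Y}" for M
      using that stt_cot by auto
    show "M \<in> (\<lambda>(X, Y). qbar X \<inter> qbar Y) ` {(X, Y). cot X Y}" if "M \<in> {M. stt M}" for M
      using that cot_stt[of M] qbar_perp[of M] by (auto intro!: image_eqI[of _ _ "(left_perp M, right_perp M)"])
  qed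
qed

end

section \<open>Right exact sequences in abelian categories\<close>

context abelian_category
begin

lemma cokernel_right_exact: assumes "A \<in> Ob C" "B \<in> Ob C" "is_cokernel C A B f E g"
  shows "right_exact C A B E f g"
proof -
  have g: "E \<in> Ob C" "g \<in> mor C B E" "f \<in> mor C A B" using assms(3) by (auto simp: is_cokernel_def)
  obtain L k where k: "is_kernel C B E g L k" using ex_kernel[OF assms(2) g(1,2)] by blast
  then have 1: "exact_at C A B E f g" using assms g unfolding exact_at_def by blast
  obtain Z where Z: "zero_object C Z" using ex_zero_object by blast
  then have ZO: "Z \<in> Ob C" by (simp add: zero_object_def)
  note zc = hom_zero_closed[OF g(1) ZO]
  have epi: "h = h'" if "X \<in> Ob C" "h \<in> mor C E X" "h' \<in> mor C E X" "Comp C B E X h g = Comp C B E X h' g" for X h h'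
  proof -
    have "Comp C A B X (Comp C B E X h g) f = Comp C A E X h (Comp C A B E g f)"
      using comp_assoc[OF assms(1,2) g(1) that(1) g(3,2) that(2)] by simp
    also have "\<dots> = \<zero>\<^bsub>Hom C A X\<^esub>" using assms(3) comp_zero_right[OF assms(1) g(1) that(1,2)] by (simp add: is_cokernel_def)
    finally have "\<exists>!u. u \<in> mor C E X \<and> Comp C B E X u g = Comp C B E X h g"
      using assms(3) that comp_closed[OF assms(2) g(1) that(1) g(2) that(2)] unfolding is_cokernel_def by blast
    then show ?thesis using that by metis
  qed
  have 2: "is_cokernel C B E g Z \<zero>\<^bsub>Hom C E Z\<^esub>"
    unfolding is_cokernel_def
  proof (intro conjI ballI impI g ZO zc)
    show "Comp C B E Z \<zero>\<^bsub>Hom C E Z\<^esub> g = \<zero>\<^bsub>Hom C B Z\<^esub>" by (rule comp_zero_left[OF assms(2) g(1) ZO g(2)])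
    fix X h assume X: "X \<in> Ob C" "h \<in> mor C E X" "Comp C B E X h g = \<zero>\<^bsub>Hom C B X\<^esub>"
    have h: "h = \<zero>\<^bsub>Hom C E X\<^esub>"
      using epi[OF X(1,2) hom_zero_closed[OF g(1) X(1)]] X(3) comp_zero_left[OF assms(2) g(1) X(1) g(2)] by simp
    have ex1: "\<exists>!u. u \<in> mor C Z X" using Z X(1) unfolding zero_object_def by blast
    then obtain u where u: "u \<in> mor C Z X" by blast
    then have "Comp C E Z X u \<zero>\<^bsub>Hom C E Z\<^esub> = h" using comp_zero_right[OF g(1) ZO X(1)] h by simp
    then show "\<exists>!u. u \<in> mor C Z X \<and> Comp C E Z X u \<zero>\<^bsub>Hom C E Z\<^esub> = h" using u ex1 by blast
  qed
  have 3: "is_kernel C E Z \<zero>\<^bsub>Hom C E Z\<^esub> E (Idm C E)"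
    unfolding is_kernel_def using zc g ZO id_closed[OF g(1)] id_right[OF g(1) ZO zc] id_left[OF _ g(1)] by auto
  have "exact_at C B E Z g \<zero>\<^bsub>Hom C E Z\<^esub>" unfolding exact_at_def using assms(2) g(1) ZO 2 3 by blast
  then show ?thesis unfolding right_exact_def using 1 Z by blast
qed

text \<open>Exactness makes \<open>g\<close> epic with kernel the image of \<open>f\<close>. As an
  epimorphism, \<open>g\<close> is the cokernel of some \<open>l\<close>, which factors through that
  kernel; a map killing \<open>f\<close> kills the image, hence \<open>l\<close>, and so factors
  through \<open>g\<close>.\<close>

lemma right_exact_cokernel: assumes "right_exact C A B E f g" shows "is_cokernel C A B f E g"
proof -
  obtain Q c I k where q: "is_cokernel C A B f Q c" "is_kernel C B Q c I k" "is_kernel C B E g I k"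
    and o: "A \<in> Ob C" "B \<in> Ob C" "E \<in> Ob C"
    using assms unfolding right_exact_def exact_at_def by blast
  obtain Z Q' c' I' k' where z: "zero_object C Z" "is_cokernel C B E g Q' c'" "is_kernel C E Q' c' I' k'"
    "is_kernel C E Z \<zero>\<^bsub>Hom C E Z\<^esub> I' k'"
    using assms unfolding right_exact_def exact_at_def by blast
  have ZO: "Z \<in> Ob C" using z(1) by (simp add: zero_object_def)
  have q': "Q \<in> Ob C" "c \<in> mor C B Q" "f \<in> mor C A B" "I \<in> Ob C" "k \<in> mor C I B" "g \<in> mor C B E"
    "Comp C A B Q c f = \<zero>\<^bsub>Hom C A Q\<^esub>" "Comp C I B E g k = \<zero>\<^bsub>Hom C I E\<^esub>" "Comp C I B Q c k = \<zero>\<^bsub>Hom C I Q\<^esub>"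
    using q by (auto simp: is_cokernel_def is_kernel_def)
  have z': "Q' \<in> Ob C" "c' \<in> mor C E Q'" "I' \<in> Ob C" "k' \<in> mor C I' E" "Comp C I' E Q' c' k' = \<zero>\<^bsub>Hom C I' Q'\<^esub>"
    using z by (auto simp: is_cokernel_def is_kernel_def)
  obtain u where u: "u \<in> mor C A I" "Comp C A I B k u = f"
    using q(2) o(1) q'(3,7) unfolding is_kernel_def by blast
  have gf: "Comp C A B E g f = \<zero>\<^bsub>Hom C A E\<^esub>"
    using comp_assoc[OF o(1) q'(4) o(2,3) u(1) q'(5,6)] comp_zero_left[OF o(1) q'(4) o(3) u(1)] q'(8) u(2) by simp
  have "Comp C E E Z \<zero>\<^bsub>Hom C E Z\<^esub> (Idm C E) = \<zero>\<^bsub>Hom C E Z\<^esub>"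
    by (rule id_right[OF o(3) ZO hom_zero_closed[OF o(3) ZO]])
  \<comment> \<open>Exactness at \<open>E\<close> makes \<open>k'\<close> also the kernel of a zero
    map, so it has a right inverse \<open>v\<close>; hence \<open>c'\<close>, the cokernel of
    \<open>g\<close>, is zero.\<close>
  then obtain v where v: "v \<in> mor C E I'" "Comp C E I' E k' v = Idm C E"
    using z(4) o(3) id_closed[OF o(3)] unfolding is_kernel_def by blast
  have "c' = Comp C E E Q' c' (Comp C E I' E k' v)" using v(2) id_right[OF o(3) z'(1,2)] by simp
  also have "\<dots> = \<zero>\<^bsub>Hom C E Q'\<^esub>"
    using comp_assoc[OF o(3) z'(3) o(3) z'(1) v(1) z'(4,2)] comp_zero_left[OF o(3) z'(3,1) v(1)] z'(5) by simp
  finally have c': "c' = \<zero>\<^bsub>Hom C E Q'\<^esub>" .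
  have zero: "h = \<zero>\<^bsub>Hom C E X\<^esub>" if X: "X \<in> Ob C" "h \<in> mor C E X" "Comp C B E X h g = \<zero>\<^bsub>Hom C B X\<^esub>" for X h
  proof -
    obtain w where "w \<in> mor C Q' X" "Comp C E Q' X w c' = h" using z(2) X unfolding is_cokernel_def by blast
    then show ?thesis using comp_zero_right[OF o(3) z'(1) X(1)] c' by simp
  qed
  have cancel: "h = h'" if X: "X \<in> Ob C" "h \<in> mor C E X" "h' \<in> mor C E X" "Comp C B E X h g = Comp C B E X h' g" for X h h'
  proof -
    interpret M: abelian_group "Hom C E X" by (rule abelian_group_hom[OF o(3) X(1)])
    interpret N: abelian_group "Hom C B X" by (rule abelian_group_hom[OF o(2) X(1)])
    let ?n = "\<ominus>\<^bsub>Hom C E X\<^esub> h'"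
    have n: "?n \<in> mor C E X" using X(3) by simp
    note cc = comp_closed[OF o(2,3) X(1) q'(6)]
    have "Comp C B E X (h \<oplus>\<^bsub>Hom C E X\<^esub> ?n) g = Comp C B E X (h' \<oplus>\<^bsub>Hom C E X\<^esub> ?n) g"
      using comp_add_left[OF o(2,3) X(1) q'(6)] X n by simp
    also have "\<dots> = \<zero>\<^bsub>Hom C B X\<^esub>" using comp_zero_left[OF o(2,3) X(1) q'(6)] X(3) by (simp add: M.r_neg)
    finally have "h \<oplus>\<^bsub>Hom C E X\<^esub> ?n = \<zero>\<^bsub>Hom C E X\<^esub>" using zero[OF X(1)] X n by simp
    then show ?thesis using X n M.minus_equality[of h ?n] by simp
  qed
  have "is_epi C B E g" unfolding is_epi_def using q'(6) cancel by blast
  then obtain L l where l: "L \<in> Ob C" "is_cokernel C L B l E g" using epi_is_cokernel[OF o(2,3)] by blast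
  have l': "l \<in> mor C L B" "Comp C L B E g l = \<zero>\<^bsub>Hom C L E\<^esub>" using l(2) by (auto simp: is_cokernel_def)
  obtain m where m: "m \<in> mor C L I" "Comp C L I B k m = l" using q(3) l(1) l' unfolding is_kernel_def by blast
  have "\<exists>!u. u \<in> mor C E X \<and> Comp C B E X u g = h"
    if X: "X \<in> Ob C" "h \<in> mor C B X" "Comp C A B X h f = \<zero>\<^bsub>Hom C A X\<^esub>" for X h
  proof -
    obtain w where w: "w \<in> mor C Q X" "Comp C B Q X w c = h" using q(1) X unfolding is_cokernel_def by blast
    have "Comp C I B X h k = Comp C I Q X w (Comp C I B Q c k)"
      using comp_assoc[OF q'(4) o(2) q'(1) X(1) q'(5,2) w(1)] w(2) by simp
    also have "\<dots> = \<zero>\<^bsub>Hom C I X\<^esub>" using q'(9) comp_zero_right[OF q'(4,1) X(1) w(1)] by simp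
    finally have "Comp C L B X h l = \<zero>\<^bsub>Hom C L X\<^esub>"
      using comp_assoc[OF l(1) q'(4) o(2) X(1) m(1) q'(5) X(2)] m(2) comp_zero_left[OF l(1) q'(4) X(1) m(1)] by simp
    then show ?thesis using l(2) X(1,2) unfolding is_cokernel_def by blast
  qed
  then show ?thesis unfolding is_cokernel_def using q' o gf by blast
qed

lemma right_exact_iff: "right_exact C A B E f g \<longleftrightarrow> A \<in> Ob C \<and> B \<in> Ob C \<and> is_cokernel C A B f E g"
proof
  assume r: "right_exact C A B E f g"
  then show "A \<in> Ob C \<and> B \<in> Ob C \<and> is_cokernel C A B f E g"
    using right_exact_cokernel[OF r] unfolding right_exact_def exact_at_def by blast
qed (blast intro: cokernel_right_exact)

end

context two_term_setting
begin

section \<open>The quotient category in terms of arrows\<close>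

abbreviation "\<Q> \<equiv> two_term_quotient T W"

text \<open>The empty set is a default for arrows that are not morphisms.\<close>

fun cls :: "('o, 'm, 'e) arrow \<Rightarrow> 'm set" where
  "cls (Mor A f B) = factor_ideal T \<S> A B +>\<^bsub>Hom T A B\<^esub> f"
| "cls _ = {}"

lemma factor_ideal_iff: assumes "A \<in> Ob T" "B \<in> Ob T"
  shows "f \<in> factor_ideal T \<S> A B \<longleftrightarrow> nul A B (Mor A f B)"
proof
  assume "f \<in> factor_ideal T \<S> A B"
  then obtain S g h where S: "S \<in> \<S>" "g \<in> mor T A S" "h \<in> mor T S B" "f = Comp T A S B h g"
    unfolding factor_ideal_def by blast
  then have "Mor S h B \<cdot> Mor A g S = Mor A f B" "Mor A g S \<in> H A S" "Mor S h B \<in> H S B"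
    using assms S_Ob[OF S(1)] by (simp_all add: H_Mor)
  then show "nul A B (Mor A f B)" using S(1) unfolding nul_def by metis
next
  assume "nul A B (Mor A f B)"
  then obtain S g h where S: "S \<in> \<S>" "g \<in> H A S" "h \<in> H S B" "Mor A f B = h \<cdot> g" unfolding nul_def by blast
  obtain g' h' where "g = Mor A g' S" "g' \<in> mor T A S" "h = Mor S h' B" "h' \<in> mor T S B"
    using S(2,3) by (auto elim!: H_E)
  then have "f = Comp T A S B h' g' \<and> S \<in> \<S> \<and> g' \<in> mor T A S \<and> h' \<in> mor T S B" using S by simp
  then show "f \<in> factor_ideal T \<S> A B" unfolding factor_ideal_def by blast
qed

lemma ideal_subgroup: assumes "A \<in> Ob T" "B \<in> Ob T"
  shows "abelian_subgroup (factor_ideal T \<S> A B) (Hom T A B)"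
proof (rule abelian_subgroupI3)
  show "abelian_group (Hom T A B)" by (rule abelian_group_hom[OF assms])
  then interpret M: abelian_group "Hom T A B" .
  have m: "f \<in> factor_ideal T \<S> A B \<Longrightarrow> Mor A f B \<in> H A B" for f using factor_ideal_iff[OF assms] nul_H by blast
  show "additive_subgroup (factor_ideal T \<S> A B) (Hom T A B)"
    unfolding additive_subgroup_def
  proof (rule M.add.subgroupI)
    show "factor_ideal T \<S> A B \<subseteq> mor T A B" using m by (auto simp: H_Mor)
    show "factor_ideal T \<S> A B \<noteq> {}"
      using factor_ideal_iff[OF assms] nul_zero[OF assms] by (auto simp: ZH_def)
    show "\<ominus>\<^bsub>Hom T A B\<^esub> f \<in> factor_ideal T \<S> A B" if f: "f \<in> factor_ideal T \<S> A B" for f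
    proof -
      have "nul A B (neg (Mor A f B))" using nul_neg factor_ideal_iff[OF assms] f by blast
      then show ?thesis using factor_ideal_iff[OF assms] m[OF f] by simp
    qed
    show "f \<oplus>\<^bsub>Hom T A B\<^esub> g \<in> factor_ideal T \<S> A B" if f: "f \<in> factor_ideal T \<S> A B" "g \<in> factor_ideal T \<S> A B" for f g
    proof -
      have "nul A B (Mor A f B \<^bold>+ Mor A g B)" using nul_add factor_ideal_iff[OF assms] f by blast
      then show ?thesis using factor_ideal_iff[OF assms] m[OF f(1)] m[OF f(2)] by simp
    qed
  qed
qed

section \<open>Operations of the quotient category on cosets\<close>

lemma Q_Ob: "Ob \<Q> = \<G>"
  by (simp add: two_term_quotient_def ideal_quotient_def)

lemma Q_mor: assumes "A \<in> Ob T" "B \<in> Ob T" shows "mor \<Q> A B = cls ` H A B"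
proof -
  have "mor \<Q> A B = a_rcosets\<^bsub>Hom T A B\<^esub> (factor_ideal T \<S> A B)"
    by (simp add: two_term_quotient_def ideal_quotient_def)
  also have "\<dots> = cls ` H A B"
    using assms by (auto simp: A_RCOSETS_def' H_Mor image_iff elim!: H_E) (metis H_Mor cls.simps(1))
  finally show ?thesis .
qed

lemma cls_mem: assumes "f \<in> H A B" "f' \<in> cls f" shows "Mor A f' B \<in> H A B \<and> qeq A B (Mor A f' B) f \<and> cls (Mor A f' B) = cls f"
proof -
  obtain g where g: "f = Mor A g B" "A \<in> Ob T" "B \<in> Ob T" "g \<in> mor T A B" using assms(1) by (rule H_E)
  interpret M: abelian_subgroup "factor_ideal T \<S> A B" "Hom T A B" by (rule ideal_subgroup[OF g(2,3)])
  have m: "f' \<in> factor_ideal T \<S> A B +>\<^bsub>Hom T A B\<^esub> g" using assms(2) g(1) by simp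
  have f': "f' \<in> mor T A B" using M.a_elemrcos_carrier[OF g(4) m] .
  have "f' \<oplus>\<^bsub>Hom T A B\<^esub> \<ominus>\<^bsub>Hom T A B\<^esub> g \<in> factor_ideal T \<S> A B" using M.a_rcos_module[OF g(4) f'] m by simp
  then have "nul A B (Mor A f' B \<^bold>- f)" using g f' group_closed factor_ideal_iff[OF g(2,3)] by (simp add: H_Mor)
  then show ?thesis using M.a_repr_independence'[OF m g(4)] g f' by (simp add: qeq_def H_Mor)
qed

lemma cls_self: assumes "f \<in> H A B" obtains f' where "f = Mor A f' B" "f' \<in> cls f"
proof -
  obtain g where g: "f = Mor A g B" "A \<in> Ob T" "B \<in> Ob T" "g \<in> mor T A B" using assms(1) by (rule H_E)
  interpret M: abelian_subgroup "factor_ideal T \<S> A B" "Hom T A B" by (rule ideal_subgroup[OF g(2,3)])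
  show ?thesis using that g M.a_rcos_self[OF g(4)] by simp
qed

lemma cls_eq: assumes "f \<in> H A B" "g \<in> H A B" shows "cls f = cls g \<longleftrightarrow> qeq A B f g"
proof
  assume "cls f = cls g"
  then show "qeq A B f g" using cls_mem[OF assms(2)] cls_self[OF assms(1)] by metis
next
  assume c: "qeq A B f g"
  obtain f' g' where g: "f = Mor A f' B" "f' \<in> mor T A B" "g = Mor A g' B" "A \<in> Ob T" "B \<in> Ob T" "g' \<in> mor T A B"
    using assms by (auto elim!: H_E)
  interpret M: abelian_subgroup "factor_ideal T \<S> A B" "Hom T A B" by (rule ideal_subgroup[OF g(4,5)])
  have "f' \<oplus>\<^bsub>Hom T A B\<^esub> \<ominus>\<^bsub>Hom T A B\<^esub> g' \<in> factor_ideal T \<S> A B"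
    using c g group_closed factor_ideal_iff[OF g(4,5)] by (simp add: qeq_def H_Mor)
  then have "f' \<in> factor_ideal T \<S> A B +>\<^bsub>Hom T A B\<^esub> g'" using M.a_rcos_module[OF g(6,2)] by simp
  then show "cls f = cls g" using M.a_repr_independence' g by simp
qed

text \<open>Composition in \<open>ideal_quotient\<close> is a union over all pairs of
  representatives; since \<open>qeq\<close> is a congruence, every pair contributes the same
  coset.\<close>

lemma Q_comp: assumes "f \<in> H A B" "g \<in> H B C" shows "Comp \<Q> A B C (cls g) (cls f) = cls (g \<cdot> f)"
proof -
  have e: "factor_ideal T \<S> A C +>\<^bsub>Hom T A C\<^esub> Comp T A B C g' f' = cls (g \<cdot> f)" if m: "g' \<in> cls g" "f' \<in> cls f" for g' f'
  proof -
    note f' = cls_mem[OF assms(1) m(2)] and g' = cls_mem[OF assms(2) m(1)]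
    have "qeq A C (Mor B g' C \<cdot> Mor A f' B) (g \<cdot> f)"
      using qeq_trans[OF qeq_l qeq_r] f' g' assms by blast
    then have "cls (Mor B g' C \<cdot> Mor A f' B) = cls (g \<cdot> f)" using cls_eq qeq_H by blast
    then show ?thesis using f' g' by simp
  qed
  obtain f' g' where "f' \<in> cls f" "g' \<in> cls g" using cls_self assms by metis
  then show ?thesis using e by (auto simp: two_term_quotient_def ideal_quotient_def)
qed

lemma Q_one: "Idm \<Q> A = cls (idm A)"
  by (simp add: two_term_quotient_def ideal_quotient_def idm_def)

lemma Q_zero: assumes "A \<in> Ob T" "B \<in> Ob T" shows "\<zero>\<^bsub>Hom \<Q> A B\<^esub> = cls (ZH A B)"
proof -
  interpret M: abelian_subgroup "factor_ideal T \<S> A B" "Hom T A B" by (rule ideal_subgroup[OF assms])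
  show ?thesis using M.a_coset_add_zero[OF M.a_subset]
    by (simp add: two_term_quotient_def ideal_quotient_def ZH_def)
qed

lemma Q_add: assumes "f \<in> H A B" "g \<in> H A B" shows "cls f \<oplus>\<^bsub>Hom \<Q> A B\<^esub> cls g = cls (f \<^bold>+ g)"
proof -
  obtain f' g' where g: "f = Mor A f' B" "f' \<in> mor T A B" "g = Mor A g' B" "A \<in> Ob T" "B \<in> Ob T" "g' \<in> mor T A B"
    using assms by (auto elim!: H_E)
  interpret M: abelian_subgroup "factor_ideal T \<S> A B" "Hom T A B" by (rule ideal_subgroup[OF g(4,5)])
  show ?thesis using M.a_rcos_sum[OF g(2,6)] g by (simp add: two_term_quotient_def ideal_quotient_def H_Mor)
qed

lemma cot_iff: "cotorsion_pair (full_sub T \<G>) X Y \<longleftrightarrow> cot X Y"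
proof
  let ?F = "full_sub T \<G>"
  have confl: "conflation ?F A B C \<longleftrightarrow> A \<in> \<G> \<and> B \<in> \<G> \<and> C \<in> \<G> \<and> confl A B C" for A B C
    unfolding confl_iff[symmetric] conflation_def etriangle_def full_sub_def using G_Ob by auto
  have bip: "biproduct ?F A B P (i::'m) j p q \<longleftrightarrow> A \<in> \<G> \<and> B \<in> \<G> \<and> P \<in> \<G> \<and> biproduct T A B P i j p q" for A B P i j p q
    unfolding biproduct_def full_sub_def using G_Ob by auto
  have iso: "isomorphic ?F A B \<Longrightarrow> A \<in> \<G> \<and> B \<in> \<G> \<and> retract B A" for A B
  proof -
    assume i: "isomorphic ?F A B"
    then have G: "A \<in> \<G>" "B \<in> \<G>" by (auto simp: isomorphic_def full_sub_def)
    obtain f g where "f \<in> mor T A B" "g \<in> mor T B A" "Comp T B A B f g = Idm T B"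
      using i by (auto simp: isomorphic_def full_sub_def is_iso_def)
    then have "Mor A f B \<in> H A B" "Mor B g A \<in> H B A" "Mor A f B \<cdot> Mor B g A = idm B"
      using G G_Ob by (simp_all add: H_Mor idm_def)
    then show ?thesis using G unfolding retract_def by blast
  qed
  have E: "carrier (Ext ?F A B) = {\<zero>\<^bsub>Ext ?F A B\<^esub>} \<longleftrightarrow> E0 A B" if "A \<in> \<G>" "B \<in> \<G>" for A B
    using E0_iff[of A B] that G_Ob by (simp add: full_sub_def)
  have ob: "Ob ?F = \<G>" by (simp add: full_sub_def)
  {
    assume c: "cotorsion_pair ?F X Y"
    have XY: "X \<subseteq> \<G>" "Y \<subseteq> \<G>" using c by (auto simp: cotorsion_pair_def strict_subcat_def ob)
    have sX: "\<And>A B P i j p q. biproduct ?F A B P i j p q \<Longrightarrow> P \<in> X \<Longrightarrow> A \<in> X"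
      and sY: "\<And>A B P i j p q. biproduct ?F A B P i j p q \<Longrightarrow> P \<in> Y \<Longrightarrow> A \<in> Y"
      using c unfolding cotorsion_pair_def summand_closed_def by blast+
    have s: "\<exists>i j p q. biproduct ?F A B P i j p q" if b: "bip A B P i j p q" "A \<in> \<G>" "B \<in> \<G>" "P \<in> \<G>" for A B P i j p q
    proof -
      obtain i' j' p' q' where "i = Mor A i' P" "j = Mor B j' P" "p = Mor P p' A" "q = Mor P q' B"
        using bip_ty[OF b(1)] by (auto elim!: H_E)
      then have "biproduct ?F A B P i' j' p' q'" using b bip_Mor bip by simp
      then show ?thesis by blast
    qed
    have ext: "E0 A B" if "A \<in> X" "B \<in> Y" for A B
    proof -
      have "carrier (Ext ?F A B) = {\<zero>\<^bsub>Ext ?F A B\<^esub>}" using c that unfolding cotorsion_pair_def by blast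
      then show ?thesis using E[of A B] that XY by blast
    qed
    have res: "\<exists>B \<in> Y. \<exists>A \<in> X. confl B A M" "\<exists>B \<in> Y. \<exists>A \<in> X. confl M B A" if "M \<in> \<G>" for M
      using c that confl unfolding cotorsion_pair_def ob by blast+
    \<comment> \<open>If \<open>M\<close> is orthogonal to \<open>Y\<close>, the triangle
      \<open>B -> A -> M\<close> of the pair splits, and \<open>M\<close> is a summand of an object
      of \<open>X\<close>.\<close>
    have "M \<in> X" if M: "M \<in> \<G>" "\<And>B. B \<in> Y \<Longrightarrow> E0 M B" for M
    proof -
      obtain B A x y d where t: "B \<in> Y" "A \<in> X" "tri B x A y M d" using res(1)[OF M(1)] unfolding confl_def by blast
      obtain u v where b: "bip B M A x u v y" by (rule E0_split[OF t(3) M(2)[OF t(1)]])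
      show ?thesis using s[OF bip_swap[OF b]] sX t M(1) XY by blast
    qed
    moreover have "N \<in> Y" if M: "N \<in> \<G>" "\<And>A. A \<in> X \<Longrightarrow> E0 A N" for N
    proof -
      obtain B A x y d where t: "B \<in> Y" "A \<in> X" "tri N x B y A d" using res(2)[OF M(1)] unfolding confl_def by blast
      obtain u v where b: "bip N A B x u v y" by (rule E0_split[OF t(3) M(2)[OF t(2)]])
      show ?thesis using s[OF b] sY t M(1) XY by blast
    qed
    ultimately show "cot X Y" unfolding cot_def using XY ext res by blast
  next
    assume c: "cot X Y"
    have XY: "X \<subseteq> \<G>" "Y \<subseteq> \<G>" using cot_X[OF c] cot_Y[OF c] by auto
    have rY: "A \<in> Y" if "retract A B" "B \<in> Y" for A B
      using cot_qretract_Y[OF c _ retract_qretract[OF that(1)] that(2)] G_retract[OF that(1)] XY that(2) by blast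
    have retract: "retract A P" if "biproduct ?F A B P i j p q" for A B P i j p q
      using that bip bip_Mor bip_retract(1) by metis
    show "cotorsion_pair ?F X Y"
      unfolding cotorsion_pair_def strict_subcat_def summand_closed_def ob
    proof (intro conjI ballI allI impI XY)
      show "B \<in> X" if "A \<in> X" "isomorphic ?F A B" for A B using cot_retract_X[OF c] iso[OF that(2)] that(1) by blast
      show "B \<in> Y" if "A \<in> Y" "isomorphic ?F A B" for A B using rY iso[OF that(2)] that(1) by blast
      show "A \<in> X" if "biproduct ?F A B P i j p q \<and> P \<in> X" for A B P i j p q using retract cot_retract_X[OF c] that by blast
      show "A \<in> Y" if "biproduct ?F A B P i j p q \<and> P \<in> Y" for A B P i j p q using retract rY that by blast
      show "carrier (Ext ?F A B) = {\<zero>\<^bsub>Ext ?F A B\<^esub>}" if "A \<in> X" "B \<in> Y" for A B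
        using E cot_E0[OF c that] XY that by blast
      show "\<exists>B \<in> Y. \<exists>A \<in> X. conflation ?F B A M" if "M \<in> \<G>" for M
        using c that confl XY unfolding cot_def by blast
      show "\<exists>B \<in> Y. \<exists>A \<in> X. conflation ?F M B A" if "M \<in> \<G>" for M
        using c that confl XY unfolding cot_def by blast
    qed
  }
qed

section \<open>Translation of categorical notions of the quotient to representatives\<close>

lemma Q_memI: "A \<in> \<G> \<Longrightarrow> B \<in> \<G> \<Longrightarrow> f \<in> H A B \<Longrightarrow> cls f \<in> mor \<Q> A B"
  using Q_mor[of A B] G_Ob by auto

lemma Q_memE: assumes "F \<in> mor \<Q> A B" "A \<in> \<G>" "B \<in> \<G>" obtains f where "f \<in> H A B" "F = cls f"
  using assms Q_mor[of A B] G_Ob by auto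

lemma Q_ball: "A \<in> \<G> \<Longrightarrow> B \<in> \<G> \<Longrightarrow> (\<forall>F \<in> mor \<Q> A B. R F) \<longleftrightarrow> (\<forall>f \<in> H A B. R (cls f))"
  using Q_mor[of A B] G_Ob by auto

lemma Q_bex: "A \<in> \<G> \<Longrightarrow> B \<in> \<G> \<Longrightarrow> (\<exists>F \<in> mor \<Q> A B. R F) \<longleftrightarrow> (\<exists>f \<in> H A B. R (cls f))"
  using Q_mor[of A B] G_Ob by auto

lemma cls_cmp_one: "f \<in> H A B \<Longrightarrow> g \<in> H B A \<Longrightarrow> Comp \<Q> A B A (cls g) (cls f) = Idm \<Q> A \<longleftrightarrow> qeq A A (g \<cdot> f) (idm A)"
  using Q_comp[of f A B g A] cls_eq[of "g \<cdot> f" A A "idm A"] cmp_HH idm_H H_ob by (simp add: Q_one)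

lemma cls_zero: "f \<in> H A B \<Longrightarrow> cls f = \<zero>\<^bsub>Hom \<Q> A B\<^esub> \<longleftrightarrow> nul A B f"
  using cls_eq[of f A B "ZH A B"] Q_zero[of A B] ZH_H[of A B] H_ob[of f A B] qeq_zero by simp

lemma cls_cmp_zero: "f \<in> H A B \<Longrightarrow> g \<in> H B C \<Longrightarrow> Comp \<Q> A B C (cls g) (cls f) = \<zero>\<^bsub>Hom \<Q> A C\<^esub> \<longleftrightarrow> nul A C (g \<cdot> f)"
  using Q_comp[of f A B g C] cls_zero[of "g \<cdot> f" A C] cmp_HH by simp

lemma cls_cmp_eq: "f \<in> H A B \<Longrightarrow> g \<in> H B C \<Longrightarrow> h \<in> H A C \<Longrightarrow> Comp \<Q> A B C (cls g) (cls f) = cls h \<longleftrightarrow> qeq A C (g \<cdot> f) h"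
  using Q_comp[of f A B g C] cls_eq[of "g \<cdot> f" A C h] cmp_HH by simp

lemma cls_cmp_eq2: "f \<in> H A B \<Longrightarrow> g \<in> H B C \<Longrightarrow> f' \<in> H A B' \<Longrightarrow> g' \<in> H B' C \<Longrightarrow>
    Comp \<Q> A B C (cls g) (cls f) = Comp \<Q> A B' C (cls g') (cls f') \<longleftrightarrow> qeq A C (g \<cdot> f) (g' \<cdot> f')"
  using Q_comp[of f A B g C] Q_comp[of f' A B' g' C] cls_eq[of "g \<cdot> f" A C "g' \<cdot> f'"] cmp_HH by simp

lemma Q_iso: "isomorphic \<Q> A B \<longleftrightarrow> qiso A B"
proof (cases "A \<in> \<G> \<and> B \<in> \<G>")
  case True
  then have "isomorphic \<Q> A B \<longleftrightarrow> (\<exists>F \<in> mor \<Q> A B. \<exists>G \<in> mor \<Q> B A.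
      Comp \<Q> A B A G F = Idm \<Q> A \<and> Comp \<Q> B A B F G = Idm \<Q> B)"
    by (auto simp: isomorphic_def is_iso_def Q_Ob)
  also have "\<dots> \<longleftrightarrow> (\<exists>f \<in> H A B. \<exists>g \<in> H B A. qeq A A (g \<cdot> f) (idm A) \<and> qeq B B (f \<cdot> g) (idm B))"
    using True by (simp add: Q_bex cls_cmp_one cong: bex_cong)
  finally show ?thesis using True unfolding qiso_def qinv_def by blast
qed (auto simp: isomorphic_def Q_Ob qiso_def)

lemma Q_zero_object: "zero_object \<Q> Z \<longleftrightarrow> Z \<in> \<G> \<and> nul Z Z (idm Z)"
proof
  assume z: "zero_object \<Q> Z"
  then have Z: "Z \<in> \<G>" by (simp add: zero_object_def Q_Ob)
  note o = idm_H[OF G_Ob[OF Z]] ZH_H[OF G_Ob[OF Z] G_Ob[OF Z]]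
  have "cls (idm Z) \<in> mor \<Q> Z Z" "cls (ZH Z Z) \<in> mor \<Q> Z Z" using Q_memI[OF Z Z] o by blast+
  then have "cls (idm Z) = cls (ZH Z Z)" using z Z unfolding zero_object_def Q_Ob by blast
  then show "Z \<in> \<G> \<and> nul Z Z (idm Z)" using Z cls_eq[OF o] qeq_zero by simp
next
  assume Z: "Z \<in> \<G> \<and> nul Z Z (idm Z)"
  have 1: "nul Z A f" if "f \<in> H Z A" for A f using nul_l[of Z Z "idm Z" f A] Z that by simp
  have 2: "nul A Z f" if "f \<in> H A Z" for A f using nul_r[of Z Z "idm Z" f A] Z that by simp
  have "\<exists>!F. F \<in> mor \<Q> Z A" if A: "A \<in> \<G>" for A
  proof (rule ex1I)
    show "cls (ZH Z A) \<in> mor \<Q> Z A" using Z A by (intro Q_memI ZH_H G_Ob) auto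
    show "F = cls (ZH Z A)" if "F \<in> mor \<Q> Z A" for F
      using that Z A 1 cls_zero Q_zero G_Ob by (metis Q_memE)
  qed
  moreover have "\<exists>!F. F \<in> mor \<Q> A Z" if A: "A \<in> \<G>" for A
  proof (rule ex1I)
    show "cls (ZH A Z) \<in> mor \<Q> A Z" using Z A by (intro Q_memI ZH_H G_Ob) auto
    show "F = cls (ZH A Z)" if "F \<in> mor \<Q> A Z" for F
      using that Z A 2 cls_zero Q_zero G_Ob by (metis Q_memE)
  qed
  ultimately show "zero_object \<Q> Z" using Z by (simp add: zero_object_def Q_Ob)
qed

lemma Q_biproduct_qm:
  assumes "i \<in> H A P" "j \<in> H B P" "p \<in> H P A" "q \<in> H P B" "A \<in> \<G>" "B \<in> \<G>" "P \<in> \<G>"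
  shows "biproduct \<Q> A B P (cls i) (cls j) (cls p) (cls q) \<longleftrightarrow> qbip A B P i j p q"
proof -
  have "Comp \<Q> P A P (cls i) (cls p) \<oplus>\<^bsub>Hom \<Q> P P\<^esub> Comp \<Q> P B P (cls j) (cls q) = cls (i \<cdot> p \<^bold>+ j \<cdot> q)"
    using assms Q_comp Q_add cmp_HH by metis
  moreover have "cls (i \<cdot> p \<^bold>+ j \<cdot> q) = Idm \<Q> P \<longleftrightarrow> qeq P P (i \<cdot> p \<^bold>+ j \<cdot> q) (idm P)"
    unfolding Q_one using assms by (intro cls_eq) (blast intro: arrI G_Ob)+
  moreover have "cls i \<in> mor \<Q> A P" "cls j \<in> mor \<Q> B P" "cls p \<in> mor \<Q> P A" "cls q \<in> mor \<Q> P B"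
    using assms by (auto intro: Q_memI)
  ultimately show ?thesis
    unfolding biproduct_def qbip_def Q_Ob
    using assms by (simp add: cls_cmp_one cls_cmp_zero)
qed

lemma Q_biproduct: "biproduct \<Q> A B P i j p q \<Longrightarrow> \<exists>i' j' p' q'. qbip A B P i' j' p' q'"
proof -
  assume b: "biproduct \<Q> A B P i j p q"
  then have G: "A \<in> \<G>" "B \<in> \<G>" "P \<in> \<G>" by (auto simp: biproduct_def Q_Ob)
  have m: "i \<in> mor \<Q> A P" "j \<in> mor \<Q> B P" "p \<in> mor \<Q> P A" "q \<in> mor \<Q> P B"
    using b by (simp_all add: biproduct_def)
  obtain i' where i: "i' \<in> H A P" "i = cls i'" by (rule Q_memE[OF m(1) G(1,3)])
  obtain j' where j: "j' \<in> H B P" "j = cls j'" by (rule Q_memE[OF m(2) G(2,3)])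
  obtain p' where p: "p' \<in> H P A" "p = cls p'" by (rule Q_memE[OF m(3) G(3,1)])
  obtain q' where q: "q' \<in> H P B" "q = cls q'" by (rule Q_memE[OF m(4) G(3,2)])
  have "qbip A B P i' j' p' q'" using Q_biproduct_qm[OF i(1) j(1) p(1) q(1) G] b i j p q by simp
  then show ?thesis by blast
qed

lemma qbip_biproduct: assumes "qbip A B P i j p q" shows "biproduct \<Q> A B P (cls i) (cls j) (cls p) (cls q)"
  using assms Q_biproduct_qm[of i A P j B p q] by (simp add: qbip_def)

lemma Q_biproduct_iff: "(\<exists>i j p q. biproduct \<Q> A B P i j p q) \<longleftrightarrow> (\<exists>i j p q. qbip A B P i j p q)"
  using Q_biproduct qbip_biproduct by meson

lemma qepi_cancel: assumes "qepi B C c" "M \<in> \<G>" "u \<in> H C M" "v \<in> H C M" "qeq B M (u \<cdot> c) (v \<cdot> c)"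
  shows "qeq C M u v"
proof -
  have "nul B M ((u \<^bold>- v) \<cdot> c)" using assms(5) by (simp add: qeq_def plus_cmp neg_cmp)
  moreover have "u \<^bold>- v \<in> H C M" using assms(3,4) by (blast intro: arrI)
  ultimately show ?thesis using assms by (auto simp: qepi_def qeq_def)
qed

lemma Q_epi: assumes "A \<in> \<G>" "B \<in> \<G>" "e \<in> H A B" shows "is_epi \<Q> A B (cls e) \<longleftrightarrow> qepi A B e"
proof -
  have "is_epi \<Q> A B (cls e) \<longleftrightarrow>
      (\<forall>M \<in> \<G>. \<forall>u \<in> H B M. \<forall>v \<in> H B M. qeq A M (u \<cdot> e) (v \<cdot> e) \<longrightarrow> qeq B M u v)"
    using assms by (simp add: is_epi_def Q_Ob Q_memI Q_ball cls_cmp_eq2 cls_eq cong: ball_cong)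
  also have "\<dots> \<longleftrightarrow> qepi A B e"
  proof
    assume c: "\<forall>M \<in> \<G>. \<forall>u \<in> H B M. \<forall>v \<in> H B M. qeq A M (u \<cdot> e) (v \<cdot> e) \<longrightarrow> qeq B M u v"
    have "nul B M u" if M: "M \<in> \<G>" "u \<in> H B M" "nul A M (u \<cdot> e)" for M u
    proof -
      have "qeq A M (u \<cdot> e) (ZH B M \<cdot> e)" using M assms(3) G_Ob qeq_zero by simp
      then have "qeq B M u (ZH B M)" using c M(1,2) ZH_H G_Ob assms(2) by blast
      then show ?thesis using qeq_zero by blast
    qed
    then show "qepi A B e" using assms(3) by (simp add: qepi_def)
  qed (use qepi_cancel in blast)
  finally show ?thesis .
qed

lemma Q_cokernel: assumes "A \<in> \<G>" "B \<in> \<G>" "f \<in> H A B" "C \<in> \<G>" "c \<in> H B C"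
  shows "is_cokernel \<Q> A B (cls f) C (cls c) \<longleftrightarrow> qcoker A B f C c"
proof
  assume k: "is_cokernel \<Q> A B (cls f) C (cls c)"
  have z: "nul A C (c \<cdot> f)" using k cls_cmp_zero[OF assms(3,5)] by (simp add: is_cokernel_def)
  have U: "\<exists>!U. U \<in> mor \<Q> C M \<and> Comp \<Q> B C M U (cls c) = cls h" if M: "M \<in> \<G>" "h \<in> H B M" "nul A M (h \<cdot> f)" for M h
  proof -
    have "cls h \<in> mor \<Q> B M" using assms(2) M by (auto intro: Q_memI)
    moreover have "Comp \<Q> A B M (cls h) (cls f) = \<zero>\<^bsub>Hom \<Q> A M\<^esub>" using cls_cmp_zero[OF assms(3) M(2)] M(3) by simp
    ultimately show ?thesis using k M(1) unfolding is_cokernel_def Q_Ob by blast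
  qed
  have 1: "\<exists>u \<in> H C M. qeq B M h (u \<cdot> c)" if M: "M \<in> \<G>" "h \<in> H B M" "nul A M (h \<cdot> f)" for M h
  proof -
    obtain U' where U': "U' \<in> mor \<Q> C M" "Comp \<Q> B C M U' (cls c) = cls h" using U[OF M] by blast
    obtain u where u: "u \<in> H C M" "U' = cls u" by (rule Q_memE[OF U'(1) assms(4) M(1)])
    have "qeq B M (u \<cdot> c) h" using cls_cmp_eq[OF assms(5) u(1) M(2)] U'(2) u(2) by simp
    then show ?thesis using u(1) qeq_sym by blast
  qed
  \<comment> \<open>Uniqueness is applied to the zero map out of \<open>B\<close>: if
    \<open>u \<cdot> c\<close> is null, the classes of \<open>u\<close> and of zero both factor it
    through \<open>c\<close>.\<close>
  have "qepi B C c"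
    unfolding qepi_def
  proof (intro conjI ballI impI assms(5))
    fix M u assume M: "M \<in> \<G>" "u \<in> H C M" "nul B M (u \<cdot> c)"
    have z: "ZH B M \<in> H B M" "ZH C M \<in> H C M" using ZH_H G_Ob M(1) assms by blast+
    have "nul A M (ZH B M \<cdot> f)" using nul_zero assms(1,3) M(1) G_Ob by simp
    from U[OF M(1) z(1) this] have ex1: "\<exists>!U. U \<in> mor \<Q> C M \<and> Comp \<Q> B C M U (cls c) = cls (ZH B M)" .
    have "Comp \<Q> B C M (cls u) (cls c) = cls (ZH B M)" using cls_cmp_eq[OF assms(5) M(2) z(1)] M(3) qeq_zero by simp
    moreover have "qeq B M (ZH C M \<cdot> c) (ZH B M)" using assms(5) G_Ob[OF M(1)] qeq_refl[OF z(1)] by simp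
    then have "Comp \<Q> B C M (cls (ZH C M)) (cls c) = cls (ZH B M)" using cls_cmp_eq[OF assms(5) z(2,1)] by simp
    moreover have "cls u \<in> mor \<Q> C M" "cls (ZH C M) \<in> mor \<Q> C M" using assms(4) M(1,2) z(2) by (auto intro: Q_memI)
    ultimately have "cls u = cls (ZH C M)" using ex1 by blast
    then show "nul C M u" using cls_eq[OF M(2) z(2)] qeq_zero by simp
  qed
  then show "qcoker A B f C c" unfolding qcoker_def using assms z 1 by blast
next
  assume k: "qcoker A B f C c"
  then have e: "qepi B C c" by (simp add: qcoker_def)
  show "is_cokernel \<Q> A B (cls f) C (cls c)"
    unfolding is_cokernel_def Q_Ob
  proof (intro conjI ballI impI assms(4))
    show "cls f \<in> mor \<Q> A B" "cls c \<in> mor \<Q> B C" using assms by (auto intro: Q_memI)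
    show "Comp \<Q> A B C (cls c) (cls f) = \<zero>\<^bsub>Hom \<Q> A C\<^esub>" using cls_cmp_zero[OF assms(3,5)] k by (simp add: qcoker_def)
    fix M F assume M: "M \<in> \<G>" "F \<in> mor \<Q> B M" "Comp \<Q> A B M F (cls f) = \<zero>\<^bsub>Hom \<Q> A M\<^esub>"
    obtain h where h: "h \<in> H B M" "F = cls h" by (rule Q_memE[OF M(2) assms(2) M(1)])
    have "nul A M (h \<cdot> f)" using M(3) cls_cmp_zero[OF assms(3) h(1)] h(2) by simp
    then obtain u where u: "u \<in> H C M" "qeq B M h (u \<cdot> c)" using k M(1) h(1) unfolding qcoker_def by blast
    show "\<exists>!U. U \<in> mor \<Q> C M \<and> Comp \<Q> B C M U (cls c) = F"
    proof (rule ex1I)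
      show "cls u \<in> mor \<Q> C M \<and> Comp \<Q> B C M (cls u) (cls c) = F"
        using Q_memI[OF assms(4) M(1) u(1)] cls_cmp_eq[OF assms(5) u(1) h(1)] qeq_sym[OF u(2)] h(2) by simp
      fix V assume V: "V \<in> mor \<Q> C M \<and> Comp \<Q> B C M V (cls c) = F"
      then obtain v where v: "v \<in> H C M" "V = cls v" using Q_memE[OF _ assms(4) M(1)] by blast
      have "qeq B M (v \<cdot> c) h" using V v cls_cmp_eq[OF assms(5) v(1) h(1)] h(2) by simp
      then have "qeq C M v u" using qepi_cancel[OF e M(1) v(1) u(1)] qeq_trans u(2) by blast
      then show "V = cls u" using cls_eq[OF v(1) u(1)] v(2) by simp
    qed
  qed
qed

lemma Q_surj: assumes "A \<in> \<G>" "B \<in> \<G>" "f \<in> H A B" "M \<in> \<G>"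
  shows "hom_surj \<Q> A B (cls f) M \<longleftrightarrow> qsurj A B f M"
proof -
  have "Comp \<Q> A B M F (cls f) \<in> mor \<Q> A M" if F: "F \<in> mor \<Q> B M" for F
  proof -
    obtain k where "k \<in> H B M" "F = cls k" by (rule Q_memE[OF F assms(2,4)])
    then show ?thesis using Q_comp[OF assms(3)] cmp_HH assms(3) Q_memI[OF assms(1,4)] by simp
  qed
  then have sub: "(\<lambda>G. Comp \<Q> A B M G (cls f)) ` mor \<Q> B M \<subseteq> mor \<Q> A M" by (rule image_subsetI)
  have "hom_surj \<Q> A B (cls f) M \<longleftrightarrow> mor \<Q> A M \<subseteq> (\<lambda>G. Comp \<Q> A B M G (cls f)) ` mor \<Q> B M"
    unfolding hom_surj_def by (rule iffI, erule equalityD2, rule equalityI[OF sub])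
  also have "\<dots> \<longleftrightarrow> (\<forall>F \<in> mor \<Q> A M. \<exists>G \<in> mor \<Q> B M. Comp \<Q> A B M G (cls f) = F)"
    unfolding subset_iff image_iff by metis
  also have "\<dots> \<longleftrightarrow> qsurj A B f M"
    using assms by (simp add: Q_ball Q_bex cls_cmp_eq qsurj_def cong: ball_cong bex_cong)
  finally show ?thesis .
qed

lemma Q_projective: "projective_object \<Q> P \<longleftrightarrow> qproj P"
proof (cases "P \<in> \<G>")
  case P: True
  have "(\<forall>e. is_epi \<Q> A B e \<longrightarrow> (\<forall>f \<in> mor \<Q> P B. \<exists>g \<in> mor \<Q> P A. Comp \<Q> P A B e g = f)) \<longleftrightarrow>
      (\<forall>e. qepi A B e \<longrightarrow> (\<forall>f \<in> H P B. \<exists>g \<in> H P A. qeq P B (e \<cdot> g) f))" if G: "A \<in> \<G>" "B \<in> \<G>" for A B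
  proof -
    \<comment> \<open>\<open>Q_ball\<close> rewrites bounded quantifiers only, so the membership
      implied by \<open>is_epi\<close> is made explicit first.\<close>
    have "(\<forall>e. is_epi \<Q> A B e \<longrightarrow> (\<forall>f \<in> mor \<Q> P B. \<exists>g \<in> mor \<Q> P A. Comp \<Q> P A B e g = f)) \<longleftrightarrow>
      (\<forall>e \<in> mor \<Q> A B. is_epi \<Q> A B e \<longrightarrow> (\<forall>f \<in> mor \<Q> P B. \<exists>g \<in> mor \<Q> P A. Comp \<Q> P A B e g = f))"
      by (auto simp: is_epi_def)
    also have "\<dots> \<longleftrightarrow> (\<forall>e \<in> H A B. qepi A B e \<longrightarrow> (\<forall>f \<in> H P B. \<exists>g \<in> H P A. qeq P B (e \<cdot> g) f))"
      using P G by (simp add: Q_ball Q_bex Q_epi cls_cmp_eq cong: ball_cong bex_cong)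
    finally show ?thesis by (auto simp: qepi_def)
  qed
  then show ?thesis using P by (simp add: projective_object_def qproj_def Q_Ob)
qed (auto simp: projective_object_def qproj_def Q_Ob)

lemma bar_eq: "bar T W S = qbar S"
  by (simp add: bar_def iso_closure_def qbar_def Q_iso)

text \<open>Abelianness of the quotient enters here: it turns right exactness, which is stated
  through images and kernels, into the cokernel property that triangles provide.\<close>

lemma right_exact_qcoker: assumes "abelian_category K \<Q>"
  shows "right_exact \<Q> A B C F G \<longleftrightarrow> (\<exists>f c. F = cls f \<and> G = cls c \<and> qcoker A B f C c)"
proof
  assume "right_exact \<Q> A B C F G"
  then have k: "A \<in> \<G>" "B \<in> \<G>" "is_cokernel \<Q> A B F C G"
    using abelian_category.right_exact_iff[OF assms] by (auto simp: Q_Ob)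
  then have C: "C \<in> \<G>" "F \<in> mor \<Q> A B" "G \<in> mor \<Q> B C" by (auto simp: is_cokernel_def Q_Ob)
  obtain f where f: "f \<in> H A B" "F = cls f" by (rule Q_memE[OF C(2) k(1,2)])
  obtain c where c: "c \<in> H B C" "G = cls c" by (rule Q_memE[OF C(3) k(2) C(1)])
  have "qcoker A B f C c" using Q_cokernel[OF k(1,2) f(1) C(1) c(1)] k(3) f(2) c(2) by simp
  then show "\<exists>f c. F = cls f \<and> G = cls c \<and> qcoker A B f C c" using f(2) c(2) by blast
next
  assume "\<exists>f c. F = cls f \<and> G = cls c \<and> qcoker A B f C c"
  then obtain f c where f: "F = cls f" "G = cls c" "qcoker A B f C c" by blast
  then have "A \<in> \<G>" "B \<in> \<G>" "C \<in> \<G>" "f \<in> H A B" "c \<in> H B C" by (auto simp: qcoker_def qepi_def)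
  then show "right_exact \<Q> A B C F G"
    using Q_cokernel f abelian_category.right_exact_iff[OF assms] by (simp add: Q_Ob)
qed

lemma presentation_iff: assumes "abelian_category K \<Q>" "M \<subseteq> \<G>"
  shows "(\<exists>f g. right_exact \<Q> A B C f g \<and> (\<forall>N \<in> M. hom_surj \<Q> A B f N)) \<longleftrightarrow>
    (\<exists>f g. qcoker A B f C g \<and> (\<forall>N \<in> M. qsurj A B f N))"
proof -
  have s: "(\<forall>N \<in> M. hom_surj \<Q> A B (cls f) N) \<longleftrightarrow> (\<forall>N \<in> M. qsurj A B f N)" if "qcoker A B f C g" for f g
  proof -
    have o: "A \<in> \<G>" "B \<in> \<G>" "f \<in> H A B" using that by (auto simp: qcoker_def)
    have "hom_surj \<Q> A B (cls f) N \<longleftrightarrow> qsurj A B f N" if "N \<in> M" for N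
      using that assms(2) by (intro Q_surj[OF o]) blast
    then show ?thesis by blast
  qed
  show ?thesis
    unfolding right_exact_qcoker[OF assms(1)] using s by blast
qed

lemma stt_iff: assumes "abelian_category K \<Q>" shows "support_tau_tilting \<Q> (bar T W W) M \<longleftrightarrow> stt M"
proof (cases "M \<subseteq> \<G>")
  case True
  have 1: "strict_subcat \<Q> M \<longleftrightarrow> (\<forall>A \<in> M. \<forall>B. qiso A B \<longrightarrow> B \<in> M)"
    using True by (simp add: strict_subcat_def Q_Ob Q_iso)
  have 2: "sum_closed \<Q> M \<longleftrightarrow> (\<forall>Z \<in> \<G>. nul Z Z (idm Z) \<longrightarrow> Z \<in> M) \<and>
    (\<forall>A B P i j p q. qbip A B P i j p q \<and> A \<in> M \<and> B \<in> M \<longrightarrow> P \<in> M)"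
  proof -
    have "(\<forall>A B P i j p q. biproduct \<Q> A B P i j p q \<and> A \<in> M \<and> B \<in> M \<longrightarrow> P \<in> M) \<longleftrightarrow>
        (\<forall>A B P. (\<exists>i j p q. biproduct \<Q> A B P i j p q) \<and> A \<in> M \<and> B \<in> M \<longrightarrow> P \<in> M)" by blast
    also have "\<dots> \<longleftrightarrow> (\<forall>A B P i j p q. qbip A B P i j p q \<and> A \<in> M \<and> B \<in> M \<longrightarrow> P \<in> M)"
      unfolding Q_biproduct_iff by blast
    finally show ?thesis unfolding sum_closed_def Q_zero_object by blast
  qed
  have 3: "summand_closed \<Q> M \<longleftrightarrow> (\<forall>A B P i j p q. qbip A B P i j p q \<and> P \<in> M \<longrightarrow> A \<in> M)"
  proof -
    have "summand_closed \<Q> M \<longleftrightarrow> (\<forall>A B P. (\<exists>i j p q. biproduct \<Q> A B P i j p q) \<and> P \<in> M \<longrightarrow> A \<in> M)"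
      unfolding summand_closed_def by blast
    then show ?thesis unfolding Q_biproduct_iff by blast
  qed
  have 4: "(\<exists>M0 \<in> M. \<exists>M1 \<in> M. \<exists>m g. right_exact \<Q> P M0 M1 m g \<and> left_approximation \<Q> M P M0 m) \<longleftrightarrow>
    (\<exists>M0 \<in> M. \<exists>M1 \<in> M. \<exists>m g. qcoker P M0 m M1 g \<and> (\<forall>M' \<in> M. qsurj P M0 m M'))" for P
  proof -
    \<comment> \<open>The typing of \<open>m\<close> demanded by \<open>left_approximation\<close>
      is part of right exactness, so only the surjectivity remains.\<close>
    have "right_exact \<Q> P M0 M1 m g \<and> left_approximation \<Q> M P M0 m \<longleftrightarrow>
        right_exact \<Q> P M0 M1 m g \<and> (\<forall>M' \<in> M. hom_surj \<Q> P M0 m M')" if "M0 \<in> M" for M0 M1 m g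
      using that abelian_category.right_exact_iff[OF assms, of P M0 M1 m g]
      by (auto simp: left_approximation_def is_cokernel_def)
    then show ?thesis using presentation_iff[OF assms True] by (metis (no_types, lifting))
  qed
  show ?thesis
    unfolding support_tau_tilting_def tau_rigid_def additive_subcat_def stt_def 1 2 3 4 bar_eq
      presentation_iff[OF assms True] Q_projective
    using True by auto
next
  \<comment> \<open>Outside \<G> both properties fail, so no translation is called for.\<close>
  case False
  then show ?thesis
    by (auto simp: support_tau_tilting_def tau_rigid_def additive_subcat_def strict_subcat_def Q_Ob stt_def)
qed

end

theorem theorem1p3:
  fixes K :: "('k, 'r) ring_scheme"
    and T :: "('o, 'm, 'k, 'e) extri"
    and W :: "'o set"
  assumes "extriangulated_category K T"
    and "krull_schmidt T"
    and "hom_finite K T"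
    and "enough_projectives T"
    and "enough_injectives T"
    and "WIC T"
    and "additive_subcat T W"
    and "two_rigid T W"
    and "injectives T \<subset> W"
    and "abelian_category K (two_term_quotient T W)"
  shows "bij_betw (\<lambda>(X, Y). bar T W X \<inter> bar T W Y)
    {(X, Y). cotorsion_pair (full_sub T (two_term T W)) X Y}
    {M. support_tau_tilting (two_term_quotient T W) (bar T W W) M}"
proof -
  interpret two_term_setting K T W
    using assms by (simp add: two_term_setting_def two_term_setting_axioms_def psubset_imp_subset)
  show ?thesis
    unfolding cot_iff stt_iff[OF assms(10)] unfolding bar_eq by (rule cot_stt_bij)
qed

end
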